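(* Let $\Lambda$ be a $\mathbb Z$-graded algebra over a field $k$. Then $\mathrm{HH}^{*,*}(\Lambda)$ is a bigraded-commutative ring: for $\zeta\in \mathrm{HH}^{m,i}(\Lambda)$ and $\eta\in \mathrm{HH}^{n,j}(\Lambda)$ we have $$\zeta\eta=(-1)^{mn}(-1)^{ij}\,\eta\zeta,$$ where the multiplication is given by the cup product or the Yoneda product.
   Context: $\Lambda^e=\Lambda^{\mathrm{op}}\otimes_k\Lambda$, where $\Lambda^{\mathrm{op}}$ has product $r\cdot r'=(-1)^{|r||r'|}r'r$ and tensor products of graded algebras have product $(r\otimes s)(r'\otimes s')=(-1)^{|r'||s|}rr'\otimes ss'$; graded $(\Lambda,\Lambda)$-bimodules are identified with graded right $\Lambda^e$-modules (with Koszul signs). The graded bar resolution $\mathbb B$ of $\Lambda$ over $\Lambda^e$ is $B_n=\Lambda^{\otimes(n+2)}$ with action $(\lambda_0,\dots,\lambda_{n+1})(\mu,\mu')=(-1)^{|\mu||\lambda_0\cdots\lambda_{n+1}|}(\mu\lambda_0,\lambda_1,\dots,\lambda_n,\lambda_{n+1}\mu')$ and differential $d_n(\lambda_0,\dots,\lambda_{n+1})=\sum_{i=0}^n(-1)^i(\lambda_0,\dots,\lambda_i\lambda_{i+1},\dots,\lambda_{n+1})$. Then $\mathrm{HH}^{s,t}(\Lambda)=H^s(\mathrm{Hom}^t_{\Lambda^e}(\mathbb B,\Lambda))=\mathrm{Ext}^{s,t}_{\Lambda^e}(\Lambda,\Lambda)$, where $\mathrm{Hom}^t$ denotes homogeneous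 maps of degree $t$; $s$ is the cohomological and $t$ the internal degree. For cocycles $\zeta\colon B_m\to\Lambda$ of internal degree $i$ and $\eta\colon B_n\to\Lambda$ of internal degree $j$, the cup product is the class of $$(\zeta\cup\eta)(\lambda_0,\dots,\lambda_{m+n+1})=(-1)^{|(\lambda_0,\dots,\lambda_m)|\, j}\,\zeta(\lambda_0,\dots,\lambda_m,1)\,\eta(1,\lambda_{m+1},\dots,\lambda_{m+n+1}),$$ where $|(\lambda_0,\dots,\lambda_m)|=|\lambda_0|+\dots+|\lambda_m|$. The Yoneda product $\zeta*\eta$ is the class of $\zeta\circ\tilde\eta_m$, where $\tilde\eta\colon\mathbb B\to\bar\Sigma^n\mathbb B$ is a chain map, homogeneous of internal degree $j$, lifting $\eta$, and $\bar\Sigma^n\mathbb B$ is $\mathbb B$ shifted $n$ places without changing signs of the differential. *)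

theory Defs
  imports Complex_Main "HOL-Library.Function_Algebras" "HOL-Algebra.Coset"
begin

section \<open>Tensor powers over a field\<close>

definition multilinear ::
    "('k::field \<Rightarrow> 'a::ab_group_add \<Rightarrow> 'a) \<Rightarrow> ('k \<Rightarrow> 'w::ab_group_add \<Rightarrow> 'w) \<Rightarrow> nat \<Rightarrow> ('a list \<Rightarrow> 'w) \<Rightarrow> bool"
  where
  "multilinear sA sW n f \<longleftrightarrow>
     (\<forall>xs ys x y c. length xs + length ys + 1 = n \<longrightarrow>
        f (xs @ (x + y) # ys) = f (xs @ x # ys) + f (xs @ y # ys) \<and>
        f (xs @ sA c x # ys) = sW c (f (xs @ x # ys)))"

text \<open>The tensor power \<open>A\<^bsup>\<otimes>n\<^esup>\<close> of a vector space \<open>A\<close> is realised inside the dual of the space of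
  \<open>n\<close>-linear forms on \<open>A\<close>: the pure tensor of \<open>xs\<close> is evaluation of \<open>n\<close>-linear forms at \<open>xs\<close>, and
  the tensor power is the span of the pure tensors. Over a field this has the universal property of
  the tensor power, proved below as \<open>tensor_power_universal\<close>.\<close>

type_synonym ('k, 'a) tensor = "('a list \<Rightarrow> 'k) \<Rightarrow> 'k"

definition pure_tensor :: "('k::field \<Rightarrow> 'a::ab_group_add \<Rightarrow> 'a) \<Rightarrow> 'a list \<Rightarrow> ('k, 'a) tensor" where
  "pure_tensor sA xs = (\<lambda>\<phi>. if multilinear sA (*) (length xs) \<phi> then \<phi> xs else 0)"

definition tscale :: "'k::field \<Rightarrow> ('b \<Rightarrow> 'k) \<Rightarrow> 'b \<Rightarrow> 'k" where
  "tscale c f = (\<lambda>x. c * f x)"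

global_interpretation tensor_space: vector_space tscale
  by unfold_locales (auto simp: tscale_def fun_eq_iff algebra_simps)

definition tensor_power :: "('k::field \<Rightarrow> 'a::ab_group_add \<Rightarrow> 'a) \<Rightarrow> nat \<Rightarrow> ('k, 'a) tensor set" where
  "tensor_power sA n = tensor_space.span {pure_tensor sA xs | xs. length xs = n}"

definition linear_on_set ::
    "'v set \<Rightarrow> ('k \<Rightarrow> 'v::ab_group_add \<Rightarrow> 'v) \<Rightarrow> ('k \<Rightarrow> 'w::ab_group_add \<Rightarrow> 'w) \<Rightarrow> ('v \<Rightarrow> 'w) \<Rightarrow> bool"
  where
  "linear_on_set V sV sW f \<longleftrightarrow>
     (\<forall>x\<in>V. \<forall>y\<in>V. f (x + y) = f x + f y) \<and> (\<forall>c. \<forall>x\<in>V. f (sV c x) = sW c (f x))"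

text \<open>Maps out of a subspace are represented by functions on the whole type that vanish off the
  subspace, so that equality of maps is equality of functions.\<close>

definition zero_off :: "'v set \<Rightarrow> ('v \<Rightarrow> 'w::zero) \<Rightarrow> bool" where
  "zero_off V f \<longleftrightarrow> (\<forall>x. x \<notin> V \<longrightarrow> f x = 0)"

lemma multilinear_pure_tensor:
  fixes sA :: "'k::field \<Rightarrow> 'a::ab_group_add \<Rightarrow> 'a"
  shows "multilinear sA tscale n (pure_tensor sA)"
  unfolding multilinear_def
proof (intro allI impI)
  fix xs ys :: "'a list" and x y :: 'a and c :: 'k
  assume n: "length xs + length ys + 1 = n"
  show "pure_tensor sA (xs @ (x + y) # ys) = pure_tensor sA (xs @ x # ys) + pure_tensor sA (xs @ y # ys)
      \<and> pure_tensor sA (xs @ sA c x # ys) = tscale c (pure_tensor sA (xs @ x # ys))"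
    unfolding fun_eq_iff
    by (auto simp: pure_tensor_def tscale_def multilinear_def)
qed

theorem tensor_power_universal:
  fixes sA :: "'k::field \<Rightarrow> 'a::ab_group_add \<Rightarrow> 'a" and sW :: "'k \<Rightarrow> 'w::ab_group_add \<Rightarrow> 'w"
  assumes sW: "vector_space sW" and f: "multilinear sA sW n f"
  shows "\<exists>!g. zero_off (tensor_power sA n) g \<and> linear_on_set (tensor_power sA n) tscale sW g \<and>
           (\<forall>xs. length xs = n \<longrightarrow> g (pure_tensor sA xs) = f xs)"
proof -
  interpret W: vector_space sW by fact
  have vt: "vector_space (tscale :: 'k \<Rightarrow> ('k,'a) tensor \<Rightarrow> _)" by unfold_locales
  have vk: "vector_space ((*) :: 'k \<Rightarrow> 'k \<Rightarrow> 'k)"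
    by unfold_locales (auto simp: algebra_simps)
  interpret TW: vector_space_pair "tscale :: 'k \<Rightarrow> ('k,'a) tensor \<Rightarrow> _" sW
    using vt sW by (simp add: vector_space_pair_def)
  interpret WK: vector_space_pair sW "(*) :: 'k \<Rightarrow> 'k \<Rightarrow> 'k"
    using vk sW by (simp add: vector_space_pair_def)
  define S where "S = {pure_tensor sA xs | xs. length xs = n}"
  let ?T = "tensor_power sA n"
  have T: "?T = tensor_space.span S" by (simp add: tensor_power_def S_def)
  have functional: "\<exists>\<psi>. Vector_Spaces.linear sW (*) \<psi> \<and> \<psi> w \<noteq> 0" if "w \<noteq> 0" for w
  proof -
    have ind: "W.independent {w}" using that by simp
    let ?psi = "WK.construct {w} (\<lambda>_. 1)"
    have "Vector_Spaces.linear sW (*) ?psi" by (rule WK.linear_construct[OF ind])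
    moreover have "?psi w = 1" using WK.construct_basis[OF ind, of w] by simp
    ultimately show ?thesis by (intro exI[of _ ?psi]) simp
  qed
  obtain B where B: "B \<subseteq> S" "tensor_space.independent B" "S \<subseteq> tensor_space.span B"
    using tensor_space.maximal_independent_subset[of S] by blast
  define r where "r b = (SOME xs. length xs = n \<and> pure_tensor sA xs = b)" for b
  have r: "length (r b) = n \<and> pure_tensor sA (r b) = b" if "b \<in> S" for b
  proof -
    have "\<exists>xs. length xs = n \<and> pure_tensor sA xs = b" using that by (auto simp: S_def)
    then show ?thesis unfolding r_def by (rule someI_ex)
  qed
  define g where "g = TW.construct B (\<lambda>b. f (r b))"
  have lin: "Vector_Spaces.linear tscale sW g"
    unfolding g_def by (rule TW.linear_construct[OF B(2)])
  interpret g: Vector_Spaces.linear tscale sW g by (fact lin)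
  have gB: "g b = f (r b)" if "b \<in> B" for b
    unfolding g_def by (rule TW.construct_basis[OF B(2) that])
  have val: "g (pure_tensor sA xs) = f xs" if xs: "length xs = n" for xs
  proof (rule ccontr)
    assume "g (pure_tensor sA xs) \<noteq> f xs"
    then obtain \<psi> where \<psi>: "Vector_Spaces.linear sW (*) \<psi>" "\<psi> (g (pure_tensor sA xs) - f xs) \<noteq> 0"
      using functional[of "g (pure_tensor sA xs) - f xs"] by auto
    interpret psi: Vector_Spaces.linear sW "(*)" \<psi> by (fact \<psi>(1))
    have ml: "multilinear sA (*) n (\<lambda>xs. \<psi> (f xs))"
      using f unfolding multilinear_def by (simp add: psi.add psi.scale)
    define P where "P t \<longleftrightarrow> \<psi> (g t) = t (\<lambda>xs. \<psi> (f xs))" for t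
    have "P t" if "t \<in> tensor_space.span B" for t
      using that
    proof (induction rule: tensor_space.span_induct_alt)
      case base
      have "\<psi> (g 0) = 0" by (simp only: g.zero psi.zero)
      then show ?case by (simp only: P_def func_zero)
    next
      case (step c b t)
      have "b \<in> S" using step B by auto
      then have "b (\<lambda>xs. \<psi> (f xs)) = \<psi> (f (r b))"
        using r[of b] ml by (metis pure_tensor_def)
      then have "\<psi> (g b) = b (\<lambda>xs. \<psi> (f xs))" using step gB by simp
      moreover have "\<psi> (g (tscale c b + t)) = c * \<psi> (g b) + \<psi> (g t)"
        by (simp only: g.add g.scale psi.add psi.scale)
      ultimately show ?case
        using step by (simp only: P_def func_plus tscale_def)
    qed
    moreover have "pure_tensor sA xs \<in> tensor_space.span B"
      using B(3) xs unfolding S_def by auto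
    ultimately have "P (pure_tensor sA xs)" by blast
    then have "\<psi> (g (pure_tensor sA xs)) = pure_tensor sA xs (\<lambda>xs. \<psi> (f xs))" by (simp only: P_def)
    also have "\<dots> = \<psi> (f xs)" using ml xs by (simp add: pure_tensor_def)
    finally have "\<psi> (g (pure_tensor sA xs)) = \<psi> (f xs)" .
    then show False using \<psi>(2) by (simp add: psi.diff)
  qed
  define h where "h t = (if t \<in> ?T then g t else 0)" for t
  have closed: "x + y \<in> ?T" "tscale c x \<in> ?T" if "x \<in> ?T" "y \<in> ?T" for x y c
    using that unfolding T by (auto intro: tensor_space.span_add tensor_space.span_scale)
  have mem: "pure_tensor sA xs \<in> ?T" if "length xs = n" for xs
    unfolding T by (rule tensor_space.span_base) (use that in \<open>auto simp: S_def\<close>)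
  show ?thesis
  proof (rule ex1I[of _ h], intro conjI allI impI)
    show "zero_off ?T h" by (simp add: zero_off_def h_def)
    show "linear_on_set ?T tscale sW h"
      using closed by (auto simp: linear_on_set_def h_def g.add g.scale)
    show "h (pure_tensor sA xs) = f xs" if "length xs = n" for xs
      using that mem val by (simp add: h_def)
  next
    fix h' assume h': "zero_off ?T h' \<and> linear_on_set ?T tscale sW h' \<and>
      (\<forall>xs. length xs = n \<longrightarrow> h' (pure_tensor sA xs) = f xs)"
    have "h' t = g t" if "t \<in> ?T" for t
    proof -
      have "t \<in> tensor_space.span S" using that T by simp
      then have "Q t" if Q: "\<And>t. Q t = (t \<in> ?T \<and> h' t = g t)" for Q
      proof (induction rule: tensor_space.span_induct_alt)
        case base
        have z: "0 \<in> ?T" unfolding T by (rule tensor_space.span_zero)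
        have "h' (0 + 0) = h' 0 + h' 0" using h' z unfolding linear_on_set_def by blast
        then have "h' 0 = g 0" using g.zero by simp
        then show ?case using z Q by blast
      next
        case (step c b t)
        then obtain xs where xs: "b = pure_tensor sA xs" "length xs = n" by (auto simp: S_def)
        have b: "b \<in> ?T" "h' b = g b" using mem h' val xs by auto
        have t: "t \<in> ?T" "h' t = g t" using step Q by auto
        have "h' (tscale c b + t) = h' (tscale c b) + h' t"
          using h' t b closed unfolding linear_on_set_def by blast
        also have "h' (tscale c b) = sW c (h' b)"
          using h' b unfolding linear_on_set_def by blast
        finally have "h' (tscale c b + t) = g (tscale c b + t)"
          using b t by (simp only: g.add g.scale)
        then show ?case using t b closed Q by blast
      qed
      then show ?thesis by simp
    qed
    then show "h' = h" using h' by (auto simp: fun_eq_iff h_def zero_off_def)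
  qed
qed


section \<open>Bigraded rings\<close>

text \<open>A bigraded ring is a family of abelian groups \<open>H s t\<close> together with a biadditive, associative
  and unital multiplication \<open>M s t p q\<close> from \<open>H s t\<close> and \<open>H p q\<close> to \<open>H (s + p) (t + q)\<close>. The
  additive groups \<open>H s t\<close> are records of \<^theory>\<open>HOL-Algebra.Group\<close>, which are written
  multiplicatively, so \<open>\<otimes>\<^bsub>H s t\<^esub>\<close> is addition and \<open>[^]\<^bsub>H s t\<^esub>\<close> is the integer multiple.\<close>

definition bigraded_ring ::
    "(nat \<Rightarrow> int \<Rightarrow> 'x monoid) \<Rightarrow> (nat \<Rightarrow> int \<Rightarrow> nat \<Rightarrow> int \<Rightarrow> 'x \<Rightarrow> 'x \<Rightarrow> 'x) \<Rightarrow> bool"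
  where
  "bigraded_ring H M \<longleftrightarrow>
     (\<forall>s t. comm_group (H s t)) \<and>
     (\<forall>s t p q. \<forall>x\<in>carrier (H s t). \<forall>y\<in>carrier (H p q).
        M s t p q x y \<in> carrier (H (s + p) (t + q))) \<and>
     (\<forall>s t p q. \<forall>x\<in>carrier (H s t). \<forall>x'\<in>carrier (H s t). \<forall>y\<in>carrier (H p q).
        M s t p q (x \<otimes>\<^bsub>H s t\<^esub> x') y =
          M s t p q x y \<otimes>\<^bsub>H (s + p) (t + q)\<^esub> M s t p q x' y) \<and>
     (\<forall>s t p q. \<forall>x\<in>carrier (H s t). \<forall>y\<in>carrier (H p q). \<forall>y'\<in>carrier (H p q).
        M s t p q x (y \<otimes>\<^bsub>H p q\<^esub> y') =
          M s t p q x y \<otimes>\<^bsub>H (s + p) (t + q)\<^esub> M s t p q x y') \<and>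
     (\<forall>s t p q u v. \<forall>x\<in>carrier (H s t). \<forall>y\<in>carrier (H p q). \<forall>z\<in>carrier (H u v).
        M (s + p) (t + q) u v (M s t p q x y) z = M s t (p + u) (q + v) x (M p q u v y z)) \<and>
     (\<exists>e\<in>carrier (H 0 0). \<forall>s t. \<forall>x\<in>carrier (H s t). M 0 0 s t e x = x \<and> M s t 0 0 x e = x)"

definition bigraded_commutative_ring ::
    "(nat \<Rightarrow> int \<Rightarrow> 'x monoid) \<Rightarrow> (nat \<Rightarrow> int \<Rightarrow> nat \<Rightarrow> int \<Rightarrow> 'x \<Rightarrow> 'x \<Rightarrow> 'x) \<Rightarrow> bool"
  where
  "bigraded_commutative_ring H M \<longleftrightarrow>
     bigraded_ring H M \<and>
     (\<forall>m i n j. \<forall>\<zeta>\<in>carrier (H m i). \<forall>\<eta>\<in>carrier (H n j).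
        M m i n j \<zeta> \<eta> =
          M n j m i \<eta> \<zeta> [^]\<^bsub>H (m + n) (i + j)\<^esub> ((-1) ^ (m * n) * (-1) ^ nat \<bar>i * j\<bar> :: int))"


section \<open>Hochschild cohomology of a graded algebra\<close>

record ('k, 'r, 'v) graded_right_module =
  elts :: "'v set"
  homog :: "int \<Rightarrow> 'v set"
  kscale :: "'k \<Rightarrow> 'v \<Rightarrow> 'v"
  act :: "'v \<Rightarrow> 'r \<Rightarrow> 'v"

text \<open>The sort of \<open>'a\<close> is that of unital rings in which \<open>1 = 0\<close> is not excluded.\<close>

locale graded_algebra = vector_space scale
  for scale :: "'k::field \<Rightarrow> 'a::{ring,monoid_mult} \<Rightarrow> 'a" +
  fixes gr :: "int \<Rightarrow> 'a set"
  assumes scale_mult_left: "scale c (x * y) = scale c x * y"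
    and scale_mult_right: "scale c (x * y) = x * scale c y"
    and gr_subspace: "subspace (gr t)"
    and gr_direct_sum:
      "\<exists>!c. (\<forall>t. c t \<in> gr t) \<and> finite {t. c t \<noteq> 0} \<and> x = (\<Sum>t | c t \<noteq> 0. c t)"
    and gr_one: "1 \<in> gr 0"
    and gr_mult: "x \<in> gr s \<Longrightarrow> y \<in> gr t \<Longrightarrow> x * y \<in> gr (s + t)"
begin

definition component :: "'a \<Rightarrow> int \<Rightarrow> 'a" where
  "component x =
     (THE c. (\<forall>t. c t \<in> gr t) \<and> finite {t. c t \<noteq> 0} \<and> x = (\<Sum>t | c t \<noteq> 0. c t))"

abbreviation tensor :: "'a list \<Rightarrow> ('k, 'a) tensor" where
  "tensor \<equiv> pure_tensor scale"

abbreviation tpow :: "nat \<Rightarrow> ('k, 'a) tensor set" where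
  "tpow \<equiv> tensor_power scale"

definition has_degrees :: "'a list \<Rightarrow> int list \<Rightarrow> bool" where
  "has_degrees xs ts \<longleftrightarrow> list_all2 (\<lambda>x t. x \<in> gr t) xs ts"

text \<open>The linear map on \<open>tpow n\<close> whose value on a pure tensor of homogeneous elements \<open>xs\<close> of
  degrees \<open>ts\<close> is \<open>F xs ts\<close>. It is only used for \<open>F\<close> additive and homogeneous in each entry of
  \<open>xs\<close> (for fixed \<open>ts\<close>), and then it exists and is unique.\<close>

definition lift ::
    "nat \<Rightarrow> ('k \<Rightarrow> 'w::ab_group_add \<Rightarrow> 'w) \<Rightarrow> ('a list \<Rightarrow> int list \<Rightarrow> 'w) \<Rightarrow> ('k, 'a) tensor \<Rightarrow> 'w"
  where
  "lift n sW F =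
     (THE g. zero_off (tpow n) g \<and> linear_on_set (tpow n) tscale sW g \<and>
        (\<forall>xs ts. length xs = n \<and> has_degrees xs ts \<longrightarrow> g (tensor xs) = F xs ts))"

text \<open>\<open>\<Lambda>\<^sup>e = \<Lambda>\<^sup>o\<^sup>p \<otimes> \<Lambda>\<close> has underlying space \<open>tpow 2\<close>. The action of \<open>r \<in> \<Lambda>\<^sup>e\<close> on the bar
  module \<open>B\<^sub>n\<close> and on \<open>\<Lambda>\<close> is the bilinear extension of the formulas for \<open>r = \<mu> \<otimes> \<mu>'\<close>.\<close>

definition bar_act :: "nat \<Rightarrow> ('k, 'a) tensor \<Rightarrow> ('k, 'a) tensor \<Rightarrow> ('k, 'a) tensor" where
  "bar_act n x r =
     lift (n + 2) tscale
       (\<lambda>xs ts. lift 2 tscale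
          (\<lambda>ms ps. tscale ((-1) powi (ps ! 0 * sum_list ts))
             (tensor ((ms ! 0 * hd xs) # butlast (tl xs) @ [last xs * ms ! 1]))) r) x"

definition algebra_act :: "'a \<Rightarrow> ('k, 'a) tensor \<Rightarrow> 'a" where
  "algebra_act x r =
     (\<Sum>t | component x t \<noteq> 0.
        lift 2 scale
          (\<lambda>ms ps. scale ((-1) powi (ps ! 0 * t)) (ms ! 0 * component x t * ms ! 1)) r)"

definition bar :: "nat \<Rightarrow> ('k, ('k, 'a) tensor, ('k, 'a) tensor) graded_right_module" where
  "bar n =
     \<lparr>elts = tpow (n + 2),
      homog = (\<lambda>u. tensor_space.span
        {tensor xs | xs. length xs = n + 2 \<and> (\<exists>ts. has_degrees xs ts \<and> sum_list ts = u)}),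
      kscale = tscale,
      act = bar_act n\<rparr>"

definition algebra_module :: "('k, ('k, 'a) tensor, 'a) graded_right_module" where
  "algebra_module = \<lparr>elts = UNIV, homog = gr, kscale = scale, act = algebra_act\<rparr>"

definition Hom ::
    "int \<Rightarrow> ('k, ('k, 'a) tensor, 'v::ab_group_add) graded_right_module \<Rightarrow>
     ('k, ('k, 'a) tensor, 'w::ab_group_add) graded_right_module \<Rightarrow> ('v \<Rightarrow> 'w) set"
  where
  "Hom t M N =
     {f. zero_off (elts M) f \<and> f ` elts M \<subseteq> elts N \<and>
         linear_on_set (elts M) (kscale M) (kscale N) f \<and>
         (\<forall>u. f ` homog M u \<subseteq> homog N (u + t)) \<and>
         (\<forall>x\<in>elts M. \<forall>r\<in>tpow 2. f (act M x r) = act N (f x) r)}"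

text \<open>\<open>bar_d n\<close> is the differential \<open>B\<^sub>n \<rightarrow> B\<^bsub>n-1\<^esub>\<close> for \<open>n \<ge> 1\<close>; in degree \<open>0\<close> the augmentation
  \<open>B\<^sub>0 \<rightarrow> \<Lambda>\<close> takes its place.\<close>

definition bar_d :: "nat \<Rightarrow> ('k, 'a) tensor \<Rightarrow> ('k, 'a) tensor" where
  "bar_d n =
     lift (n + 2) tscale
       (\<lambda>xs ts. \<Sum>i\<le>n. tscale ((-1) ^ i) (tensor (take i xs @ (xs ! i * xs ! (i + 1)) # drop (i + 2) xs)))"

definition augmentation :: "('k, 'a) tensor \<Rightarrow> 'a" where
  "augmentation = lift 2 scale (\<lambda>xs ts. xs ! 0 * xs ! 1)"

definition cochains :: "nat \<Rightarrow> int \<Rightarrow> (('k, 'a) tensor \<Rightarrow> 'a) set" where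
  "cochains s t = Hom t (bar s) algebra_module"

definition cocycles :: "nat \<Rightarrow> int \<Rightarrow> (('k, 'a) tensor \<Rightarrow> 'a) set" where
  "cocycles s t = {f \<in> cochains s t. f \<circ> bar_d (Suc s) = 0}"

definition coboundaries :: "nat \<Rightarrow> int \<Rightarrow> (('k, 'a) tensor \<Rightarrow> 'a) set" where
  "coboundaries s t =
     (case s of 0 \<Rightarrow> {0} | Suc p \<Rightarrow> (\<lambda>g. g \<circ> bar_d (Suc p)) ` cochains p t)"

definition cocycle_group :: "nat \<Rightarrow> int \<Rightarrow> (('k, 'a) tensor \<Rightarrow> 'a) monoid" where
  "cocycle_group s t = \<lparr>carrier = cocycles s t, mult = (+), one = 0\<rparr>"

definition HH :: "nat \<Rightarrow> int \<Rightarrow> (('k, 'a) tensor \<Rightarrow> 'a) set monoid" where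
  "HH s t = cocycle_group s t Mod coboundaries s t"

definition coho_class :: "nat \<Rightarrow> int \<Rightarrow> (('k, 'a) tensor \<Rightarrow> 'a) \<Rightarrow> (('k, 'a) tensor \<Rightarrow> 'a) set" where
  "coho_class s t f = coboundaries s t #>\<^bsub>cocycle_group s t\<^esub> f"

definition cup :: "nat \<Rightarrow> nat \<Rightarrow> int \<Rightarrow> (('k, 'a) tensor \<Rightarrow> 'a) \<Rightarrow> (('k, 'a) tensor \<Rightarrow> 'a) \<Rightarrow>
    ('k, 'a) tensor \<Rightarrow> 'a" where
  "cup m n j \<zeta> \<eta> =
     lift (m + n + 2) scale
       (\<lambda>xs ts. scale ((-1) powi (sum_list (take (m + 1) ts) * j))
          (\<zeta> (tensor (take (m + 1) xs @ [1])) * \<eta> (tensor (1 # drop (m + 1) xs))))"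

text \<open>A homogeneous chain map \<open>\<tau>\<close> of internal degree \<open>j\<close> from the bar resolution to its \<open>n\<close>-fold
  shift (with unchanged signs), with components \<open>\<tau> m\<close> from \<open>B\<^bsub>m+n\<^esub>\<close> to \<open>B\<^sub>m\<close>, lifting \<open>\<eta>\<close>. The shifted
  complex is zero below degree \<open>n\<close>.\<close>

definition lifting :: "nat \<Rightarrow> int \<Rightarrow> (('k, 'a) tensor \<Rightarrow> 'a) \<Rightarrow>
    (nat \<Rightarrow> ('k, 'a) tensor \<Rightarrow> ('k, 'a) tensor) \<Rightarrow> bool" where
  "lifting n j \<eta> \<tau> \<longleftrightarrow>
     (\<forall>m. \<tau> m \<in> Hom j (bar (m + n)) (bar m)) \<and>
     (\<forall>m. bar_d (Suc m) \<circ> \<tau> (Suc m) = \<tau> m \<circ> bar_d (Suc m + n)) \<and>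
     augmentation \<circ> \<tau> 0 = \<eta>"

text \<open>The products of classes \<open>Z \<in> HH\<^bsup>m,i\<^esup>\<close> and \<open>E \<in> HH\<^bsup>n,j\<^esup>\<close> are unions over all choices of
  representatives (and of lifting); such a union is an element of the quotient group iff at least one
  choice exists and all choices give the same class, i.e. iff the product is well defined.\<close>

definition cup_product :: "nat \<Rightarrow> int \<Rightarrow> nat \<Rightarrow> int \<Rightarrow> (('k, 'a) tensor \<Rightarrow> 'a) set \<Rightarrow>
    (('k, 'a) tensor \<Rightarrow> 'a) set \<Rightarrow> (('k, 'a) tensor \<Rightarrow> 'a) set" where
  "cup_product m i n j Z E = (\<Union>\<zeta>\<in>Z. \<Union>\<eta>\<in>E. coho_class (m + n) (i + j) (cup m n j \<zeta> \<eta>))"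

definition yoneda_product :: "nat \<Rightarrow> int \<Rightarrow> nat \<Rightarrow> int \<Rightarrow> (('k, 'a) tensor \<Rightarrow> 'a) set \<Rightarrow>
    (('k, 'a) tensor \<Rightarrow> 'a) set \<Rightarrow> (('k, 'a) tensor \<Rightarrow> 'a) set" where
  "yoneda_product m i n j Z E =
     (\<Union>\<zeta>\<in>Z. \<Union>\<eta>\<in>E. \<Union>\<tau>\<in>{\<tau>. lifting n j \<eta> \<tau>}. coho_class (m + n) (i + j) (\<zeta> \<circ> \<tau> m))"

end

end

theory Submission
  imports Defs
begin

text \<open>Write \<open>\<beta>\<close> for the bar resolution. The theorem follows from one fact of homological algebra and two
  explicit chain maps.

  The fact is that a cocycle \<open>\<eta>\<close> of bidegree \<open>(n, j)\<close> has, up to chain homotopy, only one lifting to a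
  chain map \<open>\<tau>\<close> from \<open>\<beta>\<close> to its \<open>n\<close>-fold shift. Hence for a cocycle \<open>\<zeta>\<close> of degree \<open>m\<close> the class of
  \<open>\<zeta> \<circ> \<tau> m\<close> does not depend on \<open>\<tau>\<close> (\<open>lifting_unique\<close>). As usual, the homotopy is constructed degree by
  degree: the bar modules are free on tensors of the shape \<open>(1, x\<^sub>1, \<dots>, x\<^sub>p, 1)\<close>, and the bar resolution
  is exact because prepending a \<open>1\<close> is a contraction (\<open>bar_d_prepend\<close>, \<open>bar_exact\<close>).

  The two chain maps are liftings of \<open>\<eta>\<close> that apply \<open>\<eta>\<close> at the right or at the left end of a tensor. Up
  to Koszul signs they are
  \<open>(us, vs) \<mapsto> (us, \<eta> (1, vs))\<close> and \<open>(us, vs) \<mapsto> (-1)\<^bsup>mn\<^esup> (\<eta> (us, 1), vs)\<close>.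
  Composing \<open>\<zeta>\<close> with the right lifting gives the cup product of \<open>\<zeta>\<close> and \<open>\<eta>\<close> on the nose
  (\<open>cup_eq_right_lift\<close>), so the cup product and the Yoneda product agree on classes. Composing \<open>\<zeta>\<close> with
  the left lifting gives \<open>(-1)\<^bsup>mn\<^esup> (-1)\<^bsup>ij\<^esup>\<close> times the cup product of \<open>\<eta>\<close> and \<open>\<zeta>\<close> (\<open>comp_left_lift\<close>), so
  uniqueness of liftings is precisely graded commutativity; no homotopy for the commutator of cochains
  has to be written down.

  The remaining ring axioms are also instances of uniqueness. Composites of liftings lift composites
  (associativity), sums of liftings lift sums (distributivity), and the identity of \<open>\<beta>\<close> lifts the
  augmentation (unit).

  The Koszul signs depend on the degrees of homogeneous entries, so the formulas with signs make sense
  on homogeneous tensors only. The automorphism \<open>twist j\<close> of the algebra, which multiplies elements of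
  degree \<open>t\<close> by \<open>(-1)\<^bsup>jt\<^esup>\<close>, absorbs them: with it, a homomorphism \<open>f\<close> of internal degree \<open>j\<close> is a
  linear map with \<open>f (a \<cdot> x) = twist j a \<cdot> f x\<close> and \<open>f (x \<cdot> b) = f x \<cdot> b\<close> for all \<open>a\<close> and \<open>b\<close>
  (\<open>Hom_bar_iff\<close>), and both liftings are given by formulas that are multilinear in all entries.\<close>

section \<open>Linear and multilinear maps\<close>

lemma linear_on_setI:
  "(\<And>x y. x \<in> V \<Longrightarrow> y \<in> V \<Longrightarrow> f (x + y) = f x + f y) \<Longrightarrow> (\<And>c x. x \<in> V \<Longrightarrow> f (sV c x) = sW c (f x))
   \<Longrightarrow> linear_on_set V sV sW f"
  by (simp add: linear_on_set_def)

lemma linear_on_set_comp: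
  "linear_on_set V sV sW g \<Longrightarrow> (\<And>x. x \<in> V \<Longrightarrow> g x \<in> W) \<Longrightarrow> linear_on_set W sW sX f
   \<Longrightarrow> linear_on_set V sV sX (\<lambda>x. f (g x))"
  by (simp add: linear_on_set_def)

lemma linear_on_set_id: "linear_on_set V s s (\<lambda>x. x)"
  by (simp add: linear_on_set_def)

lemma linear_on_set_add:
  assumes "vector_space sW" "linear_on_set V sV sW f" "linear_on_set V sV sW g"
  shows "linear_on_set V sV sW (\<lambda>x. f x + g x)"
proof -
  interpret vector_space sW by fact
  show ?thesis using assms(2,3) by (simp add: linear_on_set_def scale_right_distrib)
qed

lemma linear_on_set_scale:
  assumes "vector_space sW" "linear_on_set V sV sW f"
  shows "linear_on_set V sV sW (\<lambda>x. sW c (f x))"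
proof -
  interpret vector_space sW by fact
  show ?thesis using assms(2) by (simp add: linear_on_set_def scale_right_distrib scale_left_commute)
qed

lemma linear_on_set_diff:
  assumes "vector_space sW" "linear_on_set V sV sW f" "linear_on_set V sV sW g"
  shows "linear_on_set V sV sW (\<lambda>x. f x - g x)"
proof -
  interpret vector_space sW by fact
  show ?thesis using assms(2,3) by (simp add: linear_on_set_def scale_right_diff_distrib)
qed

lemma linear_on_set_zero:
  assumes "vector_space sW" shows "linear_on_set V sV sW (\<lambda>x. 0)"
proof -
  interpret vector_space sW by fact
  show ?thesis by (simp add: linear_on_set_def)
qed

lemma linear_on_set_sum:
  assumes "vector_space sW" "\<And>i. i \<in> I \<Longrightarrow> linear_on_set V sV sW (f i)"
  shows "linear_on_set V sV sW (\<lambda>x. \<Sum>i\<in>I. f i x)"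
  using assms(2)
proof (induction I rule: infinite_finite_induct)
  case (insert i I)
  then show ?case using linear_on_set_add[OF assms(1), of V sV "f i"] by simp
qed (use linear_on_set_zero[OF assms(1)] in auto)

text \<open>Tensors are functions. Without these two pointwise rules the simplifier treats them as opaque
  vectors: the first one would rewrite the eta-expanded zero tensor to a constant abstraction.\<close>

declare zero_fun_apply [simp del] plus_fun_apply [simp del]

lemma multilinear_cong:
  assumes "multilinear sA sW n f" "\<And>xs. length xs = n \<Longrightarrow> f xs = g xs"
  shows "multilinear sA sW n g"
  using assms by (simp add: multilinear_def)

lemma multilinear_comp_linear:
  assumes "multilinear sA sW n f" "\<And>xs. length xs = n \<Longrightarrow> f xs \<in> V" "linear_on_set V sW sX L"
  shows "multilinear sA sX n (\<lambda>xs. L (f xs))"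
  using assms by (simp add: multilinear_def linear_on_set_def)

lemma multilinear_map:
  assumes "multilinear sA sW n f" "linear_on_set UNIV sA sA h"
  shows "multilinear sA sW n (\<lambda>xs. f (map h xs))"
  using assms by (simp add: multilinear_def linear_on_set_def)

lemma multilinear_scale:
  assumes "vector_space sW" "multilinear sA sW n f"
  shows "multilinear sA sW n (\<lambda>xs. sW c (f xs))"
  by (rule multilinear_comp_linear[OF assms(2), of UNIV])
    (simp_all add: linear_on_set_scale[OF assms(1) linear_on_set_id])

lemma multilinear_sum:
  assumes "vector_space sW" "\<And>i. i \<in> I \<Longrightarrow> multilinear sA sW n (f i)"
  shows "multilinear sA sW n (\<lambda>xs. \<Sum>i\<in>I. f i xs)"
proof -
  interpret vector_space sW by fact
  show ?thesis
    using assms(2) by (simp add: multilinear_def sum.distrib scale_sum_right)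
qed

lemma multilinear_slot:
  assumes "multilinear sA sW n f" "length us + length vs + 1 = n"
  shows "linear_on_set UNIV sA sW (\<lambda>x. f (us @ x # vs))"
  using assms by (simp add: multilinear_def linear_on_set_def)

lemma multilinear_context:
  fixes sA :: "'k::field \<Rightarrow> 'a::ab_group_add \<Rightarrow> 'a"
  assumes "multilinear sA sW m f" "m = length us + n + length vs"
  shows "multilinear sA sW n (\<lambda>xs. f (us @ xs @ vs))"
  unfolding multilinear_def
proof (intro allI impI)
  fix xs ys :: "'a list" and x y :: 'a and c assume "length xs + length ys + 1 = n"
  then have "length (us @ xs) + length (ys @ vs) + 1 = m" using assms(2) by simp
  then have "f ((us @ xs) @ (x + y) # ys @ vs) = f ((us @ xs) @ x # ys @ vs) + f ((us @ xs) @ y # ys @ vs) \<and>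
     f ((us @ xs) @ sA c x # ys @ vs) = sW c (f ((us @ xs) @ x # ys @ vs))"
    using assms(1) unfolding multilinear_def by blast
  then show "f (us @ (xs @ (x + y) # ys) @ vs) = f (us @ (xs @ x # ys) @ vs) + f (us @ (xs @ y # ys) @ vs) \<and>
     f (us @ (xs @ sA c x # ys) @ vs) = sW c (f (us @ (xs @ x # ys) @ vs))" by simp
qed

lemma multilinear_append:
  fixes sA :: "'k::field \<Rightarrow> 'a::ab_group_add \<Rightarrow> 'a"
  assumes F1: "\<And>us. length us = a \<Longrightarrow> multilinear sA sW b (F us)"
    and F2: "\<And>vs. length vs = b \<Longrightarrow> multilinear sA sW a (\<lambda>us. F us vs)"
  shows "multilinear sA sW (a + b) (\<lambda>xs. F (take a xs) (drop a xs))"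
  unfolding multilinear_def
proof (intro allI impI)
  fix xs ys :: "'a list" and x y :: 'a and c assume len: "length xs + length ys + 1 = a + b"
  let ?G = "\<lambda>zs. F (take a zs) (drop a zs)"
  show "?G (xs @ (x + y) # ys) = ?G (xs @ x # ys) + ?G (xs @ y # ys) \<and>
     ?G (xs @ sA c x # ys) = sW c (?G (xs @ x # ys))"
  proof (cases "length xs < a")
    case True
    define k where "k = a - length xs - 1"
    have *: "?G (xs @ z # ys) = F (xs @ z # take k ys) (drop k ys)" for z
      using True by (simp add: k_def take_Cons' drop_Cons')
    have "length xs + length (take k ys) + 1 = a" "length (drop k ys) = b"
      using True len by (auto simp: k_def)
    then show ?thesis unfolding * using F2[of "drop k ys"] unfolding multilinear_def by blast
  next
    case False
    have *: "?G (xs @ z # ys) = F (take a xs) (drop a xs @ z # ys)" for z using False by simp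
    have "length (take a xs) = a" "length (drop a xs) + length ys + 1 = b" using False len by auto
    then show ?thesis unfolding * using F1[of "take a xs"] unfolding multilinear_def by blast
  qed
qed

lemma multilinear_Cons:
  fixes sA :: "'k::field \<Rightarrow> 'a::ab_group_add \<Rightarrow> 'a"
  assumes F1: "\<And>x. multilinear sA sW n (F x)"
    and F2: "\<And>xs. length xs = n \<Longrightarrow> linear_on_set UNIV sA sW (\<lambda>x. F x xs)"
  shows "multilinear sA sW (Suc n) (\<lambda>xs. F (hd xs) (tl xs))"
  unfolding multilinear_def
proof (intro allI impI)
  fix xs ys :: "'a list" and x y :: 'a and c assume len: "length xs + length ys + 1 = Suc n"
  show "F (hd (xs @ (x + y) # ys)) (tl (xs @ (x + y) # ys)) =
        F (hd (xs @ x # ys)) (tl (xs @ x # ys)) + F (hd (xs @ y # ys)) (tl (xs @ y # ys)) \<and>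
     F (hd (xs @ sA c x # ys)) (tl (xs @ sA c x # ys)) = sW c (F (hd (xs @ x # ys)) (tl (xs @ x # ys)))"
    using len F1 F2[of ys] by (cases xs) (auto simp: linear_on_set_def multilinear_def)
qed

lemma multilinear_snoc:
  fixes sA :: "'k::field \<Rightarrow> 'a::ab_group_add \<Rightarrow> 'a"
  assumes F1: "\<And>x. multilinear sA sW n (\<lambda>xs. F xs x)"
    and F2: "\<And>xs. length xs = n \<Longrightarrow> linear_on_set UNIV sA sW (F xs)"
  shows "multilinear sA sW (Suc n) (\<lambda>xs. F (butlast xs) (last xs))"
  unfolding multilinear_def
proof (intro allI impI)
  fix xs ys :: "'a list" and x y :: 'a and c assume len: "length xs + length ys + 1 = Suc n"
  show "F (butlast (xs @ (x + y) # ys)) (last (xs @ (x + y) # ys)) =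
        F (butlast (xs @ x # ys)) (last (xs @ x # ys)) + F (butlast (xs @ y # ys)) (last (xs @ y # ys)) \<and>
     F (butlast (xs @ sA c x # ys)) (last (xs @ sA c x # ys)) = sW c (F (butlast (xs @ x # ys)) (last (xs @ x # ys)))"
    using len F1 F2[of xs] by (cases ys rule: rev_cases) (auto simp: linear_on_set_def multilinear_def butlast_append)
qed

text \<open>The faces of a list: the terms of the bar differential multiply two neighbouring entries.\<close>

definition contract :: "nat \<Rightarrow> 'a::times list \<Rightarrow> 'a list" where
  "contract i xs = take i xs @ (xs ! i * xs ! (i + 1)) # drop (i + 2) xs"

lemma contract_0 [simp]: "contract 0 (x # y # xs) = (x * y) # xs"
  and contract_Suc [simp]: "contract (Suc i) (x # xs) = x # contract i xs"
  by (simp_all add: contract_def)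

lemma length_contract: "i + 2 \<le> length xs \<Longrightarrow> length (contract i xs) = length xs - 1"
  by (auto simp: contract_def)

lemma contract_append_left:
  "i + 2 \<le> length us \<Longrightarrow> contract i (us @ vs) = contract i us @ vs"
  by (simp add: contract_def nth_append)

lemma contract_append_right: "contract (length us + k) (us @ vs) = us @ contract k vs"
  by (induction us) auto

lemma contract_map:
  "(\<And>x y. h (x * y) = h x * h y) \<Longrightarrow> i + 2 \<le> length xs \<Longrightarrow> contract i (map h xs) = map h (contract i xs)"
  by (simp add: contract_def take_map drop_map)

text \<open>Splitting off the first entry reduces the claim for \<open>Suc i\<close> to the claim for \<open>i\<close>; for \<open>i = 0\<close> it is the
  bilinearity of multiplication.\<close>

lemma multilinear_contract:
  fixes sA :: "'k::field \<Rightarrow> 'a::ring \<Rightarrow> 'a"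
  assumes "\<And>c x y. sA c (x * y) = sA c x * y" "\<And>c x y. sA c (x * y) = x * sA c y"
  assumes "multilinear sA sW (Suc n) f" "i \<le> n"
  shows "multilinear sA sW (Suc (Suc n)) (\<lambda>xs. f (contract i xs))"
  using assms(3,4)
proof (induction i arbitrary: n f)
  case 0
  have slot: "linear_on_set UNIV sA sW (\<lambda>z. f (z # ys))" if "length ys = n" for ys
    using multilinear_slot[OF 0(1), of "[]" ys] that by simp
  have "multilinear sA sW (Suc (Suc n)) (\<lambda>xs. f (hd xs * hd (tl xs) # tl (tl xs)))"
  proof (rule multilinear_Cons[of sA sW "Suc n" "\<lambda>x xs. f (x * hd xs # tl xs)"], rule multilinear_Cons)
    fix x
    show "multilinear sA sW n (\<lambda>ys. f (x * y # ys))" for y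
      using multilinear_context[OF 0(1), of "[x * y]" n "[]"] by simp
    show "linear_on_set UNIV sA sW (\<lambda>y. f (x * y # ys))" if "length ys = n" for ys
      using slot[OF that] assms(2) by (simp add: linear_on_set_def distrib_left assms(2)[symmetric])
  next
    fix xs :: "'a list" assume "length xs = Suc n"
    then show "linear_on_set UNIV sA sW (\<lambda>x. f (x * hd xs # tl xs))"
      using slot[of "tl xs"] by (simp add: linear_on_set_def distrib_right assms(1)[symmetric])
  qed
  then show ?case
    by (rule multilinear_cong) (auto simp: length_Suc_conv)
next
  case (Suc i)
  then obtain n' where n: "n = Suc n'" by (cases n) auto
  have "multilinear sA sW (Suc (Suc n)) (\<lambda>xs. f (hd xs # contract i (tl xs)))"
  proof (rule multilinear_Cons)
    show "multilinear sA sW (Suc n) (\<lambda>xs. f (x # contract i xs))" for x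
      unfolding n
      by (rule Suc.IH) (use Suc.prems multilinear_context[OF Suc.prems(1), of "[x]" n "[]"] n in auto)
    show "linear_on_set UNIV sA sW (\<lambda>x. f (x # contract i xs))" if "length xs = Suc n" for xs
      using multilinear_slot[OF Suc.prems(1), of "[]" "contract i xs"] that Suc.prems
      by (simp add: length_contract)
  qed
  then show ?case
    by (rule multilinear_cong) (auto simp: length_Suc_conv)
qed

lemma multilinear_bilinear:
  fixes sA :: "'k::field \<Rightarrow> 'a::ab_group_add \<Rightarrow> 'a"
  assumes "\<And>a. linear_on_set UNIV sA sW (\<lambda>b. F a b)" "\<And>b. linear_on_set UNIV sA sW (\<lambda>a. F a b)"
  shows "multilinear sA sW 2 (\<lambda>xs. F (xs ! 0) (xs ! 1))"
  unfolding multilinear_def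
proof (intro allI impI)
  fix xs ys :: "'a list" and x y :: 'a and c assume "length xs + length ys + 1 = 2"
  then consider z where "xs = []" "ys = [z]" | z where "xs = [z]" "ys = []"
    by (cases xs; cases ys) auto
  then show "F ((xs @ (x + y) # ys) ! 0) ((xs @ (x + y) # ys) ! 1) =
        F ((xs @ x # ys) ! 0) ((xs @ x # ys) ! 1) + F ((xs @ y # ys) ! 0) ((xs @ y # ys) ! 1) \<and>
     F ((xs @ sA c x # ys) ! 0) ((xs @ sA c x # ys) ! 1) = sW c (F ((xs @ x # ys) ! 0) ((xs @ x # ys) ! 1))"
    by cases (use assms in \<open>auto simp: linear_on_set_def\<close>)
qed

section \<open>Gradings and Koszul signs\<close>

lemma minus_one_powi: "(-1 :: 'k::field) powi a = (if even a then 1 else -1)"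
  by (cases a rule: int_cases2) (auto simp: power_int_minus)

lemma minus_one_powi_add: "(-1 :: 'k::field) powi (a + b) = (-1) powi a * (-1) powi b"
  by (simp add: minus_one_powi)

context graded_algebra
begin

lemma gr_0 [simp]: "0 \<in> gr t" and gr_add: "x \<in> gr t \<Longrightarrow> y \<in> gr t \<Longrightarrow> x + y \<in> gr t"
  and gr_scale: "x \<in> gr t \<Longrightarrow> scale c x \<in> gr t"
  using gr_subspace by (auto simp: subspace_def)

lemma component:
  shows component_gr: "component x t \<in> gr t"
    and finite_component: "finite {t. component x t \<noteq> 0}"
    and sum_component: "(\<Sum>t | component x t \<noteq> 0. component x t) = x"
  using theI'[OF gr_direct_sum[of x]] unfolding component_def by auto

lemma component_eqI:
  assumes "\<And>t. c t \<in> gr t" "finite {t. c t \<noteq> 0}" "(\<Sum>t | c t \<noteq> 0. c t) = x"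
  shows "component x = c"
  unfolding component_def by (rule the1_equality[OF gr_direct_sum]) (use assms in auto)

lemma sum_component_superset:
  assumes "finite S" "{t. component x t \<noteq> 0} \<subseteq> S"
  shows "(\<Sum>t\<in>S. component x t) = x"
  using sum.mono_neutral_right[OF assms, of "component x"] sum_component[of x] by auto

lemma component_add: "component (x + y) t = component x t + component y t"
proof -
  let ?S = "{t. component x t \<noteq> 0} \<union> {t. component y t \<noteq> 0}"
  have fin: "finite ?S" by (simp add: finite_component)
  have "component (x + y) = (\<lambda>t. component x t + component y t)"
  proof (rule component_eqI)
    show "component x t + component y t \<in> gr t" for t by (intro gr_add component_gr)
    show "finite {t. component x t + component y t \<noteq> 0}"
      by (rule finite_subset[OF _ fin]) auto
    have "(\<Sum>t | component x t + component y t \<noteq> 0. component x t + component y t)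
        = (\<Sum>t\<in>?S. component x t + component y t)"
      by (rule sum.mono_neutral_left) (use fin in auto)
    also have "\<dots> = x + y"
      using sum_component_superset[OF fin, of x] sum_component_superset[OF fin, of y]
      by (simp add: sum.distrib)
    finally show "(\<Sum>t | component x t + component y t \<noteq> 0. component x t + component y t) = x + y" .
  qed
  then show ?thesis by simp
qed

lemma component_scale: "component (scale c x) t = scale c (component x t)"
proof -
  let ?S = "{t. component x t \<noteq> 0}"
  have "component (scale c x) = (\<lambda>t. scale c (component x t))"
  proof (rule component_eqI)
    show "scale c (component x t) \<in> gr t" for t by (intro gr_scale component_gr)
    show "finite {t. scale c (component x t) \<noteq> 0}"
      by (rule finite_subset[OF _ finite_component[of x]]) auto
    have "(\<Sum>t | scale c (component x t) \<noteq> 0. scale c (component x t)) = (\<Sum>t\<in>?S. scale c (component x t))"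
      by (rule sum.mono_neutral_left) (auto simp: finite_component)
    also have "\<dots> = scale c x" by (simp only: scale_sum_right[symmetric] sum_component)
    finally show "(\<Sum>t | scale c (component x t) \<noteq> 0. scale c (component x t)) = scale c x" .
  qed
  then show ?thesis by simp
qed

lemma component_homogeneous: "x \<in> gr u \<Longrightarrow> component x = (\<lambda>t. if t = u then x else 0)"
proof (rule component_eqI)
  assume x: "x \<in> gr u"
  show "(if t = u then x else 0) \<in> gr t" for t using x by simp
  have sub: "{t. (if t = u then x else 0) \<noteq> 0} \<subseteq> {u}" by auto
  then show "finite {t. (if t = u then x else 0) \<noteq> 0}" by (rule finite_subset) simp
  show "(\<Sum>t | (if t = u then x else 0) \<noteq> 0. if t = u then x else 0) = x"
    using sum.mono_neutral_left[OF _ sub, of "\<lambda>t. if t = u then x else 0"] by simp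
qed

lemma homogeneous_induct [case_names zero add homogeneous]:
  assumes "P 0" "\<And>x y. P x \<Longrightarrow> P y \<Longrightarrow> P (x + y)" "\<And>x t. x \<in> gr t \<Longrightarrow> P x"
  shows "P x"
proof -
  have "P (\<Sum>t\<in>S. component x t)" if "finite S" for S
    using that by (induction S rule: finite_induct) (auto intro: assms component_gr)
  from this[OF finite_component[of x]] show ?thesis by (simp only: sum_component)
qed

text \<open>A family of linear maps, one for each degree, glued to a map on the whole algebra. Signs that depend on
  the degree of an argument are introduced in this way.\<close>

definition degreewise :: "(int \<Rightarrow> 'a \<Rightarrow> 'w::ab_group_add) \<Rightarrow> 'a \<Rightarrow> 'w" where
  "degreewise g x = (\<Sum>t | component x t \<noteq> 0. g t (component x t))"

lemma degreewise_superset: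
  assumes "\<And>t. g t 0 = 0" "finite S" "{t. component x t \<noteq> 0} \<subseteq> S"
  shows "degreewise g x = (\<Sum>t\<in>S. g t (component x t))"
  unfolding degreewise_def by (rule sum.mono_neutral_left) (use assms in auto)

lemma degreewise_linear:
  assumes sW: "vector_space sW" and g: "\<And>t. linear_on_set UNIV scale sW (g t)"
  shows "linear_on_set UNIV scale sW (degreewise g)"
proof -
  interpret W: vector_space sW by fact
  have add: "g t (x + y) = g t x + g t y" and sc: "g t (scale c x) = sW c (g t x)" for t x y c
    using g[of t] unfolding linear_on_set_def by auto
  have g0: "g t 0 = 0" for t using add[of t 0 0] by simp
  have "degreewise g (x + y) = degreewise g x + degreewise g y" for x y
  proof -
    let ?S = "{t. component x t \<noteq> 0} \<union> {t. component y t \<noteq> 0}"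
    have fin: "finite ?S" by (simp add: finite_component)
    have "{t. component (x + y) t \<noteq> 0} \<subseteq> ?S" by (auto simp: component_add)
    then show ?thesis
      using degreewise_superset[of g ?S x] degreewise_superset[of g ?S y]
        degreewise_superset[of g ?S "x + y"] fin g0
      by (simp add: component_add add sum.distrib)
  qed
  moreover have "degreewise g (scale c x) = sW c (degreewise g x)" for x c
  proof -
    let ?S = "{t. component x t \<noteq> 0}"
    have "{t. component (scale c x) t \<noteq> 0} \<subseteq> ?S" by (auto simp: component_scale)
    then show ?thesis
      using degreewise_superset[of g ?S x] degreewise_superset[of g ?S "scale c x"]
        finite_component[of x] g0
      by (simp add: component_scale sc W.scale_sum_right)
  qed
  ultimately show ?thesis by (auto simp: linear_on_set_def)
qed

lemma degreewise_homogeneous: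
  assumes "x \<in> gr u" "\<And>t. g t 0 = 0" shows "degreewise g x = g u x"
proof -
  have "{t. component x t \<noteq> 0} \<subseteq> {u}" using assms(1) by (auto simp: component_homogeneous)
  then show ?thesis
    using degreewise_superset[of g "{u}" x, OF assms(2)] assms(1) by (simp add: component_homogeneous)
qed

text \<open>The Koszul rule: moving a map of degree \<open>j\<close> past an element of degree \<open>t\<close> costs the sign \<open>(-1)\<^bsup>jt\<^esup>\<close>.
  As a map on the whole algebra this sign is an automorphism.\<close>

definition twist :: "int \<Rightarrow> 'a \<Rightarrow> 'a" where
  "twist j = degreewise (\<lambda>t. scale ((-1) powi (j * t)))"

lemma vector_space_scale: "vector_space scale" by unfold_locales
lemma vector_space_tscale: "vector_space (tscale :: 'k \<Rightarrow> ('b \<Rightarrow> 'k) \<Rightarrow> _)" by unfold_locales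

lemma twist_homogeneous: "x \<in> gr t \<Longrightarrow> twist j x = scale ((-1) powi (j * t)) x"
  unfolding twist_def by (subst degreewise_homogeneous) auto

lemma twist_linear: "linear_on_set UNIV scale scale (twist j)"
  unfolding twist_def
  by (rule degreewise_linear[OF vector_space_scale])
    (auto simp: linear_on_set_def scale_right_distrib scale_left_commute)

lemma twist_add [simp]: "twist j (x + y) = twist j x + twist j y"
  and twist_scale [simp]: "twist j (scale c x) = scale c (twist j x)"
  using twist_linear[of j] by (auto simp: linear_on_set_def)

lemma twist_0 [simp]: "twist j 0 = 0"
  using twist_add[of j 0 0] by simp

lemma twist_gr: "x \<in> gr t \<Longrightarrow> twist j x \<in> gr t"
  by (simp add: twist_homogeneous gr_scale)

lemma twist_one [simp]: "twist j 1 = 1"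
  using twist_homogeneous[OF gr_one] by simp

lemma twist_twist: "twist i (twist j x) = twist (i + j) x"
proof (induction x rule: homogeneous_induct)
  case (homogeneous x t)
  then show ?case
    by (simp add: twist_homogeneous gr_scale distrib_right minus_one_powi_add)
qed auto

lemma twist_even: "even j \<Longrightarrow> twist j x = x"
  by (induction x rule: homogeneous_induct) (auto simp: twist_homogeneous minus_one_powi)

lemma twist_cancel [simp]: "twist (u + t) (twist u x) = twist t x"
proof -
  have "twist (u + t) (twist u x) = twist t (twist (u + u) x)"
    by (simp add: twist_twist add_ac)
  then show ?thesis by (simp add: twist_even)
qed

lemma twist_mult: "twist j (x * y) = twist j x * twist j y"
proof (induction x rule: homogeneous_induct)
  case (homogeneous x s)
  show ?case
  proof (induction y rule: homogeneous_induct)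
    case (homogeneous y t)
    with \<open>x \<in> gr s\<close> show ?case
      using gr_mult[of x s y t]
      by (simp add: twist_homogeneous distrib_left minus_one_powi_add
          scale_mult_left[symmetric] scale_mult_right[symmetric] mult.commute)
  qed (auto simp: distrib_left)
qed (auto simp: distrib_right)

section \<open>Tensor powers\<close>

lemma tpow_tensor: "length xs = n \<Longrightarrow> tensor xs \<in> tpow n"
  unfolding tensor_power_def by (rule tensor_space.span_base) auto

lemma tpow_0 [simp]: "0 \<in> tpow n" and tpow_add: "x \<in> tpow n \<Longrightarrow> y \<in> tpow n \<Longrightarrow> x + y \<in> tpow n"
  and tpow_diff: "x \<in> tpow n \<Longrightarrow> y \<in> tpow n \<Longrightarrow> x - y \<in> tpow n"
  and tpow_scale: "x \<in> tpow n \<Longrightarrow> tscale c x \<in> tpow n"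
  unfolding tensor_power_def
  by (auto intro: tensor_space.span_zero tensor_space.span_add tensor_space.span_diff tensor_space.span_scale)

lemma tpow_sum: "(\<And>i. i \<in> I \<Longrightarrow> f i \<in> tpow n) \<Longrightarrow> (\<Sum>i\<in>I. f i) \<in> tpow n"
  unfolding tensor_power_def by (rule tensor_space.span_sum)

lemma tensor_space_span_induct [consumes 1, case_names zero add scale base]:
  assumes "x \<in> tensor_space.span S" "P 0" "\<And>x y. P x \<Longrightarrow> P y \<Longrightarrow> P (x + y)"
    "\<And>c x. P x \<Longrightarrow> P (tscale c x)" "\<And>x. x \<in> S \<Longrightarrow> P x"
  shows "P x"
  using assms(1)
proof (rule tensor_space.span_induct)
  show "tensor_space.subspace (Collect P)"
    by (rule tensor_space.subspaceI) (use assms in auto)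
qed (use assms in auto)

lemma tpow_induct [consumes 1, case_names zero add scale tensor]:
  assumes x: "x \<in> tpow n" and "P 0" "\<And>x y. x \<in> tpow n \<Longrightarrow> y \<in> tpow n \<Longrightarrow> P x \<Longrightarrow> P y \<Longrightarrow> P (x + y)"
    "\<And>c x. x \<in> tpow n \<Longrightarrow> P x \<Longrightarrow> P (tscale c x)" "\<And>xs. length xs = n \<Longrightarrow> P (tensor xs)"
  shows "P x"
proof -
  have "x \<in> tpow n \<and> P x"
    using x unfolding tensor_power_def
  proof (rule tensor_space_span_induct)
    show "0 \<in> tensor_space.span {tensor xs | xs. length xs = n} \<and> P 0"
      using assms(2) by (blast intro: tensor_space.span_zero)
  qed (use assms in \<open>auto simp: tensor_power_def[symmetric] intro: tpow_add tpow_scale tpow_tensor\<close>)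
  then show ?thesis by simp
qed

lemma tensor_slot: "linear_on_set UNIV scale tscale (\<lambda>x. tensor (us @ x # vs))"
  by (rule multilinear_slot[OF multilinear_pure_tensor]) simp

lemma tensor_add: "tensor (us @ (x + y) # vs) = tensor (us @ x # vs) + tensor (us @ y # vs)"
  and tensor_scale: "tensor (us @ scale c x # vs) = tscale c (tensor (us @ x # vs))"
  using tensor_slot[of us vs] by (auto simp: linear_on_set_def)

lemma tensor_zero: "tensor (us @ 0 # vs) = 0"
  using tensor_add[of us 0 0 vs] by simp

definition homogeneous_tensors :: "nat \<Rightarrow> int \<Rightarrow> ('k, 'a) tensor set" where
  "homogeneous_tensors n u = tensor_space.span
     {tensor xs | xs. length xs = n \<and> (\<exists>ts. has_degrees xs ts \<and> sum_list ts = u)}"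

lemma tensor_homogeneous:
  "has_degrees xs ts \<Longrightarrow> length xs = n \<Longrightarrow> sum_list ts = u \<Longrightarrow> tensor xs \<in> homogeneous_tensors n u"
  unfolding homogeneous_tensors_def by (rule tensor_space.span_base) auto

lemma homogeneous_tensors_subset: "homogeneous_tensors n u \<subseteq> tpow n"
  unfolding homogeneous_tensors_def tensor_power_def by (rule tensor_space.span_mono) auto

text \<open>By multilinearity each entry may be replaced by its homogeneous components. The induction does this
  from left to right, so the entries in \<open>us\<close> are the ones already treated.\<close>

lemma tensor_in_homogeneous_span:
  assumes "has_degrees us ss"
  shows "tensor (us @ xs) \<in> tensor_space.span {tensor ys | ys. length ys = length us + length xs \<and> (\<exists>ts. has_degrees ys ts)}"
  using assms
proof (induction xs arbitrary: us ss)
  case Nil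
  then show ?case by (intro tensor_space.span_base) auto
next
  case (Cons x xs)
  show ?case
  proof (induction x rule: homogeneous_induct)
    case zero
    then show ?case by (simp add: tensor_zero tensor_space.span_zero)
  next
    case (add x y)
    then show ?case by (simp only: tensor_add length_Cons tensor_space.span_add)
  next
    case (homogeneous x t)
    then have "has_degrees (us @ [x]) (ss @ [t])"
      using Cons.prems by (simp add: has_degrees_def list_all2_appendI)
    from Cons.IH[OF this] show ?case by simp
  qed
qed

lemma tpow_homogeneous_induct [consumes 1, case_names zero add scale tensor]:
  assumes x: "x \<in> tpow n" and "P 0" "\<And>x y. x \<in> tpow n \<Longrightarrow> y \<in> tpow n \<Longrightarrow> P x \<Longrightarrow> P y \<Longrightarrow> P (x + y)"
    "\<And>c x. x \<in> tpow n \<Longrightarrow> P x \<Longrightarrow> P (tscale c x)"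
    "\<And>xs ts. length xs = n \<Longrightarrow> has_degrees xs ts \<Longrightarrow> P (tensor xs)"
  shows "P x"
  using assms(1)
proof (induction rule: tpow_induct)
  case (tensor xs)
  have "tensor xs \<in> tensor_space.span {tensor ys | ys. length ys = length xs \<and> (\<exists>ts. has_degrees ys ts)}"
    using tensor_in_homogeneous_span[of "[]" "[]" xs] by (simp add: has_degrees_def)
  then have "tensor xs \<in> tpow n \<and> P (tensor xs)"
    by (rule tensor_space_span_induct) (use assms tensor in \<open>auto intro: tpow_add tpow_scale tpow_tensor\<close>)
  then show ?case by simp
qed (use assms in auto)

lemma linear_on_tpow_zero:
  assumes "linear_on_set (tpow n) tscale sW f" shows "f 0 = 0"
proof -
  have "f (0 + 0) = f 0 + f 0" using assms unfolding linear_on_set_def by (meson tpow_0)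
  then show ?thesis by simp
qed

text \<open>The uniqueness half of the universal property, restricted to homogeneous entries. Nearly every identity
  between maps out of tensor powers below is checked by means of this lemma.\<close>

lemma linear_on_tpow_eqI:
  assumes "x \<in> tpow n" "linear_on_set (tpow n) tscale sW f" "linear_on_set (tpow n) tscale sW g"
    "\<And>xs ts. length xs = n \<Longrightarrow> has_degrees xs ts \<Longrightarrow> f (tensor xs) = g (tensor xs)"
  shows "f x = g x"
  using assms(1)
proof (induction rule: tpow_homogeneous_induct)
  case zero
  show ?case using linear_on_tpow_zero[OF assms(2)] linear_on_tpow_zero[OF assms(3)] by simp
qed (use assms in \<open>auto simp: linear_on_set_def\<close>)

definition tlinear :: "nat \<Rightarrow> ('k \<Rightarrow> 'w::ab_group_add \<Rightarrow> 'w) \<Rightarrow> (('k, 'a) tensor \<Rightarrow> 'w) \<Rightarrow> bool" where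
  "tlinear n sW g \<longleftrightarrow> zero_off (tpow n) g \<and> linear_on_set (tpow n) tscale sW g"

lemma tlinear_eqI:
  assumes "tlinear n sW f" "tlinear n sW g"
    "\<And>xs ts. length xs = n \<Longrightarrow> has_degrees xs ts \<Longrightarrow> f (tensor xs) = g (tensor xs)"
  shows "f = g"
proof
  fix x
  show "f x = g x"
    using linear_on_tpow_eqI[of x n sW f g] assms by (cases "x \<in> tpow n") (auto simp: tlinear_def zero_off_def)
qed

text \<open>Unlike \<open>lift\<close>, this extension starts from a function that is multilinear in arbitrary, not only
  homogeneous, entries, so \<open>tensor_power_universal\<close> applies directly.\<close>

definition extend :: "nat \<Rightarrow> ('k \<Rightarrow> 'w::ab_group_add \<Rightarrow> 'w) \<Rightarrow> ('a list \<Rightarrow> 'w) \<Rightarrow> ('k, 'a) tensor \<Rightarrow> 'w" where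
  "extend n sW f = (THE g. tlinear n sW g \<and> (\<forall>xs. length xs = n \<longrightarrow> g (tensor xs) = f xs))"

lemma extend:
  assumes "vector_space sW" "multilinear scale sW n f"
  shows tlinear_extend: "tlinear n sW (extend n sW f)"
    and extend_tensor: "length xs = n \<Longrightarrow> extend n sW f (tensor xs) = f xs"
  using theI'[OF tensor_power_universal[OF assms, folded conj_assoc, folded tlinear_def]]
  unfolding extend_def by auto

lemma lift_eqI:
  assumes "tlinear n sW g" "\<And>xs ts. length xs = n \<Longrightarrow> has_degrees xs ts \<Longrightarrow> g (tensor xs) = F xs ts"
  shows "lift n sW F = g"
  unfolding lift_def
proof (rule the_equality)
  show "zero_off (tpow n) g \<and> linear_on_set (tpow n) tscale sW g \<and>
    (\<forall>xs ts. length xs = n \<and> has_degrees xs ts \<longrightarrow> g (tensor xs) = F xs ts)"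
    using assms by (auto simp: tlinear_def)
next
  fix h assume "zero_off (tpow n) h \<and> linear_on_set (tpow n) tscale sW h \<and>
    (\<forall>xs ts. length xs = n \<and> has_degrees xs ts \<longrightarrow> h (tensor xs) = F xs ts)"
  then show "h = g" by (intro tlinear_eqI[OF _ assms(1)]) (auto simp: tlinear_def assms(2))
qed

lemma lift_eq_extend:
  assumes "vector_space sW" "multilinear scale sW n f"
    "\<And>xs ts. length xs = n \<Longrightarrow> has_degrees xs ts \<Longrightarrow> f xs = F xs ts"
  shows "lift n sW F = extend n sW f"
  by (rule lift_eqI) (use assms extend[OF assms(1,2)] in auto)

lemma extend_tpow:
  assumes "multilinear scale tscale n f" "\<And>xs. length xs = n \<Longrightarrow> f xs \<in> tpow m" "x \<in> tpow n"
  shows "extend n tscale f x \<in> tpow m"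
  using assms(3)
proof (induction rule: tpow_induct)
  case zero
  show ?case
    using linear_on_tpow_zero[of n tscale "extend n tscale f"] tlinear_extend[OF vector_space_tscale assms(1)]
    by (simp add: tlinear_def)
next
  case (add x y)
  then show ?case using tlinear_extend[OF vector_space_tscale assms(1)] by (simp add: tlinear_def linear_on_set_def tpow_add)
next
  case (scale c x)
  then show ?case using tlinear_extend[OF vector_space_tscale assms(1)] by (simp add: tlinear_def linear_on_set_def tpow_scale)
next
  case (tensor xs)
  then show ?case by (simp add: extend_tensor[OF vector_space_tscale assms(1)] assms(2))
qed

lemma tlinearD: "tlinear n sW g \<Longrightarrow> linear_on_set (tpow n) tscale sW g"
  and tlinear_off: "tlinear n sW g \<Longrightarrow> x \<notin> tpow n \<Longrightarrow> g x = 0"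
  by (auto simp: tlinear_def zero_off_def)

section \<open>Linear maps between tensor powers\<close>

text \<open>This makes the module actions, which are extensions in their second argument, linear in the first one.\<close>

lemma extend_parameter:
  assumes sW: "vector_space sW" and f: "\<And>x. multilinear scale sW n (f x)"
    and x: "\<And>ms. length ms = n \<Longrightarrow> linear_on_set V sV sW (\<lambda>x. f x ms)"
  shows "linear_on_set V sV sW (\<lambda>x. extend n sW (f x) r)"
proof (cases "r \<in> tpow n")
  case True
  show ?thesis
  proof (rule linear_on_setI)
    fix y z assume "y \<in> V" "z \<in> V"
    with True show "extend n sW (f (y + z)) r = extend n sW (f y) r + extend n sW (f z) r"
      by (intro linear_on_tpow_eqI[of r n sW "extend n sW (f (y + z))"] linear_on_set_add[OF sW] tlinearD tlinear_extend sW f)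
        (use x in \<open>simp_all add: extend_tensor[OF sW f] linear_on_set_def\<close>)
  next
    fix c y assume "y \<in> V"
    with True show "extend n sW (f (sV c y)) r = sW c (extend n sW (f y) r)"
      by (intro linear_on_tpow_eqI[of r n sW "extend n sW (f (sV c y))"] linear_on_set_scale[OF sW] tlinearD tlinear_extend sW f)
        (use x in \<open>simp_all add: extend_tensor[OF sW f] linear_on_set_def\<close>)
  qed
next
  case False
  then show ?thesis
    using linear_on_set_zero[OF sW] by (simp add: tlinear_off[OF tlinear_extend[OF sW f]])
qed

lemma linear_parameter:
  assumes sW: "vector_space sW" and f: "\<And>a. linear_on_set (tpow n) tscale sW (f a)"
    and a: "\<And>xs. length xs = n \<Longrightarrow> linear_on_set V sV sW (\<lambda>a. f a (tensor xs))" and x: "x \<in> tpow n"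
  shows "linear_on_set V sV sW (\<lambda>a. f a x)"
proof (rule linear_on_setI)
  fix y z assume "y \<in> V" "z \<in> V"
  with x show "f (y + z) x = f y x + f z x"
    by (intro linear_on_tpow_eqI[of x n sW "f (y + z)"] linear_on_set_add[OF sW] f)
      (use a in \<open>simp_all add: linear_on_set_def\<close>)
next
  fix c y assume "y \<in> V"
  with x show "f (sV c y) x = sW c (f y x)"
    by (intro linear_on_tpow_eqI[of x n sW "f (sV c y)"] linear_on_set_scale[OF sW] f)
      (use a in \<open>simp_all add: linear_on_set_def\<close>)
qed

definition tmap :: "nat \<Rightarrow> nat \<Rightarrow> (('k, 'a) tensor \<Rightarrow> ('k, 'a) tensor) \<Rightarrow> bool" where
  "tmap n m g \<longleftrightarrow> tlinear n tscale g \<and> (\<forall>x. g x \<in> tpow m)"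

lemma tmap_linear: "tmap n m g \<Longrightarrow> linear_on_set (tpow n) tscale tscale g"
  and tmap_closed: "tmap n m g \<Longrightarrow> g x \<in> tpow m"
  and tmap_off: "tmap n m g \<Longrightarrow> x \<notin> tpow n \<Longrightarrow> g x = 0"
  by (auto simp: tmap_def tlinear_def zero_off_def)

lemma tmap_zero: "tmap n m g \<Longrightarrow> g 0 = 0"
  by (rule linear_on_tpow_zero[OF tmap_linear])

lemma tmap_extend:
  assumes "multilinear scale tscale n f" "\<And>xs. length xs = n \<Longrightarrow> f xs \<in> tpow m"
  shows "tmap n m (extend n tscale f)"
proof -
  have "extend n tscale f x \<in> tpow m" for x
    by (cases "x \<in> tpow n")
      (auto simp: extend_tpow[OF assms] tlinear_off[OF tlinear_extend[OF vector_space_tscale assms(1)]])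
  then show ?thesis by (simp add: tmap_def tlinear_extend[OF vector_space_tscale assms(1)])
qed

lemma linear_tmap_comp:
  assumes "linear_on_set (tpow m) tscale sW f" "tmap n m g"
  shows "linear_on_set (tpow n) tscale sW (\<lambda>x. f (g x))"
  by (rule linear_on_set_comp[OF tmap_linear[OF assms(2)] tmap_closed[OF assms(2)] assms(1)])

lemma multilinear_tensor:
  "multilinear scale tscale n (\<lambda>xs. tensor (us @ xs @ vs))"
  by (rule multilinear_context[OF multilinear_pure_tensor refl])

text \<open>The outer bimodule structure of a tensor power, without signs.\<close>

definition lmul :: "nat \<Rightarrow> 'a \<Rightarrow> ('k, 'a) tensor \<Rightarrow> ('k, 'a) tensor" where
  "lmul n a = extend n tscale (\<lambda>xs. tensor (a * hd xs # tl xs))"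

definition rmul :: "nat \<Rightarrow> 'a \<Rightarrow> ('k, 'a) tensor \<Rightarrow> ('k, 'a) tensor" where
  "rmul n b = extend n tscale (\<lambda>xs. tensor (butlast xs @ [last xs * b]))"

definition prepend :: "nat \<Rightarrow> 'a \<Rightarrow> ('k, 'a) tensor \<Rightarrow> ('k, 'a) tensor" where
  "prepend n a = extend n tscale (\<lambda>xs. tensor (a # xs))"

definition tensor_twist :: "nat \<Rightarrow> int \<Rightarrow> ('k, 'a) tensor \<Rightarrow> ('k, 'a) tensor" where
  "tensor_twist n j = extend n tscale (\<lambda>xs. tensor (map (twist j) xs))"

lemma multilinear_lmul: "multilinear scale tscale (Suc n) (\<lambda>xs. tensor (a * hd xs # tl xs))"
proof (rule multilinear_Cons)
  show "multilinear scale tscale n (\<lambda>xs. tensor (a * x # xs))" for x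
    using multilinear_tensor[of n "[a * x]" "[]"] by simp
  show "linear_on_set UNIV scale tscale (\<lambda>x. tensor (a * x # xs))" for xs
    using tensor_slot[of "[]" xs]
    by (simp add: linear_on_set_def distrib_left scale_mult_right[symmetric])
qed

lemma multilinear_rmul: "multilinear scale tscale (Suc n) (\<lambda>xs. tensor (butlast xs @ [last xs * b]))"
proof (rule multilinear_snoc)
  show "multilinear scale tscale n (\<lambda>xs. tensor (xs @ [x * b]))" for x
    using multilinear_tensor[of n "[]" "[x * b]"] by simp
  show "linear_on_set UNIV scale tscale (\<lambda>x. tensor (xs @ [x * b]))" for xs
    using tensor_slot[of xs "[]"]
    by (simp add: linear_on_set_def distrib_right scale_mult_left[symmetric])
qed

lemma multilinear_prepend: "multilinear scale tscale n (\<lambda>xs. tensor (a # xs))"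
  using multilinear_tensor[of n "[a]" "[]"] by simp

lemma multilinear_tensor_twist: "multilinear scale tscale n (\<lambda>xs. tensor (map (twist j) xs))"
  by (rule multilinear_map[OF multilinear_pure_tensor twist_linear])

lemma lmul: "tmap (Suc n) (Suc n) (lmul (Suc n) a)"
  unfolding lmul_def by (rule tmap_extend[OF multilinear_lmul]) (auto intro: tpow_tensor)

lemma rmul: "tmap (Suc n) (Suc n) (rmul (Suc n) a)"
  unfolding rmul_def by (rule tmap_extend[OF multilinear_rmul]) (auto intro: tpow_tensor)

lemma prepend: "tmap n (Suc n) (prepend n a)"
  unfolding prepend_def by (rule tmap_extend[OF multilinear_prepend]) (auto intro: tpow_tensor)

lemma tensor_twist: "tmap n n (tensor_twist n j)"
  unfolding tensor_twist_def by (rule tmap_extend[OF multilinear_tensor_twist]) (auto intro: tpow_tensor)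

lemma lmul_tensor [simp]: "length xs = n \<Longrightarrow> lmul (Suc n) a (tensor (x # xs)) = tensor (a * x # xs)"
  unfolding lmul_def by (simp add: extend_tensor[OF vector_space_tscale multilinear_lmul])

lemma rmul_tensor [simp]: "length xs = n \<Longrightarrow> rmul (Suc n) b (tensor (xs @ [x])) = tensor (xs @ [x * b])"
  unfolding rmul_def by (simp add: extend_tensor[OF vector_space_tscale multilinear_rmul])

lemma rmul_tensor_Cons: "length xs = n \<Longrightarrow> rmul (Suc (Suc n)) b (tensor (y # xs @ [x])) = tensor (y # xs @ [x * b])"
  using rmul_tensor[of "y # xs" "Suc n"] by simp

lemma prepend_tensor [simp]: "length xs = n \<Longrightarrow> prepend n a (tensor xs) = tensor (a # xs)"
  unfolding prepend_def by (simp add: extend_tensor[OF vector_space_tscale multilinear_prepend])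

lemma tensor_twist_tensor [simp]: "length xs = n \<Longrightarrow> tensor_twist n j (tensor xs) = tensor (map (twist j) xs)"
  unfolding tensor_twist_def by (simp add: extend_tensor[OF vector_space_tscale multilinear_tensor_twist])

lemma lmul_linear: "linear_on_set UNIV scale tscale (\<lambda>a. lmul (Suc n) a x)"
proof (cases "x \<in> tpow (Suc n)")
  case True
  show ?thesis
  proof (rule linear_parameter[OF vector_space_tscale tmap_linear[OF lmul] _ True])
    fix xs :: "'a list" assume "length xs = Suc n"
    then show "linear_on_set UNIV scale tscale (\<lambda>a. lmul (Suc n) a (tensor xs))"
      using tensor_slot[of "[]" "tl xs"]
      by (cases xs) (auto simp: linear_on_set_def distrib_right scale_mult_left[symmetric])
  qed
qed (simp add: tmap_off[OF lmul] linear_on_set_zero[OF vector_space_tscale])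

lemma rmul_linear: "linear_on_set UNIV scale tscale (\<lambda>a. rmul (Suc n) a x)"
proof (cases "x \<in> tpow (Suc n)")
  case True
  show ?thesis
  proof (rule linear_parameter[OF vector_space_tscale tmap_linear[OF rmul] _ True])
    fix xs :: "'a list" assume "length xs = Suc n"
    then show "linear_on_set UNIV scale tscale (\<lambda>a. rmul (Suc n) a (tensor xs))"
      using tensor_slot[of "butlast xs" "[]"]
      by (cases xs rule: rev_cases) (auto simp: linear_on_set_def distrib_left scale_mult_right[symmetric])
  qed
qed (simp add: tmap_off[OF rmul] linear_on_set_zero[OF vector_space_tscale])

lemma prepend_linear: "linear_on_set UNIV scale tscale (\<lambda>a. prepend n a x)"
proof (cases "x \<in> tpow n")
  case True
  show ?thesis
  proof (rule linear_parameter[OF vector_space_tscale tmap_linear[OF prepend] _ True])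
    fix xs :: "'a list" assume "length xs = n"
    then show "linear_on_set UNIV scale tscale (\<lambda>a. prepend n a (tensor xs))"
      using tensor_slot[of "[]" xs] by simp
  qed
qed (simp add: tmap_off[OF prepend] linear_on_set_zero[OF vector_space_tscale])

lemma lmul_one [simp]: "x \<in> tpow (Suc n) \<Longrightarrow> lmul (Suc n) 1 x = x"
  by (rule linear_on_tpow_eqI[where f = "lmul (Suc n) 1" and g = "\<lambda>x. x", OF _ tmap_linear[OF lmul] linear_on_set_id])
    (auto simp: length_Suc_conv)

lemma rmul_one [simp]: "x \<in> tpow (Suc n) \<Longrightarrow> rmul (Suc n) 1 x = x"
  by (rule linear_on_tpow_eqI[where f = "rmul (Suc n) 1" and g = "\<lambda>x. x", OF _ tmap_linear[OF rmul] linear_on_set_id])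
    (auto simp: length_Suc_conv_rev)

lemma lmul_prepend:
  assumes "x \<in> tpow n" shows "lmul (Suc n) a (prepend n b x) = prepend n (a * b) x"
  by (rule linear_on_tpow_eqI[OF assms linear_tmap_comp[OF tmap_linear[OF lmul[of n a]] prepend[of n b]]
      tmap_linear[OF prepend[of n "a * b"]]]) auto

lemma rmul_prepend:
  assumes "x \<in> tpow (Suc n)"
  shows "rmul (Suc (Suc n)) b (prepend (Suc n) a x) = prepend (Suc n) a (rmul (Suc n) b x)"
  by (rule linear_on_tpow_eqI[OF assms linear_tmap_comp[OF tmap_linear[OF rmul[of "Suc n" b]] prepend[of "Suc n" a]]
      linear_tmap_comp[OF tmap_linear[OF prepend[of "Suc n" a]] rmul[of n b]]])
    (auto simp: length_Suc_conv_rev rmul_tensor_Cons)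

lemma tensor_twist_homogeneous_tensor:
  "has_degrees xs ts \<Longrightarrow> tensor (us @ map (twist j) xs @ vs) = tscale ((-1) powi (j * sum_list ts)) (tensor (us @ xs @ vs))"
proof (induction xs arbitrary: us ts)
  case Nil
  then show ?case by (simp add: has_degrees_def)
next
  case (Cons x xs)
  then obtain t ts' where ts: "ts = t # ts'" "x \<in> gr t" "has_degrees xs ts'"
    by (auto simp: has_degrees_def list_all2_Cons1)
  have "tensor (us @ map (twist j) (x # xs) @ vs) = tscale ((-1) powi (j * t)) (tensor ((us @ [x]) @ map (twist j) xs @ vs))"
    by (simp add: twist_homogeneous[OF ts(2)] tensor_scale)
  also have "\<dots> = tscale ((-1) powi (j * sum_list ts)) (tensor (us @ x # xs @ vs))"
    by (simp only: Cons.IH[OF ts(3)]) (simp add: ts(1) distrib_left minus_one_powi_add)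
  finally show ?case by simp
qed

lemma tensor_twist_homogeneous:
  assumes "x \<in> homogeneous_tensors n u"
  shows "tensor_twist n j x = tscale ((-1) powi (j * u)) x"
proof -
  have "x \<in> tpow n \<and> tensor_twist n j x = tscale ((-1) powi (j * u)) x"
    using assms unfolding homogeneous_tensors_def
  proof (rule tensor_space_span_induct)
    fix x assume "x \<in> {tensor xs |xs. length xs = n \<and> (\<exists>ts. has_degrees xs ts \<and> sum_list ts = u)}"
    then show "x \<in> tpow n \<and> tensor_twist n j x = tscale ((-1) powi (j * u)) x"
      using tensor_twist_homogeneous_tensor[of _ _ "[]" _ "[]"] by (auto intro: tpow_tensor)
  qed (use tmap_linear[OF tensor_twist, of n j] in \<open>auto simp: linear_on_set_def tmap_zero[OF tensor_twist]
        intro: tpow_add tpow_scale tensor_space.scale_left_commute tensor_space.scale_right_distrib[symmetric]\<close>)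
  then show ?thesis by simp
qed

section \<open>Homomorphisms out of the bar modules\<close>

text \<open>The action of \<open>\<mu> \<otimes> \<mu>'\<close> on a bar module has the sign \<open>(-1)\<^bsup>|\<mu>||x|\<^esup>\<close>. Summing over the components of
  \<open>\<mu>\<close>, and twisting \<open>x\<close> by the degree of each of them, gives a formula that is linear in \<open>\<mu>\<close>, in \<open>\<mu>'\<close> and
  in \<open>x\<close> without assuming any of them to be homogeneous.\<close>

definition bar_pairing :: "nat \<Rightarrow> ('k, 'a) tensor \<Rightarrow> 'a list \<Rightarrow> ('k, 'a) tensor" where
  "bar_pairing n x ms =
     degreewise (\<lambda>p a. lmul (Suc n) a (rmul (Suc n) (ms ! 1) (tensor_twist (Suc n) p x))) (ms ! 0)"

lemma multilinear_bar_pairing: "multilinear scale tscale 2 (bar_pairing n x)"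
  unfolding bar_pairing_def
proof (rule multilinear_bilinear)
  show "linear_on_set UNIV scale tscale
      (degreewise (\<lambda>p a. lmul (Suc n) a (rmul (Suc n) b (tensor_twist (Suc n) p x))))" for b
    by (rule degreewise_linear[OF vector_space_tscale lmul_linear])
  show "linear_on_set UNIV scale tscale (\<lambda>b.
      degreewise (\<lambda>p a. lmul (Suc n) a (rmul (Suc n) b (tensor_twist (Suc n) p x))) a)" for a
    unfolding degreewise_def
    by (intro linear_on_set_sum vector_space_tscale linear_on_set_comp[OF rmul_linear tmap_closed[OF rmul] tmap_linear[OF lmul]])
qed

lemma bar_pairing_linear: "tlinear (Suc n) tscale (\<lambda>x. bar_pairing n x ms)"
  unfolding tlinear_def
proof
  show "zero_off (tpow (Suc n)) (\<lambda>x. bar_pairing n x ms)"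
    unfolding zero_off_def bar_pairing_def degreewise_def
    by (simp add: tmap_off[OF tensor_twist] tmap_zero[OF rmul] tmap_zero[OF lmul])
  show "linear_on_set (tpow (Suc n)) tscale tscale (\<lambda>x. bar_pairing n x ms)"
    unfolding bar_pairing_def degreewise_def
    by (intro linear_on_set_sum vector_space_tscale)
      (rule linear_tmap_comp[OF linear_tmap_comp[OF tmap_linear[OF lmul] rmul] tensor_twist])
qed

text \<open>For homogeneous \<open>x\<close> the roles can be exchanged: the sign is the twist of \<open>a\<close> by the degree of \<open>x\<close>.\<close>

lemma bar_pairing_homogeneous:
  assumes "x \<in> homogeneous_tensors (Suc n) u"
  shows "bar_pairing n x [a, b] = lmul (Suc n) (twist u a) (rmul (Suc n) b x)"
proof -
  have "lmul (Suc n) a' (rmul (Suc n) b (tensor_twist (Suc n) p x))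
      = lmul (Suc n) (scale ((-1) powi (u * p)) a') (rmul (Suc n) b x)" for a' p
  proof -
    have x: "x \<in> tpow (Suc n)" using assms homogeneous_tensors_subset by blast
    have "rmul (Suc n) b (tscale c x) = tscale c (rmul (Suc n) b x)" for c
      using tmap_linear[OF rmul] x by (auto simp: linear_on_set_def)
    moreover have "lmul (Suc n) a' (tscale c y) = lmul (Suc n) (scale c a') y" if "y \<in> tpow (Suc n)" for c y
      using tmap_linear[OF lmul] lmul_linear that by (auto simp: linear_on_set_def)
    ultimately show ?thesis
      by (simp add: tensor_twist_homogeneous[OF assms] tmap_closed[OF rmul] mult.commute)
  qed
  note * = this
  have add: "lmul (Suc n) (y + z) w = lmul (Suc n) y w + lmul (Suc n) z w" for y z w
    using lmul_linear[of n w] by (auto simp: linear_on_set_def)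
  have zero: "lmul (Suc n) 0 w = 0" for w using add[of 0 0 w] by simp
  have "lmul (Suc n) (\<Sum>i\<in>I. g i) w = (\<Sum>i\<in>I. lmul (Suc n) (g i) w)" for w I and g :: "int \<Rightarrow> 'a"
    by (induction I rule: infinite_finite_induct) (auto simp: add zero)
  then show ?thesis
    unfolding bar_pairing_def twist_def degreewise_def by (simp add: *)
qed

lemma bar_act_eq: "bar_act n x r = extend 2 tscale (bar_pairing (Suc n) x) r"
proof -
  have off: "extend 2 tscale (bar_pairing (Suc n) x) = (\<lambda>_. 0)" if "x \<notin> tpow (Suc (Suc n))" for x
    by (rule tlinear_eqI[OF tlinear_extend[OF vector_space_tscale multilinear_bar_pairing]])
      (use that tlinear_off[OF bar_pairing_linear] in \<open>auto simp: tlinear_def zero_off_def linear_on_set_zero[OF vector_space_tscale] extend_tensor[OF vector_space_tscale multilinear_bar_pairing]\<close>)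
  show ?thesis
    unfolding bar_act_def
  proof (rule fun_cong[OF lift_eqI])
    show "tlinear (n + 2) tscale (\<lambda>x. extend 2 tscale (bar_pairing (Suc n) x) r)"
      using extend_parameter[OF vector_space_tscale multilinear_bar_pairing tlinearD[OF bar_pairing_linear], of "Suc n" r]
      by (simp add: tlinear_def zero_off_def off)
  next
    fix xs ts assume xs: "length xs = n + 2" "has_degrees xs ts"
    then have hom: "tensor xs \<in> homogeneous_tensors (Suc (Suc n)) (sum_list ts)"
      by (auto intro: tensor_homogeneous)
    have "lift 2 tscale (\<lambda>ms ps. tscale ((-1) powi (ps ! 0 * sum_list ts))
           (tensor ((ms ! 0 * hd xs) # butlast (tl xs) @ [last xs * ms ! 1]))) =
       extend 2 tscale (bar_pairing (Suc n) (tensor xs))"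
    proof (rule lift_eq_extend[OF vector_space_tscale multilinear_bar_pairing])
      fix ms ps assume ms: "length ms = 2" "has_degrees ms ps"
      then obtain a b p q where [simp]: "ms = [a, b]" "ps = [p, q]" and a: "a \<in> gr p"
        by (auto simp: length_Suc_conv numeral_2_eq_2 has_degrees_def list_all2_Cons1)
      obtain y zs z where [simp]: "xs = y # zs @ [z]" "length zs = n"
      proof (cases xs)
        case (Cons y ys)
        then show ?thesis using that xs by (cases ys rule: rev_cases) auto
      qed (use xs in auto)
      have "bar_pairing (Suc n) (tensor xs) ms = lmul (Suc (Suc n)) (scale ((-1) powi (p * sum_list ts)) a) (tensor (y # zs @ [z * b]))"
        by (simp add: bar_pairing_homogeneous[OF hom[simplified]] rmul_tensor_Cons twist_homogeneous[OF a] mult.commute)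
      also have "\<dots> = tscale ((-1) powi (p * sum_list ts)) (tensor (a * y # zs @ [z * b]))"
        using tensor_scale[of "[]"] by (simp add: scale_mult_left[symmetric])
      finally show "bar_pairing (Suc n) (tensor xs) ms = tscale ((-1) powi (ps ! 0 * sum_list ts))
           (tensor ((ms ! 0 * hd xs) # butlast (tl xs) @ [last xs * ms ! 1]))"
        by (simp add: butlast_append)
    qed
    then show "extend 2 tscale (bar_pairing (Suc n) (tensor xs)) r =
      lift 2 tscale (\<lambda>ms ps. tscale ((-1) powi (ps ! 0 * sum_list ts))
           (tensor ((ms ! 0 * hd xs) # butlast (tl xs) @ [last xs * ms ! 1]))) r" by simp
  qed
qed

definition closed_linear :: "('k \<Rightarrow> 'w::ab_group_add \<Rightarrow> 'w) \<Rightarrow> 'w set \<Rightarrow> bool" where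
  "closed_linear sW W \<longleftrightarrow> 0 \<in> W \<and> (\<forall>y\<in>W. (\<forall>z\<in>W. y + z \<in> W) \<and> (\<forall>c. sW c y \<in> W))"

text \<open>What the bar modules and the algebra have in common as targets of homomorphisms: on elements of degree
  \<open>u\<close> the right action of \<open>a \<otimes> b\<close> is \<open>twist u a\<close> from the left and \<open>b\<close> from the right. The left and right
  multiplications \<open>l\<close> and \<open>r\<close> are free of signs.\<close>

definition two_sided where
  "two_sided N l r \<longleftrightarrow>
    (\<forall>u. \<forall>y\<in>homog N u. y \<in> elts N \<and> (\<forall>a b. act N y (tensor [a, b]) = l (twist u a) (r b y))) \<and>
    (\<forall>s. linear_on_set (elts N) (kscale N) (kscale N) (\<lambda>y. act N y s)) \<and>
    (\<forall>y. linear_on_set (tpow 2) tscale (kscale N) (act N y)) \<and>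
    (\<forall>a. linear_on_set (elts N) (kscale N) (kscale N) (l a) \<and> linear_on_set (elts N) (kscale N) (kscale N) (r a)) \<and>
    (\<forall>y\<in>elts N. l 1 y = y \<and> r 1 y = y \<and> (\<forall>a. l a y \<in> elts N \<and> r a y \<in> elts N)) \<and>
    closed_linear (kscale N) (elts N) \<and> (\<forall>u. closed_linear (kscale N) (homog N u))"

lemma homogeneous_tensors_subspace:
  "0 \<in> homogeneous_tensors n u"
  "x \<in> homogeneous_tensors n u \<Longrightarrow> y \<in> homogeneous_tensors n u \<Longrightarrow> x + y \<in> homogeneous_tensors n u"
  "x \<in> homogeneous_tensors n u \<Longrightarrow> tscale c x \<in> homogeneous_tensors n u"
  unfolding homogeneous_tensors_def
  by (auto intro: tensor_space.span_zero tensor_space.span_add tensor_space.span_scale)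

lemma bar_simps: "elts (bar n) = tpow (Suc (Suc n))" "homog (bar n) = homogeneous_tensors (Suc (Suc n))"
  "kscale (bar n) = tscale" "act (bar n) = bar_act n"
  by (simp_all add: bar_def homogeneous_tensors_def fun_eq_iff)

lemma two_sided_bar: "two_sided (bar n) (lmul (Suc (Suc n))) (rmul (Suc (Suc n)))"
proof -
  have "linear_on_set (tpow (Suc (Suc n))) tscale tscale (\<lambda>y. bar_act n y s)" for s
    unfolding bar_act_eq
    by (rule extend_parameter[OF vector_space_tscale multilinear_bar_pairing tlinearD[OF bar_pairing_linear]])
  moreover have "linear_on_set (tpow 2) tscale tscale (bar_act n y)" for y
    unfolding bar_act_eq by (rule tlinearD[OF tlinear_extend[OF vector_space_tscale multilinear_bar_pairing]])
  moreover have "bar_act n y (tensor [a, b]) = lmul (Suc (Suc n)) (twist u a) (rmul (Suc (Suc n)) b y)"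
    if "y \<in> homogeneous_tensors (Suc (Suc n)) u" for y u a b
    using that by (simp add: bar_act_eq extend_tensor[OF vector_space_tscale multilinear_bar_pairing] bar_pairing_homogeneous)
  ultimately show ?thesis
    unfolding two_sided_def bar_simps
    using homogeneous_tensors_subset homogeneous_tensors_subspace
    by (auto simp: closed_linear_def tpow_add tpow_scale subsetD[OF homogeneous_tensors_subset] intro: tmap_closed[OF lmul] tmap_closed[OF rmul] tmap_linear[OF lmul] tmap_linear[OF rmul])
qed

lemma multilinear_algebra_act: "multilinear scale scale 2 (\<lambda>ms. twist t (ms ! 0) * y * ms ! 1)"
  by (rule multilinear_bilinear[where F = "\<lambda>a b. twist t a * y * b"])
    (auto simp: linear_on_set_def distrib_left distrib_right scale_mult_left[symmetric] scale_mult_right[symmetric])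

lemma algebra_act_eq: "algebra_act x r = degreewise (\<lambda>t y. extend 2 scale (\<lambda>ms. twist t (ms ! 0) * y * ms ! 1) r) x"
proof -
  have "lift 2 scale (\<lambda>ms ps. scale ((-1) powi (ps ! 0 * t)) (ms ! 0 * y * ms ! 1)) =
      extend 2 scale (\<lambda>ms. twist t (ms ! 0) * y * ms ! 1)" for t y
    by (rule lift_eq_extend[OF vector_space_scale multilinear_algebra_act])
      (auto simp: length_Suc_conv numeral_2_eq_2 has_degrees_def list_all2_Cons1 twist_homogeneous scale_mult_left mult.commute)
  then show ?thesis by (simp add: algebra_act_def degreewise_def)
qed

lemma algebra_module_simps: "elts algebra_module = UNIV" "homog algebra_module = gr"
  "kscale algebra_module = scale" "act algebra_module = algebra_act"
  by (simp_all add: algebra_module_def)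

lemma two_sided_algebra: "two_sided algebra_module (*) (\<lambda>b y. y * b)"
proof -
  have lin: "linear_on_set UNIV scale scale (\<lambda>y. extend 2 scale (\<lambda>ms. twist t (ms ! 0) * y * ms ! 1) r)" for t r
    by (rule extend_parameter[OF vector_space_scale multilinear_algebra_act])
      (auto simp: linear_on_set_def distrib_left distrib_right scale_mult_left[symmetric] scale_mult_right[symmetric])
  have "linear_on_set UNIV scale scale (\<lambda>y. algebra_act y s)" for s
    unfolding algebra_act_eq by (rule degreewise_linear[OF vector_space_scale lin])
  moreover have "linear_on_set (tpow 2) tscale scale (algebra_act y)" for y
    unfolding algebra_act_eq degreewise_def
    by (intro linear_on_set_sum vector_space_scale tlinearD[OF tlinear_extend[OF vector_space_scale multilinear_algebra_act]])
  moreover have "algebra_act y (tensor [a, b]) = twist u a * (y * b)" if "y \<in> gr u" for y u a b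
  proof -
    have val: "extend 2 scale (\<lambda>ms. twist t (ms ! 0) * z * ms ! 1) (tensor [a, b]) = twist t a * z * b" for t z
      by (subst extend_tensor[OF vector_space_scale multilinear_algebra_act]) simp_all
    show ?thesis
      unfolding algebra_act_eq val using degreewise_homogeneous[OF that, of "\<lambda>t y. twist t a * y * b"]
      by (simp add: mult.assoc)
  qed
  ultimately show ?thesis
    unfolding two_sided_def algebra_module_simps
    by (auto simp: closed_linear_def linear_on_set_def distrib_left distrib_right scale_mult_left[symmetric] scale_mult_right[symmetric] gr_add gr_scale)
qed

text \<open>In this form equivariance is free of signs and of homogeneity conditions. On an element of degree \<open>u\<close>,
  multiplication by \<open>a\<close> from the left is the action of \<open>twist u a \<otimes> 1\<close>; after a map of degree \<open>t\<close> the same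
  element acts as multiplication by \<open>twist (u + t) (twist u a) = twist t a\<close>, as \<open>twist\<close> depends only on the
  parity of its index.\<close>

lemma Hom_bar_iff:
  assumes N: "two_sided N l r"
  shows "f \<in> Hom t (bar p) N \<longleftrightarrow>
    tlinear (Suc (Suc p)) (kscale N) f \<and> f ` tpow (Suc (Suc p)) \<subseteq> elts N \<and>
    (\<forall>u. f ` homogeneous_tensors (Suc (Suc p)) u \<subseteq> homog N (u + t)) \<and>
    (\<forall>x\<in>tpow (Suc (Suc p)). \<forall>a. f (lmul (Suc (Suc p)) a x) = l (twist t a) (f x) \<and> f (rmul (Suc (Suc p)) a x) = r a (f x))"
    (is "?L \<longleftrightarrow> ?lin \<and> ?img \<and> ?deg \<and> ?eqv")
proof -
  let ?n = "Suc (Suc p)"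
  have lin_l: "linear_on_set (elts N) (kscale N) (kscale N) (l a)"
    and lin_r: "linear_on_set (elts N) (kscale N) (kscale N) (r a)"
    and one: "y \<in> elts N \<Longrightarrow> l 1 y = y" "y \<in> elts N \<Longrightarrow> r 1 y = y"
    and clr: "y \<in> elts N \<Longrightarrow> l a y \<in> elts N" "y \<in> elts N \<Longrightarrow> r a y \<in> elts N"
    and act: "y \<in> homog N u \<Longrightarrow> act N y (tensor [a, b]) = l (twist u a) (r b y)"
    and lin1: "linear_on_set (elts N) (kscale N) (kscale N) (\<lambda>y. act N y s)"
    and lin2: "linear_on_set (tpow 2) tscale (kscale N) (act N y)" for y a b u s
    using N unfolding two_sided_def by auto
  have bact: "bar_act p y (tensor [a, b]) = lmul ?n (twist u a) (rmul ?n b y)"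
    if "y \<in> homogeneous_tensors ?n u" for y a b u
    using two_sided_bar[of p] that unfolding two_sided_def bar_simps by auto
  have blin1: "linear_on_set (tpow ?n) tscale tscale (\<lambda>y. bar_act p y s)"
    and blin2: "linear_on_set (tpow 2) tscale tscale (bar_act p y)" for y s
    using two_sided_bar[of p] unfolding two_sided_def bar_simps by auto
  have bmem: "bar_act p y s \<in> tpow ?n" for y s
    unfolding bar_act_eq
    by (rule tmap_closed[OF tmap_extend[OF multilinear_bar_pairing]])
      (auto simp: bar_pairing_def degreewise_def intro!: tpow_sum tmap_closed[OF lmul])
  show ?thesis
  proof
    assume L: ?L
    then have lin: ?lin and img: ?img and deg: ?deg
      and eqv: "\<And>x s. x \<in> tpow ?n \<Longrightarrow> s \<in> tpow 2 \<Longrightarrow> f (bar_act p x s) = act N (f x) s"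
      unfolding Hom_def bar_simps tlinear_def by auto
    note flin = tlinearD[OF lin]
    have im: "x \<in> tpow ?n \<Longrightarrow> f x \<in> elts N" for x using img by auto
    have mem2: "tensor [a, b] \<in> tpow 2" for a b by (rule tpow_tensor) simp
    \<comment> \<open>Acting with \<open>twist u a\<close> undoes the sign in the action on elements of degree \<open>u\<close>.\<close>
    have key: "f (lmul ?n a (rmul ?n b (tensor xs))) = l (twist t a) (r b (f (tensor xs)))"
      if "length xs = ?n" "has_degrees xs ts" for a b xs ts
    proof -
      let ?u = "sum_list ts"
      have h: "tensor xs \<in> homogeneous_tensors ?n ?u" using that by (auto intro: tensor_homogeneous)
      have m: "tensor xs \<in> tpow ?n" using that by (auto intro: tpow_tensor)
      have fh: "f (tensor xs) \<in> homog N (?u + t)" using deg h by auto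
      have "lmul ?n a (rmul ?n b (tensor xs)) = bar_act p (tensor xs) (tensor [twist ?u a, b])"
        by (simp add: bact[OF h] twist_twist twist_even)
      then show ?thesis by (simp add: eqv[OF m mem2] act[OF fh])
    qed
    have "f (lmul ?n a x) = l (twist t a) (f x)" if "x \<in> tpow ?n" for a x
    proof (rule linear_on_tpow_eqI[OF that])
      show "linear_on_set (tpow ?n) tscale (kscale N) (\<lambda>x. f (lmul ?n a x))"
        by (rule linear_tmap_comp[OF flin lmul])
      show "linear_on_set (tpow ?n) tscale (kscale N) (\<lambda>x. l (twist t a) (f x))"
        by (rule linear_on_set_comp[OF flin im lin_l])
      fix xs ts assume xs: "length xs = ?n" "has_degrees xs ts"
      have m: "tensor xs \<in> tpow ?n" using xs by (auto intro: tpow_tensor)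
      show "f (lmul ?n a (tensor xs)) = l (twist t a) (f (tensor xs))"
        using key[OF xs, of a 1] m by (simp add: one im)
    qed
    moreover have "f (rmul ?n a x) = r a (f x)" if "x \<in> tpow ?n" for a x
    proof (rule linear_on_tpow_eqI[OF that])
      show "linear_on_set (tpow ?n) tscale (kscale N) (\<lambda>x. f (rmul ?n a x))"
        by (rule linear_tmap_comp[OF flin rmul])
      show "linear_on_set (tpow ?n) tscale (kscale N) (\<lambda>x. r a (f x))"
        by (rule linear_on_set_comp[OF flin im lin_r])
      fix xs ts assume xs: "length xs = ?n" "has_degrees xs ts"
      have m: "tensor xs \<in> tpow ?n" using xs by (auto intro: tpow_tensor)
      show "f (rmul ?n a (tensor xs)) = r a (f (tensor xs))"
        using key[OF xs, of 1 a] m by (simp add: one im clr tmap_closed[OF rmul])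
    qed
    ultimately show "?lin \<and> ?img \<and> ?deg \<and> ?eqv" using lin img deg by blast
  next
    assume R: "?lin \<and> ?img \<and> ?deg \<and> ?eqv"
    then have lin: ?lin and img: ?img and deg: ?deg and eqv: ?eqv by blast+
    note flin = tlinearD[OF lin]
    have im: "x \<in> tpow ?n \<Longrightarrow> f x \<in> elts N" for x using img by auto
    have "f (bar_act p x s) = act N (f x) s" if x: "x \<in> tpow ?n" and s: "s \<in> tpow 2" for x s
    proof (rule linear_on_tpow_eqI[OF x])
      show "linear_on_set (tpow ?n) tscale (kscale N) (\<lambda>x. f (bar_act p x s))"
        by (rule linear_on_set_comp[OF blin1 bmem flin])
      show "linear_on_set (tpow ?n) tscale (kscale N) (\<lambda>x. act N (f x) s)"
        by (rule linear_on_set_comp[OF flin im lin1])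
      fix xs ts assume xs: "length xs = ?n" "has_degrees xs ts"
      let ?u = "sum_list ts"
      have h: "tensor xs \<in> homogeneous_tensors ?n ?u" using xs by (auto intro: tensor_homogeneous)
      have m: "tensor xs \<in> tpow ?n" using xs by (auto intro: tpow_tensor)
      have fh: "f (tensor xs) \<in> homog N (?u + t)" using deg h by auto
      show "f (bar_act p (tensor xs) s) = act N (f (tensor xs)) s"
      proof (rule linear_on_tpow_eqI[OF s])
        show "linear_on_set (tpow 2) tscale (kscale N) (\<lambda>s. f (bar_act p (tensor xs) s))"
          by (rule linear_on_set_comp[OF blin2 bmem flin])
        show "linear_on_set (tpow 2) tscale (kscale N) (act N (f (tensor xs)))" by (rule lin2)
        fix ms ps assume "length ms = 2" "has_degrees ms ps"
        then obtain a b where "ms = [a, b]" by (auto simp: length_Suc_conv numeral_2_eq_2)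
        moreover have "f (bar_act p (tensor xs) (tensor [a, b])) = l (twist t (twist ?u a)) (r b (f (tensor xs)))"
          using eqv m tmap_closed[OF rmul] by (simp add: bact[OF h])
        moreover have "act N (f (tensor xs)) (tensor [a, b]) = l (twist t (twist ?u a)) (r b (f (tensor xs)))"
          by (simp add: act[OF fh] twist_twist add.commute)
        ultimately show "f (bar_act p (tensor xs) (tensor ms)) = act N (f (tensor xs)) (tensor ms)" by simp
      qed
    qed
    then show ?L using lin img deg unfolding Hom_def bar_simps tlinear_def by auto
  qed
qed

lemma tensor_space_span_into:
  assumes "x \<in> tensor_space.span S" "linear_on_set (tpow n) tscale sW f" "S \<subseteq> tpow n"
    "closed_linear sW W" "\<And>x. x \<in> S \<Longrightarrow> f x \<in> W"
  shows "f x \<in> W"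
proof -
  have "x \<in> tpow n \<and> f x \<in> W"
    using assms(1)
    by (rule tensor_space_span_induct)
      (use assms(2-) linear_on_tpow_zero[OF assms(2)] in
        \<open>auto simp: linear_on_set_def tpow_add tpow_scale closed_linear_def\<close>)
  then show ?thesis by simp
qed

lemma Hom_extendI:
  assumes N: "two_sided N l r" and sW: "vector_space (kscale N)"
    and F: "multilinear scale (kscale N) (Suc (Suc p)) F"
    and elts: "\<And>xs. length xs = Suc (Suc p) \<Longrightarrow> F xs \<in> elts N"
    and deg: "\<And>xs ts. length xs = Suc (Suc p) \<Longrightarrow> has_degrees xs ts \<Longrightarrow> F xs \<in> homog N (sum_list ts + t)"
    and left: "\<And>a x xs. length xs = Suc p \<Longrightarrow> F (a * x # xs) = l (twist t a) (F (x # xs))"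
    and right: "\<And>b x xs. length xs = Suc p \<Longrightarrow> F (xs @ [x * b]) = r b (F (xs @ [x]))"
  shows "extend (Suc (Suc p)) (kscale N) F \<in> Hom t (bar p) N"
proof -
  let ?n = "Suc (Suc p)" and ?f = "extend (Suc (Suc p)) (kscale N) F"
  have lin_l: "linear_on_set (elts N) (kscale N) (kscale N) (l a)"
    and lin_r: "linear_on_set (elts N) (kscale N) (kscale N) (r a)"
    and hom: "closed_linear (kscale N) (elts N)" "closed_linear (kscale N) (homog N u)" for a u
    using N unfolding two_sided_def by auto
  note lin = tlinear_extend[OF sW F] and val = extend_tensor[OF sW F]
  note flin = tlinearD[OF lin]
  have degf: "?f ` homogeneous_tensors ?n u \<subseteq> homog N (u + t)" for u
  proof clarify
    fix x assume "x \<in> homogeneous_tensors ?n u"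
    then show "?f x \<in> homog N (u + t)"
      unfolding homogeneous_tensors_def
      by (rule tensor_space_span_into[OF _ flin]) (use hom deg val in \<open>auto intro: tpow_tensor\<close>)
  qed
  have img: "?f x \<in> elts N" if "x \<in> tpow ?n" for x
    using that[unfolded tensor_power_def]
    by (rule tensor_space_span_into[OF _ flin]) (use hom elts val in \<open>auto intro: tpow_tensor\<close>)
  show ?thesis
    unfolding Hom_bar_iff[OF N]
  proof (intro conjI allI ballI)
    fix x a assume x: "x \<in> tpow ?n"
    show "?f (lmul ?n a x) = l (twist t a) (?f x)"
    proof (rule linear_on_tpow_eqI[OF x linear_tmap_comp[OF flin lmul] linear_on_set_comp[OF flin img lin_l]])
      fix xs ts assume "length xs = ?n" "has_degrees xs ts"
      then show "?f (lmul ?n a (tensor xs)) = l (twist t a) (?f (tensor xs))"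
        by (cases xs) (auto simp: val left)
    qed
    show "?f (rmul ?n a x) = r a (?f x)"
    proof (rule linear_on_tpow_eqI[OF x linear_tmap_comp[OF flin rmul] linear_on_set_comp[OF flin img lin_r]])
      fix xs ts assume "length xs = ?n" "has_degrees xs ts"
      then show "?f (rmul ?n a (tensor xs)) = r a (?f (tensor xs))"
        by (cases xs rule: rev_cases) (auto simp: val right)
    qed
  qed (use lin img degf in auto)
qed

section \<open>The bar differential\<close>

lemma has_degrees_simps [simp]:
  "has_degrees [] ts \<longleftrightarrow> ts = []"
  "has_degrees (x # xs) ts \<longleftrightarrow> (\<exists>t ts'. ts = t # ts' \<and> x \<in> gr t \<and> has_degrees xs ts')"
  by (auto simp: has_degrees_def list_all2_Cons1)

lemma has_degrees_append:
  "has_degrees (xs @ ys) ts \<longleftrightarrow> (\<exists>ss us. ts = ss @ us \<and> has_degrees xs ss \<and> has_degrees ys us)"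
  unfolding has_degrees_def list_all2_append1 by (metis list_all2_lengthD)

lemma has_degrees_twist: "has_degrees xs ts \<Longrightarrow> has_degrees (map (twist j) xs) ts"
  by (induction xs arbitrary: ts) (auto intro: twist_gr)

lemma contract_degrees:
  "has_degrees xs ts \<Longrightarrow> i + 2 \<le> length xs \<Longrightarrow> \<exists>ts'. has_degrees (contract i xs) ts' \<and> sum_list ts' = sum_list ts"
proof (induction i arbitrary: xs ts)
  case 0
  then obtain x y zs where xs: "xs = x # y # zs" by (cases xs; cases "tl xs") auto
  then obtain s t us where "ts = s # t # us" "x \<in> gr s" "y \<in> gr t" "has_degrees zs us"
    using 0 by auto
  then show ?case using xs gr_mult[of x s y t] by (intro exI[of _ "(s + t) # us"]) auto
next
  case (Suc i)
  then obtain x zs where xs: "xs = x # zs" by (cases xs) auto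
  then obtain t us where ts: "ts = t # us" "x \<in> gr t" "has_degrees zs us" using Suc.prems by auto
  then obtain us' where "has_degrees (contract i zs) us'" "sum_list us' = sum_list us"
    using Suc.IH[of zs us] Suc.prems xs by auto
  then show ?case using xs ts by (intro exI[of _ "t # us'"]) auto
qed

lemma tmap_add: "tmap n m g \<Longrightarrow> x \<in> tpow n \<Longrightarrow> y \<in> tpow n \<Longrightarrow> g (x + y) = g x + g y"
  and tmap_scale: "tmap n m g \<Longrightarrow> x \<in> tpow n \<Longrightarrow> g (tscale c x) = tscale c (g x)"
  using tmap_linear[of n m g] by (auto simp: linear_on_set_def)

lemma tmap_diff:
  assumes "tmap n m g" "x \<in> tpow n" "y \<in> tpow n" shows "g (x - y) = g x - g y"
  using tmap_add[OF assms(1), of "x - y" y] assms by (simp add: tpow_diff)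

lemma linear_sum_tensor:
  assumes "linear_on_set (tpow n) tscale sW f" "\<And>i. i \<in> I \<Longrightarrow> g i \<in> tpow n"
  shows "f (\<Sum>i\<in>I. tscale (c i) (g i)) = (\<Sum>i\<in>I. sW (c i) (f (g i)))"
  using assms(2)
proof (induction I rule: infinite_finite_induct)
  case (insert i I)
  then have "f (tscale (c i) (g i) + (\<Sum>i\<in>I. tscale (c i) (g i))) = f (tscale (c i) (g i)) + f (\<Sum>i\<in>I. tscale (c i) (g i))"
    using assms(1) by (auto simp: linear_on_set_def tpow_scale tpow_sum)
  then show ?case using insert assms(1) by (simp add: linear_on_set_def)
qed (simp_all add: linear_on_tpow_zero[OF assms(1)])

lemma multilinear_bar_d:
  "multilinear scale tscale (Suc (Suc n)) (\<lambda>xs. \<Sum>i\<le>n. tscale ((-1) ^ i) (tensor (contract i xs)))"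
  by (intro multilinear_sum multilinear_scale vector_space_tscale multilinear_contract scale_mult_left scale_mult_right multilinear_pure_tensor) simp

lemma bar_d_eq:
  "bar_d n = extend (Suc (Suc n)) tscale (\<lambda>xs. \<Sum>i\<le>n. tscale ((-1) ^ i) (tensor (contract i xs)))"
  unfolding bar_d_def by (simp, rule lift_eq_extend[OF vector_space_tscale multilinear_bar_d]) (simp add: contract_def)

lemma bar_d_tensor:
  "length xs = Suc (Suc n) \<Longrightarrow> bar_d n (tensor xs) = (\<Sum>i\<le>n. tscale ((-1) ^ i) (tensor (contract i xs)))"
  unfolding bar_d_eq by (rule extend_tensor[OF vector_space_tscale multilinear_bar_d])

lemma bar_d: "tmap (Suc (Suc n)) (Suc n) (bar_d n)"
  unfolding bar_d_eq
  by (rule tmap_extend[OF multilinear_bar_d]) (auto intro!: tpow_sum tpow_scale tpow_tensor simp: length_contract)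

lemma lmul_contract:
  assumes "length xs = Suc n" "i \<le> n"
  shows "lmul (Suc n) a (tensor (contract i (x # xs))) = tensor (contract i ((a * x) # xs))"
  using assms by (cases i; cases xs) (auto simp: length_contract mult.assoc)

lemma rmul_contract:
  assumes "length xs = Suc (Suc n)" "i \<le> Suc n"
  shows "rmul (Suc (Suc n)) b (tensor (contract i (xs @ [x]))) = tensor (contract i (xs @ [x * b]))"
proof (cases "i = Suc n")
  case True
  obtain ys y where xs: "xs = ys @ [y]" using assms by (cases xs rule: rev_cases) auto
  then have i: "i = length ys + 0" using True assms by simp
  have "contract i (xs @ [z]) = ys @ [y * z]" for z
    unfolding xs i append_assoc contract_append_right by simp
  then show ?thesis using xs assms by (simp add: mult.assoc)
next
  case False
  then show ?thesis using assms by (simp add: contract_append_left length_contract)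
qed

lemma bar_d_lmul:
  assumes "x \<in> tpow (Suc (Suc n))"
  shows "bar_d n (lmul (Suc (Suc n)) a x) = lmul (Suc n) a (bar_d n x)"
proof (rule linear_on_tpow_eqI[OF assms linear_tmap_comp[OF tmap_linear[OF bar_d] lmul] linear_tmap_comp[OF tmap_linear[OF lmul] bar_d]])
  fix xs ts assume "length xs = Suc (Suc n)" "has_degrees xs ts"
  then obtain y ys where xs: "xs = y # ys" "length ys = Suc n" by (cases xs) auto
  have "bar_d n (lmul (Suc (Suc n)) a (tensor xs)) = (\<Sum>i\<le>n. tscale ((-1) ^ i) (tensor (contract i ((a * y) # ys))))"
    using xs by (simp add: bar_d_tensor)
  also have "\<dots> = (\<Sum>i\<le>n. tscale ((-1) ^ i) (lmul (Suc n) a (tensor (contract i (y # ys)))))"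
    using xs by (intro sum.cong refl) (simp add: lmul_contract)
  also have "\<dots> = lmul (Suc n) a (bar_d n (tensor xs))"
    using xs by (simp add: bar_d_tensor)
      (rule linear_sum_tensor[OF tmap_linear[OF lmul], symmetric], simp add: tpow_tensor length_contract)
  finally show "bar_d n (lmul (Suc (Suc n)) a (tensor xs)) = lmul (Suc n) a (bar_d n (tensor xs))" .
qed

text \<open>For \<open>a = 1\<close> this says that prepending \<open>1\<close> is a contracting homotopy of the bar resolution. The
  version for all \<open>a\<close> is also the recursion for the differential that gives \<open>d\<^sup>2 = 0\<close>.\<close>

lemma bar_d_prepend:
  assumes "x \<in> tpow (Suc (Suc n))"
  shows "bar_d (Suc n) (prepend (Suc (Suc n)) a x) = lmul (Suc (Suc n)) a x - prepend (Suc n) a (bar_d n x)"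
proof (rule linear_on_tpow_eqI[OF assms linear_tmap_comp[OF tmap_linear[OF bar_d] prepend]
      linear_on_set_diff[OF vector_space_tscale tmap_linear[OF lmul] linear_tmap_comp[OF tmap_linear[OF prepend] bar_d]]])
  fix xs ts assume "length xs = Suc (Suc n)" "has_degrees xs ts"
  then obtain y ys where xs: "xs = y # ys" "length ys = Suc n" by (cases xs) auto
  have "bar_d (Suc n) (tensor (a # xs)) = tensor (a * y # ys) + (\<Sum>i\<le>n. tscale ((-1) ^ Suc i) (tensor (a # contract i xs)))"
    using xs by (simp add: bar_d_tensor sum.atMost_Suc_shift del: sum.atMost_Suc)
  also have "(\<Sum>i\<le>n. tscale ((-1) ^ Suc i) (tensor (a # contract i xs))) =
      - (\<Sum>i\<le>n. tscale ((-1) ^ i) (tensor (a # contract i xs)))"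
    by (simp add: sum_negf)
  also have "(\<Sum>i\<le>n. tscale ((-1) ^ i) (tensor (a # contract i xs))) = prepend (Suc n) a (bar_d n (tensor xs))"
  proof -
    have "(\<Sum>i\<le>n. tscale ((-1) ^ i) (tensor (a # contract i xs))) =
        (\<Sum>i\<le>n. tscale ((-1) ^ i) (prepend (Suc n) a (tensor (contract i xs))))"
      using xs by (intro sum.cong refl) (simp add: length_contract)
    also have "\<dots> = prepend (Suc n) a (\<Sum>i\<le>n. tscale ((-1) ^ i) (tensor (contract i xs)))"
      using xs by (intro linear_sum_tensor[OF tmap_linear[OF prepend], symmetric]) (simp add: tpow_tensor length_contract)
    finally show ?thesis using xs by (simp add: bar_d_tensor)
  qed
  finally show "bar_d (Suc n) (prepend (Suc (Suc n)) a (tensor xs)) =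
      lmul (Suc (Suc n)) a (tensor xs) - prepend (Suc n) a (bar_d n (tensor xs))"
    using xs by (simp add: fun_Compl_def)
qed

text \<open>By \<open>bar_d_prepend\<close>, on a tensor with first entry \<open>y\<close> and tail \<open>t\<close> the two terms \<open>y \<cdot> d t\<close> cancel and \<open>d\<^sup>2 t\<close>
  remains, which vanishes by induction.\<close>

lemma bar_d_bar_d: "bar_d n (bar_d (Suc n) x) = 0"
proof (cases "x \<in> tpow (Suc (Suc (Suc n)))")
  case True
  then show ?thesis
  proof (induction n arbitrary: x)
    case 0
    show ?case
    proof (rule linear_on_tpow_eqI[OF 0 linear_tmap_comp[OF tmap_linear[OF bar_d] bar_d] linear_on_set_zero[OF vector_space_tscale]])
      fix xs ts assume "length xs = Suc (Suc (Suc 0))" "has_degrees xs ts"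
      then obtain x y z where "xs = [x, y, z]" by (auto simp: length_Suc_conv)
      then show "bar_d 0 (bar_d (Suc 0) (tensor xs)) = 0"
        by (simp add: bar_d_tensor tmap_diff[OF bar_d] tpow_tensor mult.assoc)
    qed
  next
    case (Suc n)
    show ?case
    proof (rule linear_on_tpow_eqI[OF Suc.prems linear_tmap_comp[OF tmap_linear[OF bar_d] bar_d] linear_on_set_zero[OF vector_space_tscale]])
      fix xs ts assume "length xs = Suc (Suc (Suc (Suc n)))" "has_degrees xs ts"
      then obtain y ys where xs: "xs = y # ys" "length ys = Suc (Suc (Suc n))" by (cases xs) auto
      let ?t = "tensor ys"
      have t: "?t \<in> tpow (Suc (Suc (Suc n)))" using xs by (auto intro: tpow_tensor)
      have *: "bar_d (Suc (Suc n)) (tensor xs) = lmul (Suc (Suc (Suc n))) y ?t - prepend (Suc (Suc n)) y (bar_d (Suc n) ?t)"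
        using bar_d_prepend[OF t, of y] xs by simp
      have "bar_d (Suc n) (bar_d (Suc (Suc n)) (tensor xs)) = lmul (Suc (Suc n)) y (bar_d (Suc n) ?t) -
          (lmul (Suc (Suc n)) y (bar_d (Suc n) ?t) - prepend (Suc n) y (bar_d n (bar_d (Suc n) ?t)))"
        using t by (simp add: * tmap_diff[OF bar_d] tmap_closed[OF lmul] tmap_closed[OF prepend] tmap_closed[OF bar_d]
            bar_d_lmul bar_d_prepend)
      also have "\<dots> = 0" by (simp add: Suc.IH[OF t] tmap_zero[OF prepend])
      finally show "bar_d (Suc n) (bar_d (Suc (Suc n)) (tensor xs)) = 0" .
    qed
  qed
next
  case False
  then show ?thesis by (simp add: tmap_off[OF bar_d] tmap_zero[OF bar_d])
qed

lemma bar_d_Hom: "bar_d (Suc n) \<in> Hom 0 (bar (Suc n)) (bar n)"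
proof -
  have "extend (Suc (Suc (Suc n))) (kscale (bar n)) (\<lambda>xs. \<Sum>i\<le>Suc n. tscale ((-1) ^ i) (tensor (contract i xs)))
    \<in> Hom 0 (bar (Suc n)) (bar n)" (is "extend _ _ ?F \<in> _")
  proof (rule Hom_extendI[OF two_sided_bar], unfold bar_simps)
    show "vector_space (tscale :: 'k \<Rightarrow> ('k, 'a) tensor \<Rightarrow> _)" by (rule vector_space_tscale)
    show "multilinear scale tscale (Suc (Suc (Suc n))) ?F" by (rule multilinear_bar_d)
    show "?F xs \<in> tpow (Suc (Suc n))" if "length xs = Suc (Suc (Suc n))" for xs
      using that by (intro tpow_sum tpow_scale tpow_tensor) (simp add: length_contract)
    show "?F xs \<in> homogeneous_tensors (Suc (Suc n)) (sum_list ts + 0)"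
      if xs: "length xs = Suc (Suc (Suc n))" "has_degrees xs ts" for xs ts
    proof -
      have "tensor (contract i xs) \<in> homogeneous_tensors (Suc (Suc n)) (sum_list ts)" if "i \<le> Suc n" for i
        using contract_degrees[OF xs(2), of i] that xs(1) by (auto intro: tensor_homogeneous simp: length_contract)
      then show ?thesis
        unfolding homogeneous_tensors_def add_0_right
        by (intro tensor_space.span_sum tensor_space.span_scale) simp
    qed
    show "?F (a * x # xs) = lmul (Suc (Suc n)) (twist 0 a) (?F (x # xs))" if "length xs = Suc (Suc n)" for a x xs
      using that bar_d_lmul[of "tensor (x # xs)" "Suc n" a] by (simp add: twist_even bar_d_tensor tpow_tensor)
    show "?F (xs @ [x * b]) = rmul (Suc (Suc n)) b (?F (xs @ [x]))" if "length xs = Suc (Suc n)" for b x xs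
    proof -
      have "?F (xs @ [x * b]) = (\<Sum>i\<le>Suc n. tscale ((-1) ^ i) (rmul (Suc (Suc n)) b (tensor (contract i (xs @ [x])))))"
        using that by (intro sum.cong refl) (simp add: rmul_contract)
      then show ?thesis
        using that by (simp only:) (rule linear_sum_tensor[OF tmap_linear[OF rmul], symmetric], simp add: tpow_tensor length_contract)
    qed
  qed
  then show ?thesis by (simp add: bar_d_eq bar_simps)
qed

lemma multilinear_augmentation: "multilinear scale scale 2 (\<lambda>xs. xs ! 0 * xs ! 1)"
  by (rule multilinear_bilinear)
    (auto simp: linear_on_set_def distrib_left distrib_right scale_mult_left[symmetric] scale_mult_right[symmetric])

lemma augmentation_eq: "augmentation = extend 2 scale (\<lambda>xs. xs ! 0 * xs ! 1)"
  unfolding augmentation_def by (rule lift_eq_extend[OF vector_space_scale multilinear_augmentation]) simp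

lemma augmentation_tensor [simp]: "augmentation (tensor [x, y]) = x * y"
  unfolding augmentation_eq by (simp add: extend_tensor[OF vector_space_scale multilinear_augmentation, simplified])

lemma augmentation_Hom: "augmentation \<in> Hom 0 (bar 0) algebra_module"
proof -
  have "extend (Suc (Suc 0)) (kscale algebra_module) (\<lambda>xs. xs ! 0 * xs ! 1) \<in> Hom 0 (bar 0) algebra_module"
    by (rule Hom_extendI[OF two_sided_algebra])
      (use vector_space_scale multilinear_augmentation in \<open>auto simp: algebra_module_simps numeral_2_eq_2 mult.assoc length_Suc_conv gr_mult twist_even\<close>)
  then show ?thesis by (simp add: augmentation_eq algebra_module_simps numeral_2_eq_2)
qed

text \<open>The formula of the differential also makes sense in degree \<open>0\<close>, where it is the augmentation, with the
  algebra identified with its first tensor power. Exactness thus has the same form in degree \<open>0\<close> as in the others.\<close>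

lemma bar_d_0: "bar_d 0 x = tensor [augmentation x]"
proof -
  have lin: "tlinear 2 scale augmentation"
    unfolding augmentation_eq by (rule tlinear_extend[OF vector_space_scale multilinear_augmentation])
  have slot: "linear_on_set UNIV scale tscale (\<lambda>x. tensor [x])" using tensor_slot[of "[]" "[]"] by simp
  show ?thesis
  proof (cases "x \<in> tpow 2")
    case True
    then have x: "x \<in> tpow (Suc (Suc 0))" by (simp add: numeral_2_eq_2)
    show ?thesis
    proof (rule linear_on_tpow_eqI[OF x tmap_linear[OF bar_d]])
      show "linear_on_set (tpow (Suc (Suc 0))) tscale tscale (\<lambda>x. tensor [augmentation x])"
        using linear_on_set_comp[OF tlinearD[OF lin] _ slot] by (simp add: numeral_2_eq_2)
      fix xs ts assume "length xs = Suc (Suc 0)" "has_degrees xs ts"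
      then obtain y z where "xs = [y, z]" by (auto simp: length_Suc_conv)
      then show "bar_d 0 (tensor xs) = tensor [augmentation (tensor xs)]" by (simp add: bar_d_tensor)
    qed
  next
    case False
    then show ?thesis
      using tensor_zero[of "[]" "[]"] tlinear_off[OF lin] tmap_off[OF bar_d[of 0]] by (simp add: numeral_2_eq_2)
  qed
qed

section \<open>Closure properties of homomorphisms\<close>

lemma Hom_tlinear: "f \<in> Hom t (bar p) N \<Longrightarrow> tlinear (Suc (Suc p)) (kscale N) f"
  by (simp add: Hom_def bar_simps tlinear_def)

lemma Hom_bar_tmap: "f \<in> Hom t (bar p) (bar q) \<Longrightarrow> tmap (Suc (Suc p)) (Suc (Suc q)) f"
proof -
  assume f: "f \<in> Hom t (bar p) (bar q)"
  have "f x \<in> tpow (Suc (Suc q))" for x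
    using f tlinear_off[OF Hom_tlinear[OF f], of x]
    by (cases "x \<in> tpow (Suc (Suc p))") (auto simp: Hom_def bar_simps)
  then show ?thesis using Hom_tlinear[OF f] by (simp add: tmap_def bar_simps)
qed

lemma Hom_comp:
  assumes "g \<in> Hom s (bar p) (bar q)" "f \<in> Hom t (bar q) N"
  shows "f \<circ> g \<in> Hom (s + t) (bar p) N"
proof -
  have f0: "f 0 = 0" by (rule linear_on_tpow_zero[OF tlinearD[OF Hom_tlinear[OF assms(2)]]])
  have "(\<forall>x\<in>homogeneous_tensors (Suc (Suc p)) u. f (g x) \<in> homog N (u + (s + t)))" for u
    using assms by (auto simp: Hom_def bar_simps image_subset_iff add.assoc[symmetric])
  then show ?thesis
    using assms f0 by (auto simp: Hom_def bar_simps zero_off_def linear_on_set_def image_subset_iff)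
qed

lemma tlinear_add: "vector_space sW \<Longrightarrow> tlinear n sW f \<Longrightarrow> tlinear n sW g \<Longrightarrow> tlinear n sW (\<lambda>x. f x + g x)"
  by (simp add: tlinear_def zero_off_def linear_on_set_add)

lemma tlinear_scale: "vector_space sW \<Longrightarrow> tlinear n sW f \<Longrightarrow> tlinear n sW (\<lambda>x. sW c (f x))"
proof -
  assume sW: "vector_space sW" and f: "tlinear n sW f"
  interpret W: vector_space sW by fact
  show ?thesis using f linear_on_set_scale[OF sW, of "tpow n" tscale f] by (simp add: tlinear_def zero_off_def)
qed

lemma Hom_add:
  assumes N: "two_sided N l r" and vsN: "vector_space (kscale N)"
    and fg: "f \<in> Hom t (bar p) N" "g \<in> Hom t (bar p) N"
  shows "(\<lambda>x. f x + g x) \<in> Hom t (bar p) N"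
  using N fg tlinear_add[OF vsN, of "Suc (Suc p)" f g]
  unfolding Hom_bar_iff[OF N]
  by (simp add: two_sided_def closed_linear_def linear_on_set_def image_subset_iff)

lemma Hom_scale:
  assumes N: "two_sided N l r" and vsN: "vector_space (kscale N)" and f: "f \<in> Hom t (bar p) N"
  shows "(\<lambda>x. kscale N c (f x)) \<in> Hom t (bar p) N"
  using N f tlinear_scale[OF vsN, of "Suc (Suc p)" f c]
  unfolding Hom_bar_iff[OF N]
  by (simp add: two_sided_def closed_linear_def linear_on_set_def image_subset_iff)

lemma Hom_diff_bar:
  assumes "f \<in> Hom t (bar p) (bar q)" "g \<in> Hom t (bar p) (bar q)"
  shows "(\<lambda>x. f x - g x) \<in> Hom t (bar p) (bar q)"
proof -
  have "vector_space (kscale (bar q))" by (simp add: bar_simps vector_space_tscale)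
  from Hom_add[OF two_sided_bar this assms(1) Hom_scale[OF two_sided_bar this assms(2), of "-1"]]
  show ?thesis by (simp add: bar_simps)
qed

lemma prepend_homogeneous:
  assumes "a \<in> gr s" "x \<in> homogeneous_tensors n u"
  shows "prepend n a x \<in> homogeneous_tensors (Suc n) (s + u)"
  using assms(2) unfolding homogeneous_tensors_def[of n]
proof (rule tensor_space_span_into[OF _ tmap_linear[OF prepend]])
  show "closed_linear tscale (homogeneous_tensors (Suc n) (s + u))"
    using homogeneous_tensors_subspace by (simp add: closed_linear_def)
next
  fix x assume "x \<in> {tensor xs | xs. length xs = n \<and> (\<exists>ts. has_degrees xs ts \<and> sum_list ts = u)}"
  then obtain xs ts where xs: "x = tensor xs" "length xs = n" "has_degrees xs ts" "sum_list ts = u" by blast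
  then show "prepend n a x \<in> homogeneous_tensors (Suc n) (s + u)"
    using tensor_homogeneous[of "a # xs" "s # ts"] assms(1) by simp
qed (auto intro: tpow_tensor)

section \<open>Exactness of the bar resolution\<close>

text \<open>The factorisation exists because \<open>bar p\<close> is free and cycles bound: \<open>\<psi>\<close> sends the generator
  \<open>(1, x\<^sub>1, \<dots>, x\<^sub>p, 1)\<close> to \<open>1\<close> prepended to its image under \<open>\<phi>\<close>. The formula also incorporates the first
  entry of the argument, through \<open>twist j\<close> since \<open>\<psi>\<close> has degree \<open>j\<close>; the last entry is taken care of by
  the right equivariance of \<open>\<phi>\<close>.\<close>

lemma bar_exact:
  assumes \<phi>: "\<phi> \<in> Hom j (bar p) (bar q)" and cycle: "\<And>x. bar_d q (\<phi> x) = 0"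
  shows "\<exists>\<psi>\<in>Hom j (bar p) (bar (Suc q)). \<forall>x. bar_d (Suc q) (\<psi> x) = \<phi> x"
proof
  let ?F = "\<lambda>xs. prepend (Suc (Suc q)) (twist j (hd xs)) (\<phi> (tensor (1 # tl xs)))"
  let ?\<psi> = "extend (Suc (Suc p)) (kscale (bar (Suc q))) ?F"
  note \<phi>_tmap = Hom_bar_tmap[OF \<phi>]
  have \<phi>_deg: "x \<in> homogeneous_tensors (Suc (Suc p)) u \<Longrightarrow> \<phi> x \<in> homogeneous_tensors (Suc (Suc q)) (u + j)"
    and \<phi>_left: "x \<in> tpow (Suc (Suc p)) \<Longrightarrow> \<phi> (lmul (Suc (Suc p)) a x) = lmul (Suc (Suc q)) (twist j a) (\<phi> x)"
    and \<phi>_right: "x \<in> tpow (Suc (Suc p)) \<Longrightarrow> \<phi> (rmul (Suc (Suc p)) a x) = rmul (Suc (Suc q)) a (\<phi> x)" for x u a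
    using \<phi> unfolding Hom_bar_iff[OF two_sided_bar] bar_simps image_subset_iff by auto
  have ml: "multilinear scale tscale (Suc (Suc p)) ?F"
  proof (rule multilinear_Cons)
    show "multilinear scale tscale (Suc p) (\<lambda>xs. prepend (Suc (Suc q)) (twist j x) (\<phi> (tensor (1 # xs))))" for x
      by (rule multilinear_comp_linear[OF multilinear_prepend _ linear_tmap_comp[OF tmap_linear[OF prepend] \<phi>_tmap]])
        (simp add: tpow_tensor)
    show "linear_on_set UNIV scale tscale (\<lambda>x. prepend (Suc (Suc q)) (twist j x) (\<phi> (tensor (1 # xs))))" for xs
      by (rule linear_on_set_comp[OF twist_linear _ prepend_linear]) simp
  qed
  show \<psi>: "?\<psi> \<in> Hom j (bar p) (bar (Suc q))"
  proof (rule Hom_extendI[OF two_sided_bar], unfold bar_simps)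
    show "vector_space (tscale :: 'k \<Rightarrow> ('k, 'a) tensor \<Rightarrow> _)" by (rule vector_space_tscale)
    show "multilinear scale tscale (Suc (Suc p)) ?F" by (rule ml)
    show "?F xs \<in> tpow (Suc (Suc (Suc q)))" for xs by (rule tmap_closed[OF prepend])
    show "?F xs \<in> homogeneous_tensors (Suc (Suc (Suc q))) (sum_list ts + j)"
      if xs: "length xs = Suc (Suc p)" "has_degrees xs ts" for xs ts
    proof -
      obtain x ys t us where x: "xs = x # ys" "ts = t # us" "x \<in> gr t" "has_degrees ys us"
        using xs by (cases xs) auto
      have "\<phi> (tensor (1 # ys)) \<in> homogeneous_tensors (Suc (Suc q)) (sum_list us + j)"
        by (rule \<phi>_deg, rule tensor_homogeneous[of _ "0 # us"]) (use x xs gr_one in auto)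
      then show ?thesis
        using prepend_homogeneous[OF twist_gr[OF x(3)], of "\<phi> (tensor (1 # ys))" "Suc (Suc q)" "sum_list us + j" j] x
        by (simp add: add.assoc)
    qed
    show "?F (a * x # xs) = lmul (Suc (Suc (Suc q))) (twist j a) (?F (x # xs))" for a x xs
      by (simp add: twist_mult lmul_prepend tmap_closed[OF \<phi>_tmap])
    show "?F (xs @ [x * b]) = rmul (Suc (Suc (Suc q))) b (?F (xs @ [x]))" if "length xs = Suc p" for b x xs
    proof -
      obtain y ys where xs: "xs = y # ys" "length ys = p" using \<open>length xs = Suc p\<close> by (cases xs) auto
      have "\<phi> (tensor (1 # ys @ [x * b])) = rmul (Suc (Suc q)) b (\<phi> (tensor (1 # ys @ [x])))"
        using \<phi>_right[of "tensor (1 # ys @ [x])" b] xs by (simp add: rmul_tensor_Cons tpow_tensor)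
      then show ?thesis using xs by (simp add: rmul_prepend tmap_closed[OF \<phi>_tmap])
    qed
  qed
  note \<psi>_tmap = Hom_bar_tmap[OF \<psi>]
  have val: "?\<psi> (tensor xs) = ?F xs" if "length xs = Suc (Suc p)" for xs
    using extend_tensor[OF vector_space_tscale ml that] by (simp add: bar_simps)
  show "\<forall>x. bar_d (Suc q) (?\<psi> x) = \<phi> x"
  proof
    fix x
    show "bar_d (Suc q) (?\<psi> x) = \<phi> x"
    proof (cases "x \<in> tpow (Suc (Suc p))")
      case True
      then show ?thesis
      proof (rule linear_on_tpow_eqI[OF _ linear_tmap_comp[OF tmap_linear[OF bar_d] \<psi>_tmap] tmap_linear[OF \<phi>_tmap]])
        fix xs ts assume "length xs = Suc (Suc p)" "has_degrees xs ts"
        then obtain y ys where xs: "xs = y # ys" "length ys = Suc p" by (cases xs) auto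
        have "bar_d (Suc q) (?\<psi> (tensor xs)) = lmul (Suc (Suc q)) (twist j y) (\<phi> (tensor (1 # ys)))"
          using xs by (simp add: val bar_d_prepend tmap_closed[OF \<phi>_tmap] cycle tmap_zero[OF prepend])
        also have "\<dots> = \<phi> (tensor xs)"
          using \<phi>_left[of "tensor (1 # ys)" y] xs by (simp add: tpow_tensor)
        finally show "bar_d (Suc q) (?\<psi> (tensor xs)) = \<phi> (tensor xs)" .
      qed
    next
      case False
      then show ?thesis by (simp add: tmap_off[OF \<psi>_tmap] tmap_off[OF \<phi>_tmap] tmap_zero[OF bar_d])
    qed
  qed
qed

section \<open>Cochains, cocycles and coboundaries\<close>

lemma cochains_comp:
  assumes "g \<in> Hom s (bar p) (bar q)" "f \<in> cochains q t"
  shows "f \<circ> g \<in> cochains p (t + s)"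
  using Hom_comp[OF assms(1), of f t algebra_module] assms(2) by (simp add: cochains_def add.commute)

lemma vector_space_algebra_module: "vector_space (kscale algebra_module)" by (simp add: algebra_module_simps vector_space_scale)

lemma cochains_add: "f \<in> cochains s t \<Longrightarrow> g \<in> cochains s t \<Longrightarrow> f + g \<in> cochains s t"
  unfolding cochains_def plus_fun_def by (rule Hom_add[OF two_sided_algebra vector_space_algebra_module])

lemma cochains_scale: "f \<in> cochains s t \<Longrightarrow> (\<lambda>x. scale c (f x)) \<in> cochains s t"
  unfolding cochains_def using Hom_scale[OF two_sided_algebra vector_space_algebra_module] by (simp add: algebra_module_simps)

lemma cochains_zero: "0 \<in> cochains s t"
  unfolding cochains_def Hom_bar_iff[OF two_sided_algebra]
  by (auto simp: algebra_module_simps zero_fun_def tlinear_def zero_off_def linear_on_set_zero[OF vector_space_scale])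

lemma cochain_iff:
  "f \<in> cochains s t \<longleftrightarrow> tlinear (Suc (Suc s)) scale f \<and> (\<forall>u. f ` homogeneous_tensors (Suc (Suc s)) u \<subseteq> gr (u + t)) \<and>
    (\<forall>x\<in>tpow (Suc (Suc s)). \<forall>a. f (lmul (Suc (Suc s)) a x) = twist t a * f x \<and> f (rmul (Suc (Suc s)) a x) = f x * a)"
  unfolding cochains_def Hom_bar_iff[OF two_sided_algebra] by (simp add: algebra_module_simps)

lemma cochain_left:
  assumes "f \<in> cochains s t" "length xs = Suc s"
  shows "f (tensor (a * x # xs)) = twist t a * f (tensor (x # xs))"
proof -
  have "tensor (x # xs) \<in> tpow (Suc (Suc s))" using assms by (intro tpow_tensor) simp
  then show ?thesis using assms unfolding cochain_iff by (metis lmul_tensor)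
qed

lemma cochain_right:
  assumes "f \<in> cochains s t" "length xs = Suc s"
  shows "f (tensor (xs @ [x * b])) = f (tensor (xs @ [x])) * b"
proof -
  have "tensor (xs @ [x]) \<in> tpow (Suc (Suc s))" using assms by (intro tpow_tensor) simp
  then show ?thesis using assms unfolding cochain_iff by (metis rmul_tensor)
qed

lemma cochain_degree:
  assumes "f \<in> cochains s t" "length xs = Suc (Suc s)" "has_degrees xs ts"
  shows "f (tensor xs) \<in> gr (sum_list ts + t)"
  using assms tensor_homogeneous[OF assms(3,2) refl] unfolding cochain_iff by blast

lemma cochain_tlinear: "f \<in> cochains s t \<Longrightarrow> tlinear (Suc (Suc s)) scale f"
  by (simp add: cochain_iff)

lemma cochain_linear: "f \<in> cochains s t \<Longrightarrow> linear_on_set (tpow (Suc (Suc s))) tscale scale f"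
  by (rule tlinearD[OF cochain_tlinear])

lemma cochain_zero: "f \<in> cochains s t \<Longrightarrow> f 0 = 0"
  by (rule linear_on_tpow_zero[OF cochain_linear])

lemma cochain_add: "f \<in> cochains s t \<Longrightarrow> x \<in> tpow (Suc (Suc s)) \<Longrightarrow> y \<in> tpow (Suc (Suc s)) \<Longrightarrow> f (x + y) = f x + f y"
  using cochain_linear[of f s t] by (simp add: linear_on_set_def)

lemma cochain_diff:
  assumes "f \<in> cochains s t" "x \<in> tpow (Suc (Suc s))" "y \<in> tpow (Suc (Suc s))" shows "f (x - y) = f x - f y"
  using cochain_add[OF assms(1), of "x - y" y] assms by (simp add: tpow_diff)

lemma cocycle_iff: "f \<in> cocycles s t \<longleftrightarrow> f \<in> cochains s t \<and> (\<forall>x. f (bar_d (Suc s) x) = 0)"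
  by (auto simp: cocycles_def zero_fun_def fun_eq_iff)

lemma cocycle_sum:
  assumes f: "f \<in> cocycles s t" and xs: "length xs = Suc (Suc (Suc s))"
  shows "(\<Sum>i\<le>Suc s. scale ((-1) ^ i) (f (tensor (contract i xs)))) = 0"
proof -
  have "(\<Sum>i\<le>Suc s. scale ((-1) ^ i) (f (tensor (contract i xs)))) = f (bar_d (Suc s) (tensor xs))"
    unfolding bar_d_tensor[OF xs]
    by (rule linear_sum_tensor[OF cochain_linear, symmetric])
      (use f xs in \<open>auto simp: cocycle_iff tpow_tensor length_contract\<close>)
  then show ?thesis using f by (simp add: cocycle_iff)
qed

lemma coboundaries_Suc: "coboundaries (Suc p) t = (\<lambda>g. g \<circ> bar_d (Suc p)) ` cochains p t"
  and coboundaries_0: "coboundaries 0 t = {0}"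
  by (simp_all add: coboundaries_def)

lemma coboundaries_zero: "0 \<in> coboundaries s t"
  by (cases s) (auto simp: coboundaries_0 coboundaries_Suc image_iff intro!: bexI[of _ 0] cochains_zero simp: fun_eq_iff zero_fun_def)

lemma coboundaries_add: "f \<in> coboundaries s t \<Longrightarrow> g \<in> coboundaries s t \<Longrightarrow> f + g \<in> coboundaries s t"
proof (cases s)
  case (Suc p)
  assume "f \<in> coboundaries s t" "g \<in> coboundaries s t"
  then obtain f' g' where "f' \<in> cochains p t" "g' \<in> cochains p t" "f = f' \<circ> bar_d (Suc p)" "g = g' \<circ> bar_d (Suc p)"
    by (auto simp: Suc coboundaries_Suc)
  then show ?thesis
    by (auto simp: Suc coboundaries_Suc image_iff fun_eq_iff plus_fun_def intro!: bexI[of _ "f' + g'"] cochains_add)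
qed (auto simp: coboundaries_0)

lemma coboundaries_scale: "f \<in> coboundaries s t \<Longrightarrow> (\<lambda>x. scale c (f x)) \<in> coboundaries s t"
proof (cases s)
  case (Suc p)
  assume "f \<in> coboundaries s t"
  then obtain f' where "f' \<in> cochains p t" "f = f' \<circ> bar_d (Suc p)"
    by (auto simp: Suc coboundaries_Suc)
  then show ?thesis
    by (auto simp: Suc coboundaries_Suc image_iff fun_eq_iff intro!: bexI[of _ "\<lambda>x. scale c (f' x)"] cochains_scale)
qed (auto simp: coboundaries_0 zero_fun_def)

lemma coboundaries_cocycles: "coboundaries s t \<subseteq> cocycles s t"
proof (cases s)
  case 0
  then show ?thesis by (auto simp: coboundaries_0 cocycle_iff cochains_zero zero_fun_apply)
next
  case (Suc p)
  have "f \<circ> bar_d (Suc p) \<in> cochains (Suc p) t" if "f \<in> cochains p t" for f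
    using cochains_comp[OF bar_d_Hom that] by simp
  then show ?thesis
    by (auto simp: Suc coboundaries_Suc cocycle_iff bar_d_bar_d cochain_zero)
qed

section \<open>Uniqueness of liftings\<close>

lemma liftingD:
  assumes "lifting n j \<eta> \<tau>"
  shows "\<tau> m \<in> Hom j (bar (m + n)) (bar m)" "bar_d (Suc m) (\<tau> (Suc m) x) = \<tau> m (bar_d (Suc (m + n)) x)"
    "augmentation (\<tau> 0 x) = \<eta> x"
  using assms by (auto simp: lifting_def fun_eq_iff)

lemma lifting_comp_cocycle:
  assumes "lifting n j \<eta> \<tau>" "\<zeta> \<in> cocycles m i"
  shows "\<zeta> \<circ> \<tau> m \<in> cocycles (m + n) (i + j)"
  using assms(2) cochains_comp[OF liftingD(1)[OF assms(1)], of \<zeta> m i] liftingD(2)[OF assms(1), of m]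
  by (auto simp: cocycle_iff) (metis )

lemma lifting_comp_coboundary:
  assumes "lifting n j \<eta> \<tau>" "\<zeta> \<in> coboundaries m i"
  shows "\<zeta> \<circ> \<tau> m \<in> coboundaries (m + n) (i + j)"
proof (cases m)
  case 0
  then show ?thesis using assms coboundaries_zero[of "m + n" "i + j"] by (simp add: coboundaries_0 comp_def zero_fun_def)
next
  case (Suc p)
  then obtain \<xi> where \<xi>: "\<xi> \<in> cochains p i" "\<zeta> = \<xi> \<circ> bar_d (Suc p)" using assms by (auto simp: coboundaries_Suc)
  have "\<zeta> \<circ> \<tau> m = (\<xi> \<circ> \<tau> p) \<circ> bar_d (Suc (p + n))"
    unfolding \<xi>(2) Suc by (rule ext) (simp add: liftingD(2)[OF assms(1)])
  then show ?thesis
    using cochains_comp[OF liftingD(1)[OF assms(1)] \<xi>(1)] Suc by (auto simp: coboundaries_Suc)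
qed

text \<open>The difference \<open>\<sigma>\<close> of the liftings is a chain map that lifts \<open>0\<close>, and \<open>bar_exact\<close> gives a homotopy \<open>h\<close> with
  \<open>\<sigma> (k + 1) = d \<circ> h (k + 1) + h k \<circ> d\<close>. Composing with \<open>\<zeta>\<close> kills the first summand, so \<open>\<zeta> \<circ> \<sigma>\<close> is the
  coboundary of \<open>\<zeta> \<circ> h\<close>.\<close>

theorem lifting_unique:
  assumes \<tau>: "lifting n j \<eta> \<tau>" and \<tau>': "lifting n j \<eta> \<tau>'" and \<zeta>: "\<zeta> \<in> cocycles m i"
  shows "(\<lambda>x. \<zeta> (\<tau> m x) - \<zeta> (\<tau>' m x)) \<in> coboundaries (m + n) (i + j)"
proof -
  define \<sigma> where "\<sigma> k x = \<tau> k x - \<tau>' k x" for k x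
  have \<sigma>: "\<sigma> k \<in> Hom j (bar (k + n)) (bar k)" for k
    unfolding \<sigma>_def by (rule Hom_diff_bar[OF liftingD(1)[OF \<tau>] liftingD(1)[OF \<tau>']])
  note tm = Hom_bar_tmap[OF liftingD(1)[OF \<tau>]] and tm' = Hom_bar_tmap[OF liftingD(1)[OF \<tau>']]
  have d\<sigma>: "bar_d (Suc k) (\<sigma> (Suc k) x) = \<sigma> k (bar_d (Suc (k + n)) x)" for k x
    by (simp add: \<sigma>_def tmap_diff[OF bar_d tmap_closed[OF tm] tmap_closed[OF tm']] liftingD(2)[OF \<tau>] liftingD(2)[OF \<tau>'])
  have d0: "bar_d 0 (\<sigma> 0 x) = 0" for x
    by (simp add: \<sigma>_def tmap_diff[OF bar_d tmap_closed[OF tm] tmap_closed[OF tm']] bar_d_0 liftingD(3)[OF \<tau>] liftingD(3)[OF \<tau>'])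
  \<comment> \<open>The right-hand side is a cycle because \<open>h\<close> satisfies the homotopy equation of the degree below on boundaries.\<close>
  have step: "\<exists>h'\<in>Hom j (bar (Suc k + n)) (bar (Suc (Suc k))).
      \<forall>x. bar_d (Suc (Suc k)) (h' x) = \<sigma> (Suc k) x - h (bar_d (Suc (k + n)) x)"
    if h: "h \<in> Hom j (bar (k + n)) (bar (Suc k))"
      "\<And>x. bar_d (Suc k) (h (bar_d (Suc (k + n)) x)) = \<sigma> k (bar_d (Suc (k + n)) x)" for h k
  proof (rule bar_exact)
    have "(\<lambda>x. h (bar_d (Suc (k + n)) x)) \<in> Hom j (bar (Suc k + n)) (bar (Suc k))"
      using Hom_comp[OF bar_d_Hom h(1)] by (simp add: comp_def)
    then show "(\<lambda>x. \<sigma> (Suc k) x - h (bar_d (Suc (k + n)) x)) \<in> Hom j (bar (Suc k + n)) (bar (Suc k))"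
      by (rule Hom_diff_bar[OF \<sigma>])
    show "bar_d (Suc k) (\<sigma> (Suc k) x - h (bar_d (Suc (k + n)) x)) = 0" for x
      by (simp add: tmap_diff[OF bar_d tmap_closed[OF Hom_bar_tmap[OF \<sigma>]] tmap_closed[OF Hom_bar_tmap[OF h(1)]]] d\<sigma> h(2))
  qed
  \<comment> \<open>Only the equation on boundaries passes through the induction; it follows from \<open>step\<close> as \<open>d\<^sup>2 = 0\<close>.\<close>
  have htpy: "\<exists>h\<in>Hom j (bar (k + n)) (bar (Suc k)).
      \<forall>x. bar_d (Suc k) (h (bar_d (Suc (k + n)) x)) = \<sigma> k (bar_d (Suc (k + n)) x)" for k
  proof (induction k)
    case 0
    show ?case using bar_exact[OF \<sigma> d0] by auto
  next
    case (Suc k)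
    then obtain h where h: "h \<in> Hom j (bar (k + n)) (bar (Suc k))"
      "\<And>x. bar_d (Suc k) (h (bar_d (Suc (k + n)) x)) = \<sigma> k (bar_d (Suc (k + n)) x)" by blast
    have "h 0 = 0" by (rule tmap_zero[OF Hom_bar_tmap[OF h(1)]])
    obtain h' where h': "h' \<in> Hom j (bar (Suc k + n)) (bar (Suc (Suc k)))"
      "\<And>x. bar_d (Suc (Suc k)) (h' x) = \<sigma> (Suc k) x - h (bar_d (Suc (k + n)) x)"
      using step[OF h] by blast
    show ?case by (rule bexI[OF _ h'(1)]) (simp add: h'(2) bar_d_bar_d \<open>h 0 = 0\<close>)
  qed
  have \<zeta>': "\<zeta> \<in> cochains m i" and \<zeta>d: "\<zeta> (bar_d (Suc m) x) = 0" for x using \<zeta> by (auto simp: cocycle_iff)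
  have eq: "\<zeta> (\<tau> m x) - \<zeta> (\<tau>' m x) = \<zeta> (\<sigma> m x)" for x
    by (simp add: \<sigma>_def cochain_diff[OF \<zeta>' tmap_closed[OF tm] tmap_closed[OF tm']])
  show ?thesis
  proof (cases m)
    case 0
    obtain h where "\<And>x. bar_d (Suc 0) (h x) = \<sigma> 0 x" using bar_exact[OF \<sigma> d0] by blast
    then have "\<zeta> (\<sigma> m x) = 0" for x using \<zeta>d 0 by metis
    then show ?thesis using coboundaries_zero[of "m + n" "i + j"] by (simp add: eq zero_fun_def)
  next
    case (Suc k)
    obtain h where h: "h \<in> Hom j (bar (k + n)) (bar (Suc k))"
      "\<And>x. bar_d (Suc k) (h (bar_d (Suc (k + n)) x)) = \<sigma> k (bar_d (Suc (k + n)) x)" using htpy[of k] by blast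
    let ?\<phi> = "\<lambda>x. \<sigma> (Suc k) x - h (bar_d (Suc (k + n)) x)"
    obtain h' where h': "\<And>x. bar_d (Suc (Suc k)) (h' x) = ?\<phi> x" using step[OF h] by blast
    have "\<zeta> (?\<phi> x) = 0" for x using \<zeta>d[of "h' x"] h'[of x] Suc by simp
    moreover have "\<zeta> (?\<phi> x) = \<zeta> (\<sigma> m x) - \<zeta> (h (bar_d (Suc (k + n)) x))" for x
      using cochain_diff[OF \<zeta>'] tmap_closed[OF Hom_bar_tmap[OF \<sigma>[of m]]] tmap_closed[OF Hom_bar_tmap[OF h(1)]] Suc by simp
    ultimately have "(\<lambda>x. \<zeta> (\<tau> m x) - \<zeta> (\<tau>' m x)) = (\<zeta> \<circ> h) \<circ> bar_d (Suc (k + n))"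
      by (simp add: fun_eq_iff eq)
    then show ?thesis
      using cochains_comp[OF h(1), of \<zeta> i] \<zeta>' Suc by (auto simp: coboundaries_Suc)
  qed
qed

section \<open>Two liftings of a cocycle\<close>

text \<open>The liftings of \<open>\<eta>\<close> that apply it to the last \<open>n + 1\<close> or to the first \<open>n + 1\<close> of \<open>m + n + 2\<close> entries. The
  first one moves a map of degree \<open>j\<close> past \<open>us\<close>, hence the twist; the second one moves it past nothing, but
  needs the sign \<open>(-1)\<^bsup>mn\<^esup>\<close> to commute with the differentials of the shift, which carry no sign.\<close>

definition right_lift :: "nat \<Rightarrow> int \<Rightarrow> (('k, 'a) tensor \<Rightarrow> 'a) \<Rightarrow> nat \<Rightarrow> ('k, 'a) tensor \<Rightarrow> ('k, 'a) tensor" where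
  "right_lift n j \<eta> m = extend (Suc (Suc (m + n))) tscale
     (\<lambda>xs. tensor (map (twist j) (take (Suc m) xs) @ [\<eta> (tensor (1 # drop (Suc m) xs))]))"

definition left_lift :: "nat \<Rightarrow> (('k, 'a) tensor \<Rightarrow> 'a) \<Rightarrow> nat \<Rightarrow> ('k, 'a) tensor \<Rightarrow> ('k, 'a) tensor" where
  "left_lift n \<eta> m = extend (Suc (Suc (m + n))) tscale
     (\<lambda>xs. tscale ((-1) ^ (m * n)) (tensor (\<eta> (tensor (take (Suc n) xs @ [1])) # drop (Suc n) xs)))"

lemma multilinear_right_lift:
  assumes "\<eta> \<in> cochains n j"
  shows "multilinear scale tscale (Suc (Suc (m + n)))
     (\<lambda>xs. tensor (map (twist j) (take (Suc m) xs) @ [\<eta> (tensor (1 # drop (Suc m) xs))]))"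
proof -
  have "multilinear scale tscale (Suc m + Suc n)
     (\<lambda>xs. tensor (map (twist j) (take (Suc m) xs) @ [\<eta> (tensor (1 # drop (Suc m) xs))]))"
  proof (rule multilinear_append)
    fix us :: "'a list"
    have "multilinear scale scale (Suc n) (\<lambda>vs. \<eta> (tensor (1 # vs)))"
      by (rule multilinear_comp_linear[OF multilinear_prepend _ cochain_linear[OF assms]]) (simp add: tpow_tensor)
    then show "multilinear scale tscale (Suc n) (\<lambda>vs. tensor (map (twist j) us @ [\<eta> (tensor (1 # vs))]))"
      by (rule multilinear_comp_linear[OF _ _ tensor_slot]) simp
  next
    fix vs :: "'a list"
    show "multilinear scale tscale (Suc m) (\<lambda>us. tensor (map (twist j) us @ [\<eta> (tensor (1 # vs))]))"
      using multilinear_map[OF multilinear_tensor[of "Suc m" "[]" "[\<eta> (tensor (1 # vs))]"] twist_linear] by simp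
  qed
  then show ?thesis by simp
qed

lemma multilinear_left_lift:
  assumes "\<eta> \<in> cochains n j"
  shows "multilinear scale tscale (Suc (Suc (m + n)))
     (\<lambda>xs. tscale ((-1) ^ (m * n)) (tensor (\<eta> (tensor (take (Suc n) xs @ [1])) # drop (Suc n) xs)))"
proof (rule multilinear_scale[OF vector_space_tscale])
  have "multilinear scale tscale (Suc n + Suc m)
     (\<lambda>xs. tensor (\<eta> (tensor (take (Suc n) xs @ [1])) # drop (Suc n) xs))"
  proof (rule multilinear_append)
    fix us :: "'a list"
    show "multilinear scale tscale (Suc m) (\<lambda>vs. tensor (\<eta> (tensor (us @ [1])) # vs))" by (rule multilinear_prepend)
  next
    fix vs :: "'a list"
    have "multilinear scale tscale (Suc n) (\<lambda>us. tensor (us @ [1]))"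
      using multilinear_tensor[of "Suc n" "[]" "[1]"] by simp
    then have "multilinear scale scale (Suc n) (\<lambda>us. \<eta> (tensor (us @ [1])))"
      by (rule multilinear_comp_linear[OF _ _ cochain_linear[OF assms]]) (simp add: tpow_tensor)
    then show "multilinear scale tscale (Suc n) (\<lambda>us. tensor (\<eta> (tensor (us @ [1])) # vs))"
      by (rule multilinear_comp_linear[OF _ _ tensor_slot[of "[]", simplified]]) simp
  qed
  then show "multilinear scale tscale (Suc (Suc (m + n)))
     (\<lambda>xs. tensor (\<eta> (tensor (take (Suc n) xs @ [1])) # drop (Suc n) xs))" by (simp add: add.commute)
qed

lemma right_lift_tensor:
  assumes "\<eta> \<in> cochains n j" "length us = Suc m" "length vs = Suc n"
  shows "right_lift n j \<eta> m (tensor (us @ vs)) = tensor (map (twist j) us @ [\<eta> (tensor (1 # vs))])"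
  unfolding right_lift_def using assms by (simp add: extend_tensor[OF vector_space_tscale multilinear_right_lift])

lemma left_lift_tensor:
  assumes "\<eta> \<in> cochains n j" "length us = Suc n" "length vs = Suc m"
  shows "left_lift n \<eta> m (tensor (us @ vs)) = tscale ((-1) ^ (m * n)) (tensor (\<eta> (tensor (us @ [1])) # vs))"
  unfolding left_lift_def using assms by (simp add: extend_tensor[OF vector_space_tscale multilinear_left_lift])

lemma right_lift_Hom:
  assumes \<eta>: "\<eta> \<in> cochains n j"
  shows "right_lift n j \<eta> m \<in> Hom j (bar (m + n)) (bar m)"
proof -
  let ?F = "\<lambda>xs. tensor (map (twist j) (take (Suc m) xs) @ [\<eta> (tensor (1 # drop (Suc m) xs))])"
  have "extend (Suc (Suc (m + n))) (kscale (bar m)) ?F \<in> Hom j (bar (m + n)) (bar m)"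
  proof (rule Hom_extendI[OF two_sided_bar], unfold bar_simps)
    show "vector_space (tscale :: 'k \<Rightarrow> ('k, 'a) tensor \<Rightarrow> _)" by (rule vector_space_tscale)
    show "multilinear scale tscale (Suc (Suc (m + n))) ?F" by (rule multilinear_right_lift[OF \<eta>])
    show "?F xs \<in> tpow (Suc (Suc m))" if "length xs = Suc (Suc (m + n))" for xs
      using that by (intro tpow_tensor) simp
    show "?F xs \<in> homogeneous_tensors (Suc (Suc m)) (sum_list ts + j)"
      if xs: "length xs = Suc (Suc (m + n))" "has_degrees xs ts" for xs ts
    proof -
      obtain ss us where ts: "ts = ss @ us" "has_degrees (take (Suc m) xs) ss" "has_degrees (drop (Suc m) xs) us"
        using xs(2) has_degrees_append[of "take (Suc m) xs" "drop (Suc m) xs" ts] by auto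
      have "\<eta> (tensor (1 # drop (Suc m) xs)) \<in> gr (sum_list (0 # us) + j)"
        by (rule cochain_degree[OF \<eta>]) (use xs ts gr_one in auto)
      then have "has_degrees (map (twist j) (take (Suc m) xs) @ [\<eta> (tensor (1 # drop (Suc m) xs))]) (ss @ [sum_list us + j])"
        unfolding has_degrees_append using has_degrees_twist[OF ts(2)] by auto
      then show ?thesis by (rule tensor_homogeneous) (use xs ts in auto)
    qed
    show "?F (a * x # xs) = lmul (Suc (Suc m)) (twist j a) (?F (x # xs))" if "length xs = Suc (m + n)" for a x xs
      using that by (simp add: twist_mult)
    show "?F (xs @ [x * b]) = rmul (Suc (Suc m)) b (?F (xs @ [x]))" if "length xs = Suc (m + n)" for b x xs
      using that cochain_right[OF \<eta>, of "1 # drop (Suc m) xs" x b] by simp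
  qed
  then show ?thesis by (simp add: right_lift_def bar_simps)
qed

lemma left_lift_Hom:
  assumes \<eta>: "\<eta> \<in> cochains n j"
  shows "left_lift n \<eta> m \<in> Hom j (bar (m + n)) (bar m)"
proof -
  let ?F = "\<lambda>xs. tscale ((-1) ^ (m * n)) (tensor (\<eta> (tensor (take (Suc n) xs @ [1])) # drop (Suc n) xs))"
  have "extend (Suc (Suc (m + n))) (kscale (bar m)) ?F \<in> Hom j (bar (m + n)) (bar m)"
  proof (rule Hom_extendI[OF two_sided_bar], unfold bar_simps)
    show "vector_space (tscale :: 'k \<Rightarrow> ('k, 'a) tensor \<Rightarrow> _)" by (rule vector_space_tscale)
    show "multilinear scale tscale (Suc (Suc (m + n))) ?F" by (rule multilinear_left_lift[OF \<eta>])
    show "?F xs \<in> tpow (Suc (Suc m))" if "length xs = Suc (Suc (m + n))" for xs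
      using that by (intro tpow_scale tpow_tensor) simp
    show "?F xs \<in> homogeneous_tensors (Suc (Suc m)) (sum_list ts + j)"
      if xs: "length xs = Suc (Suc (m + n))" "has_degrees xs ts" for xs ts
    proof -
      obtain ss us where ts: "ts = ss @ us" "has_degrees (take (Suc n) xs) ss" "has_degrees (drop (Suc n) xs) us"
        using xs(2) has_degrees_append[of "take (Suc n) xs" "drop (Suc n) xs" ts] by auto
      have "\<eta> (tensor (take (Suc n) xs @ [1])) \<in> gr (sum_list (ss @ [0]) + j)"
        by (rule cochain_degree[OF \<eta>]) (use xs ts gr_one in \<open>auto simp: has_degrees_append\<close>)
      then have "has_degrees (\<eta> (tensor (take (Suc n) xs @ [1])) # drop (Suc n) xs) ((sum_list ss + j) # us)"
        using ts by simp
      then show ?thesis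
        by (intro homogeneous_tensors_subspace(3) tensor_homogeneous) (use xs ts in auto)
    qed
    show "?F (a * x # xs) = lmul (Suc (Suc m)) (twist j a) (?F (x # xs))" if "length xs = Suc (m + n)" for a x xs
      using that cochain_left[OF \<eta>, of "take n xs @ [1]" a x] by (simp add: tmap_scale[OF lmul] tpow_tensor)
    show "?F (xs @ [x * b]) = rmul (Suc (Suc m)) b (?F (xs @ [x]))" if "length xs = Suc (m + n)" for b x xs
      using that by (simp add: tmap_scale[OF rmul] tpow_tensor rmul_tensor_Cons)
  qed
  then show ?thesis by (simp add: left_lift_def bar_simps)
qed

lemma tensor_slot_sum:
  "tensor (us @ (\<Sum>i\<in>I. scale (c i) (g i)) # vs) = (\<Sum>i\<in>I. tscale (c i) (tensor (us @ g i # vs)))"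
proof (induction I rule: infinite_finite_induct)
  case (insert i I)
  have "tensor (us @ (\<Sum>i\<in>insert i I. scale (c i) (g i)) # vs) =
      tensor (us @ (scale (c i) (g i) + (\<Sum>i\<in>I. scale (c i) (g i))) # vs)"
    using insert by simp
  also have "\<dots> = tscale (c i) (tensor (us @ g i # vs)) + (\<Sum>i\<in>I. tscale (c i) (tensor (us @ g i # vs)))"
    by (simp only: tensor_add tensor_scale insert.IH)
  finally show ?case using insert by simp
qed (simp_all add: tensor_zero)

lemma sum_atMost_split: "(\<Sum>i\<le>Suc (m + n). f i) = (\<Sum>i\<le>m. f i) + (\<Sum>k\<le>n. f (Suc m + k))"
  for f :: "nat \<Rightarrow> 'w::ab_group_add"
  by (induction n) (simp_all add: add_ac)

lemma contract_left:
  assumes "length us = Suc m" "i \<le> m"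
  shows "contract i (us @ a # vs) = contract i (us @ [a]) @ vs"
  using contract_append_left[of i "us @ [a]" vs] assms by simp

text \<open>The cocycle identity on \<open>(1, a, vs)\<close>, solved for the faces that do not touch the leading \<open>1\<close>.\<close>

lemma cocycle_sum_tail:
  assumes \<eta>: "\<eta> \<in> cocycles n j" and vs: "length vs = Suc n"
  shows "(\<Sum>k\<le>n. scale ((-1) ^ k) (\<eta> (tensor (1 # contract k (a # vs))))) = twist j a * \<eta> (tensor (1 # vs))"
proof -
  have \<eta>': "\<eta> \<in> cochains n j" using \<eta> by (simp add: cocycle_iff)
  have "\<eta> (tensor (a # vs)) - (\<Sum>k\<le>n. scale ((-1) ^ k) (\<eta> (tensor (1 # contract k (a # vs))))) = 0"
    using cocycle_sum[OF \<eta>, of "1 # a # vs"] vs by (simp add: sum.atMost_Suc_shift sum_negf del: sum.atMost_Suc)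
  then show ?thesis using cochain_left[OF \<eta>' vs, of a 1] by simp
qed

text \<open>The cocycle identity on \<open>(us, a, 1)\<close>, solved for the faces that do not touch the final \<open>1\<close>.\<close>

lemma cocycle_sum_init:
  assumes \<eta>: "\<eta> \<in> cocycles n j" and us: "length us = Suc n"
  shows "(\<Sum>i\<le>n. scale ((-1) ^ i) (\<eta> (tensor (contract i (us @ [a]) @ [1])))) = scale ((-1) ^ n) (\<eta> (tensor (us @ [1])) * a)"
proof -
  have \<eta>': "\<eta> \<in> cochains n j" using \<eta> by (simp add: cocycle_iff)
  have "(\<Sum>i\<le>n. scale ((-1) ^ i) (\<eta> (tensor (contract i (us @ [a, 1]))))) =
      (\<Sum>i\<le>n. scale ((-1) ^ i) (\<eta> (tensor (contract i (us @ [a]) @ [1]))))"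
    using us contract_left[of us n _ a "[1]"] by (intro sum.cong refl) simp
  moreover have "contract (Suc n) (us @ [a, 1]) = us @ [a]"
    using contract_append_right[of us 0 "[a, 1]"] us by simp
  ultimately show ?thesis
    using cocycle_sum[OF \<eta>, of "us @ [a, 1]"] us cochain_right[OF \<eta>' us, of 1 a] by simp
qed

text \<open>Split the faces of \<open>(us, a, vs)\<close> at \<open>a\<close>. Those inside \<open>(us, a)\<close> are faces of the image as well. Those inside
  \<open>(a, vs)\<close> add up, by the cocycle identity, to the last face of the image, which multiplies \<open>twist j a\<close> into
  the value of \<open>\<eta>\<close>.\<close>

lemma right_lift_lifting:
  assumes \<eta>: "\<eta> \<in> cocycles n j"
  shows "lifting n j \<eta> (right_lift n j \<eta>)"
proof -
  have \<eta>': "\<eta> \<in> cochains n j" using \<eta> by (simp add: cocycle_iff)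
  note R = right_lift_Hom[OF \<eta>'] and val = right_lift_tensor[OF \<eta>']
  note tm = Hom_bar_tmap[OF R]
  have chain: "bar_d (Suc m) \<circ> right_lift n j \<eta> (Suc m) = right_lift n j \<eta> m \<circ> bar_d (Suc m + n)" for m
  proof (rule tlinear_eqI)
    show "tlinear (Suc (Suc (Suc m + n))) tscale (bar_d (Suc m) \<circ> right_lift n j \<eta> (Suc m))"
      using Hom_tlinear[OF Hom_comp[OF R[of "Suc m"] bar_d_Hom]] by (simp add: bar_simps)
    show "tlinear (Suc (Suc (Suc m + n))) tscale (right_lift n j \<eta> m \<circ> bar_d (Suc m + n))"
      using Hom_tlinear[OF Hom_comp[OF bar_d_Hom R[of m]]] by (simp add: bar_simps)
    fix xs ts assume len: "length xs = Suc (Suc (Suc m + n))" "has_degrees xs ts"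
    define us a vs where "us = take (Suc m) xs" and "a = xs ! Suc m" and "vs = drop (Suc (Suc m)) xs"
    have xs: "xs = us @ a # vs" and us: "length us = Suc m" and vs: "length vs = Suc n"
      using len(1) by (simp_all add: us_def a_def vs_def id_take_nth_drop[of "Suc m" xs, symmetric])
    let ?w = "map (twist j) us" and ?c = "\<eta> (tensor (1 # vs))"
    let ?L = "\<lambda>i. tensor (contract i (?w @ [twist j a]) @ [?c])"
    have "right_lift n j \<eta> m (bar_d (Suc m + n) (tensor xs)) =
        (\<Sum>i\<le>Suc (m + n). tscale ((-1) ^ i) (right_lift n j \<eta> m (tensor (contract i xs))))"
      using len(1) by (simp add: bar_d_tensor del: sum.atMost_Suc)
        (rule linear_sum_tensor[OF tmap_linear[OF tm]], simp add: tpow_tensor length_contract)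
    also have "\<dots> = (\<Sum>i\<le>m. tscale ((-1) ^ i) (?L i)) +
        tscale ((-1) ^ Suc m) (\<Sum>k\<le>n. tscale ((-1) ^ k) (tensor (?w @ \<eta> (tensor (1 # contract k (a # vs))) # [])))"
      unfolding sum_atMost_split tensor_space.scale_sum_right
    proof (intro arg_cong2[of _ _ _ _ "(+)"] sum.cong refl)
      fix i assume "i \<in> {..m}"
      then show "tscale ((-1) ^ i) (right_lift n j \<eta> m (tensor (contract i xs))) = tscale ((-1) ^ i) (?L i)"
        using us vs contract_map[of "twist j" i "us @ [a]", OF twist_mult] contract_left[of us m i a vs]
        by (simp add: xs val length_contract)
    next
      fix k assume "k \<in> {..n}"
      then show "tscale ((-1) ^ (Suc m + k)) (right_lift n j \<eta> m (tensor (contract (Suc m + k) xs))) =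
          tscale ((-1) ^ Suc m) (tscale ((-1) ^ k) (tensor (?w @ \<eta> (tensor (1 # contract k (a # vs))) # [])))"
        using us vs contract_append_right[of us k "a # vs"]
        by (simp add: xs val length_contract power_add)
    qed
    also have "(\<Sum>k\<le>n. tscale ((-1) ^ k) (tensor (?w @ \<eta> (tensor (1 # contract k (a # vs))) # []))) =
        tensor (?w @ (\<Sum>k\<le>n. scale ((-1) ^ k) (\<eta> (tensor (1 # contract k (a # vs))))) # [])"
      by (simp only: tensor_slot_sum)
    also have "\<dots> = tensor (?w @ [twist j a * ?c])" by (simp add: cocycle_sum_tail[OF \<eta> vs])
    also have "(\<Sum>i\<le>m. tscale ((-1) ^ i) (?L i)) + tscale ((-1) ^ Suc m) (tensor (?w @ [twist j a * ?c])) =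
        bar_d (Suc m) (tensor (?w @ twist j a # [?c]))"
    proof -
      have "contract (Suc m) (?w @ twist j a # [?c]) = ?w @ [twist j a * ?c]"
        using contract_append_right[of ?w 0 "twist j a # [?c]"] us by simp
      moreover have "(\<Sum>i\<le>m. tscale ((-1) ^ i) (tensor (contract i (?w @ twist j a # [?c])))) = (\<Sum>i\<le>m. tscale ((-1) ^ i) (?L i))"
        using us contract_left[of ?w m _ "twist j a" "[?c]"] by (intro sum.cong refl) simp
      ultimately show ?thesis using us by (simp add: bar_d_tensor)
    qed
    also have "\<dots> = bar_d (Suc m) (right_lift n j \<eta> (Suc m) (tensor xs))"
      using val[of "us @ [a]" "Suc m" vs] us vs by (simp add: xs)
    finally show "(bar_d (Suc m) \<circ> right_lift n j \<eta> (Suc m)) (tensor xs) = (right_lift n j \<eta> m \<circ> bar_d (Suc m + n)) (tensor xs)"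
      by simp
  qed
  have "augmentation \<circ> right_lift n j \<eta> 0 = \<eta>"
  proof (rule tlinear_eqI)
    show "tlinear (Suc (Suc n)) scale (augmentation \<circ> right_lift n j \<eta> 0)"
      using Hom_tlinear[OF Hom_comp[OF R[of 0] augmentation_Hom]] by (simp add: algebra_module_simps)
    show "tlinear (Suc (Suc n)) scale \<eta>" by (rule cochain_tlinear[OF \<eta>'])
    fix xs ts assume "length xs = Suc (Suc n)" "has_degrees xs ts"
    then obtain x ys where "xs = x # ys" "length ys = Suc n" by (cases xs) auto
    then show "(augmentation \<circ> right_lift n j \<eta> 0) (tensor xs) = \<eta> (tensor xs)"
      using val[of "[x]" 0 ys] cochain_left[OF \<eta>', of ys x 1] by simp
  qed
  then show ?thesis unfolding lifting_def using R chain by blast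
qed

text \<open>The mirror image of the previous argument. The faces inside \<open>(us, a)\<close> now give the first face of the image
  with the sign \<open>(-1)\<^sup>n\<close>, and the faces inside \<open>(a, vs)\<close> are shifted by \<open>n + 1\<close> in place of \<open>1\<close>. So the
  differentials commute up to \<open>(-1)\<^sup>n\<close>, which is the quotient of the signs in degrees \<open>m + 1\<close> and \<open>m\<close>.\<close>

lemma left_lift_lifting:
  assumes \<eta>: "\<eta> \<in> cocycles n j"
  shows "lifting n j \<eta> (left_lift n \<eta>)"
proof -
  have \<eta>': "\<eta> \<in> cochains n j" using \<eta> by (simp add: cocycle_iff)
  note R = left_lift_Hom[OF \<eta>'] and val = left_lift_tensor[OF \<eta>']
  note tm = Hom_bar_tmap[OF R]
  have chain: "bar_d (Suc m) \<circ> left_lift n \<eta> (Suc m) = left_lift n \<eta> m \<circ> bar_d (Suc m + n)" for m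
  proof (rule tlinear_eqI)
    show "tlinear (Suc (Suc (Suc m + n))) tscale (bar_d (Suc m) \<circ> left_lift n \<eta> (Suc m))"
      using Hom_tlinear[OF Hom_comp[OF R[of "Suc m"] bar_d_Hom]] by (simp add: bar_simps)
    show "tlinear (Suc (Suc (Suc m + n))) tscale (left_lift n \<eta> m \<circ> bar_d (Suc m + n))"
      using Hom_tlinear[OF Hom_comp[OF bar_d_Hom R[of m]]] by (simp add: bar_simps)
    fix xs ts assume len: "length xs = Suc (Suc (Suc m + n))" "has_degrees xs ts"
    define us a vs where "us = take (Suc n) xs" and "a = xs ! Suc n" and "vs = drop (Suc (Suc n)) xs"
    have xs: "xs = us @ a # vs" and us: "length us = Suc n" and vs: "length vs = Suc m"
      using len(1) by (simp_all add: us_def a_def vs_def id_take_nth_drop[of "Suc n" xs, symmetric])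
    let ?c = "\<eta> (tensor (us @ [1]))"
    let ?s = "(-1) ^ (m * n) :: 'k"
    have "left_lift n \<eta> m (bar_d (Suc m + n) (tensor xs)) =
        (\<Sum>i\<le>Suc (n + m). tscale ((-1) ^ i) (left_lift n \<eta> m (tensor (contract i xs))))"
      using len(1) by (simp add: bar_d_tensor add.commute del: sum.atMost_Suc)
        (rule linear_sum_tensor[OF tmap_linear[OF tm]], simp add: tpow_tensor length_contract)
    also have "\<dots> = tscale ?s (\<Sum>i\<le>n. tscale ((-1) ^ i) (tensor ([] @ \<eta> (tensor (contract i (us @ [a]) @ [1])) # vs))) +
        tscale ?s (\<Sum>k\<le>m. tscale ((-1) ^ (Suc n + k)) (tensor (?c # contract k (a # vs))))"
      unfolding sum_atMost_split tensor_space.scale_sum_right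
    proof (intro arg_cong2[of _ _ _ _ "(+)"] sum.cong refl)
      fix i assume "i \<in> {..n}"
      then show "tscale ((-1) ^ i) (left_lift n \<eta> m (tensor (contract i xs))) =
          tscale ?s (tscale ((-1) ^ i) (tensor ([] @ \<eta> (tensor (contract i (us @ [a]) @ [1])) # vs)))"
        using us vs contract_left[of us n i a vs] by (simp add: xs val length_contract mult.commute)
    next
      fix k assume "k \<in> {..m}"
      then show "tscale ((-1) ^ (Suc n + k)) (left_lift n \<eta> m (tensor (contract (Suc n + k) xs))) =
          tscale ?s (tscale ((-1) ^ (Suc n + k)) (tensor (?c # contract k (a # vs))))"
        using us vs contract_append_right[of us k "a # vs"]
        by (simp add: xs val length_contract mult.commute)
    qed
    also have "(\<Sum>i\<le>n. tscale ((-1) ^ i) (tensor ([] @ \<eta> (tensor (contract i (us @ [a]) @ [1])) # vs))) =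
        tensor ([] @ (\<Sum>i\<le>n. scale ((-1) ^ i) (\<eta> (tensor (contract i (us @ [a]) @ [1])))) # vs)"
      by (simp only: tensor_slot_sum)
    also have "\<dots> = tscale ((-1) ^ n) (tensor (?c * a # vs))"
      by (simp only: cocycle_sum_init[OF \<eta> us] tensor_scale) simp
    also have "tscale ?s (tscale ((-1) ^ n) (tensor (?c * a # vs))) +
        tscale ?s (\<Sum>k\<le>m. tscale ((-1) ^ (Suc n + k)) (tensor (?c # contract k (a # vs)))) =
        tscale ((-1) ^ (Suc m * n)) (bar_d (Suc m) (tensor (?c # a # vs)))"
    proof -
      have "bar_d (Suc m) (tensor (?c # a # vs)) = tensor (?c * a # vs) + (\<Sum>k\<le>m. tscale ((-1) ^ Suc k) (tensor (?c # contract k (a # vs))))"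
        using vs by (simp add: bar_d_tensor sum.atMost_Suc_shift del: sum.atMost_Suc)
      then show ?thesis
        by (simp only: tensor_space.scale_right_distrib tensor_space.scale_sum_right tensor_space.scale_scale)
          (simp add: power_add mult_ac)
    qed
    also have "\<dots> = bar_d (Suc m) (left_lift n \<eta> (Suc m) (tensor xs))"
      using val[of us "a # vs" "Suc m"] us vs by (simp add: xs tmap_scale[OF bar_d] tpow_tensor)
    finally show "(bar_d (Suc m) \<circ> left_lift n \<eta> (Suc m)) (tensor xs) = (left_lift n \<eta> m \<circ> bar_d (Suc m + n)) (tensor xs)"
      by simp
  qed
  have "augmentation \<circ> left_lift n \<eta> 0 = \<eta>"
  proof (rule tlinear_eqI)
    show "tlinear (Suc (Suc n)) scale (augmentation \<circ> left_lift n \<eta> 0)"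
      using Hom_tlinear[OF Hom_comp[OF R[of 0] augmentation_Hom]] by (simp add: algebra_module_simps)
    show "tlinear (Suc (Suc n)) scale \<eta>" by (rule cochain_tlinear[OF \<eta>'])
    fix xs ts assume "length xs = Suc (Suc n)" "has_degrees xs ts"
    then obtain x ys where "xs = ys @ [x]" "length ys = Suc n" by (cases xs rule: rev_cases) auto
    then show "(augmentation \<circ> left_lift n \<eta> 0) (tensor xs) = \<eta> (tensor xs)"
      using val[of ys "[x]" 0] cochain_right[OF \<eta>', of ys 1 x] by simp
  qed
  then show ?thesis unfolding lifting_def using R chain by blast
qed

section \<open>The cup product as a composition\<close>

text \<open>Right equivariance of \<open>\<zeta>\<close> moves the value of \<open>\<eta>\<close> out of the last entry; the twists contribute the sign of
  the cup product.\<close>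

lemma cup_eq_right_lift:
  assumes \<zeta>: "\<zeta> \<in> cochains m i" and \<eta>: "\<eta> \<in> cochains n j"
  shows "cup m n j \<zeta> \<eta> = \<zeta> \<circ> right_lift n j \<eta> m"
  unfolding cup_def
proof (rule lift_eqI)
  show "tlinear (m + n + 2) scale (\<zeta> \<circ> right_lift n j \<eta> m)"
    using cochain_tlinear[OF cochains_comp[OF right_lift_Hom[OF \<eta>] \<zeta>]] by simp
  fix xs ts assume len: "length xs = m + n + 2" "has_degrees xs ts"
  define us vs where "us = take (m + 1) xs" and "vs = drop (m + 1) xs"
  have xs: "xs = us @ vs" and us: "length us = Suc m" and vs: "length vs = Suc n"
    using len(1) by (simp_all add: us_def vs_def)
  obtain ss rs where ts: "ts = ss @ rs" "has_degrees us ss"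
    using len(2) unfolding xs has_degrees_append by blast
  then have ss: "ss = take (m + 1) ts" "has_degrees us ss"
    using us list_all2_lengthD[of _ us ss] by (auto simp: has_degrees_def)
  let ?c = "\<eta> (tensor (1 # vs))"
  have "\<zeta> (right_lift n j \<eta> m (tensor xs)) = \<zeta> (tscale ((-1) powi (j * sum_list ss)) (tensor (us @ [1 * ?c])))"
    using tensor_twist_homogeneous_tensor[OF ss(2), of "[]" j "[?c]"] us vs
    by (simp add: xs right_lift_tensor[OF \<eta>])
  also have "\<dots> = scale ((-1) powi (j * sum_list ss)) (\<zeta> (tensor (us @ [1])) * ?c)"
    using cochain_linear[OF \<zeta>] us cochain_right[OF \<zeta>, of us 1 ?c] by (simp add: linear_on_set_def tpow_tensor)
  finally show "(\<zeta> \<circ> right_lift n j \<eta> m) (tensor xs) =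
      scale ((-1) powi (sum_list (take (m + 1) ts) * j)) (\<zeta> (tensor (take (m + 1) xs @ [1])) * \<eta> (tensor (1 # drop (m + 1) xs)))"
    by (simp add: ss(1) us_def vs_def mult.commute)
qed

text \<open>The value of \<open>\<eta>\<close> now is the first entry of the argument of \<open>\<zeta>\<close>, and moving it out costs a twist by \<open>i\<close>. Its
  degree is \<open>|us| + j\<close>: the part \<open>|us|\<close> gives the sign in the cup product of \<open>\<eta>\<close> and \<open>\<zeta>\<close>, and \<open>j\<close> gives
  the sign \<open>(-1)\<^bsup>ij\<^esup>\<close>.\<close>

lemma comp_left_lift:
  assumes \<zeta>: "\<zeta> \<in> cochains m i" and \<eta>: "\<eta> \<in> cochains n j"
  shows "\<zeta> \<circ> left_lift n \<eta> m = (\<lambda>x. scale ((-1) ^ (m * n) * (-1) powi (i * j)) (cup n m i \<eta> \<zeta> x))"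
proof (rule tlinear_eqI)
  show "tlinear (Suc (Suc (m + n))) scale (\<zeta> \<circ> left_lift n \<eta> m)"
    by (rule cochain_tlinear[OF cochains_comp[OF left_lift_Hom[OF \<eta>] \<zeta>]])
  have "cup n m i \<eta> \<zeta> \<in> cochains (m + n) (j + i)"
    using cochains_comp[OF right_lift_Hom[OF \<zeta>, of n] \<eta>] by (simp add: cup_eq_right_lift[OF \<eta> \<zeta>] add.commute)
  from cochain_tlinear[OF cochains_scale[OF this]]
  show "tlinear (Suc (Suc (m + n))) scale (\<lambda>x. scale ((-1) ^ (m * n) * (-1) powi (i * j)) (cup n m i \<eta> \<zeta> x))" .
  fix xs ts assume len: "length xs = Suc (Suc (m + n))" "has_degrees xs ts"
  define us vs where "us = take (Suc n) xs" and "vs = drop (Suc n) xs"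
  have xs: "xs = us @ vs" and us: "length us = Suc n" and vs: "length vs = Suc m"
    using len(1) by (simp_all add: us_def vs_def)
  obtain ss where ss: "has_degrees us ss"
    using len(2) unfolding xs has_degrees_append by auto
  let ?c = "\<eta> (tensor (us @ [1]))" and ?z = "\<zeta> (tensor (1 # vs))"
  have c: "?c \<in> gr (sum_list (ss @ [0]) + j)"
    by (rule cochain_degree[OF \<eta>]) (use us ss gr_one in \<open>auto simp: has_degrees_append\<close>)
  have \<zeta>_scale: "\<zeta> (tscale b (tensor ys)) = scale b (\<zeta> (tensor ys))" if "length ys = Suc (Suc m)" for b ys
    using cochain_linear[OF \<zeta>] that by (simp add: linear_on_set_def tpow_tensor)
  have \<eta>_scale: "\<eta> (tscale b (tensor ys)) = scale b (\<eta> (tensor ys))" if "length ys = Suc (Suc n)" for b ys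
    using cochain_linear[OF \<eta>] that by (simp add: linear_on_set_def tpow_tensor)
  have "\<zeta> (left_lift n \<eta> m (tensor xs)) = scale ((-1) ^ (m * n)) (twist i ?c * ?z)"
    using us vs cochain_left[OF \<zeta>, of vs ?c 1] by (simp add: xs left_lift_tensor[OF \<eta>] \<zeta>_scale)
  also have "twist i ?c = scale ((-1) powi (i * j)) (scale ((-1) powi (i * sum_list ss)) ?c)"
    using twist_homogeneous[OF c, of i] by (simp add: distrib_left minus_one_powi_add mult.commute)
  also have "scale ((-1) ^ (m * n)) (scale ((-1) powi (i * j)) (scale ((-1) powi (i * sum_list ss)) ?c) * ?z) =
      scale ((-1) ^ (m * n) * (-1) powi (i * j)) (scale ((-1) powi (i * sum_list ss)) (?c * ?z))"
    by (simp add: scale_mult_left[symmetric])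
  also have "scale ((-1) powi (i * sum_list ss)) (?c * ?z) = cup n m i \<eta> \<zeta> (tensor xs)"
    using tensor_twist_homogeneous_tensor[OF ss, of "[]" i "[?z]"] us vs cochain_right[OF \<eta>, of us 1 ?z]
    by (simp add: cup_eq_right_lift[OF \<eta> \<zeta>] xs right_lift_tensor[OF \<zeta>] \<eta>_scale)
  finally show "(\<zeta> \<circ> left_lift n \<eta> m) (tensor xs) = scale ((-1) ^ (m * n) * (-1) powi (i * j)) (cup n m i \<eta> \<zeta> (tensor xs))"
    by simp
qed

section \<open>The Hochschild cohomology groups\<close>

lemma cocycles_add: "f \<in> cocycles s t \<Longrightarrow> g \<in> cocycles s t \<Longrightarrow> f + g \<in> cocycles s t"
  by (simp add: cocycle_iff cochains_add plus_fun_apply)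

lemma cocycles_scale: "f \<in> cocycles s t \<Longrightarrow> (\<lambda>x. scale c (f x)) \<in> cocycles s t"
  by (simp add: cocycle_iff cochains_scale)

lemma cocycles_uminus: "f \<in> cocycles s t \<Longrightarrow> - f \<in> cocycles s t"
  using cocycles_scale[of f s t "-1"] by (simp add: fun_Compl_def)

lemma coboundaries_uminus: "f \<in> coboundaries s t \<Longrightarrow> - f \<in> coboundaries s t"
  using coboundaries_scale[of f s t "-1"] by (simp add: fun_Compl_def)

lemma comm_group_cocycles: "comm_group (cocycle_group s t)"
proof (rule comm_groupI)
  fix f assume "f \<in> carrier (cocycle_group s t)"
  then show "\<exists>g\<in>carrier (cocycle_group s t). g \<otimes>\<^bsub>cocycle_group s t\<^esub> f = \<one>\<^bsub>cocycle_group s t\<^esub>"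
    by (intro bexI[of _ "- f"]) (simp_all add: cocycle_group_def cocycles_uminus)
next
  show "\<one>\<^bsub>cocycle_group s t\<^esub> \<in> carrier (cocycle_group s t)"
    using subsetD[OF coboundaries_cocycles coboundaries_zero] by (simp add: cocycle_group_def)
qed (auto simp: cocycle_group_def cocycles_add add_ac)

lemma inv_cocycle:
  assumes "f \<in> cocycles s t" shows "inv\<^bsub>cocycle_group s t\<^esub> f = - f"
proof -
  interpret comm_group "cocycle_group s t" by (rule comm_group_cocycles)
  show ?thesis
    by (rule inv_equality) (use assms in \<open>simp_all add: cocycle_group_def cocycles_uminus\<close>)
qed

lemma subgroup_coboundaries: "subgroup (coboundaries s t) (cocycle_group s t)"
proof (unfold_locales)
  show "coboundaries s t \<subseteq> carrier (cocycle_group s t)"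
    using coboundaries_cocycles by (simp add: cocycle_group_def)
  show "inv\<^bsub>cocycle_group s t\<^esub> f \<in> coboundaries s t" if "f \<in> coboundaries s t" for f
    using that coboundaries_uminus[OF that] coboundaries_cocycles[of s t] by (auto simp: inv_cocycle)
qed (auto simp: cocycle_group_def coboundaries_add coboundaries_zero)

lemma normal_coboundaries: "coboundaries s t \<lhd> cocycle_group s t"
  by (rule comm_group.normal_iff_subgroup[THEN iffD2, OF comm_group_cocycles subgroup_coboundaries])

lemma comm_group_HH: "comm_group (HH s t)"
  unfolding HH_def by (rule comm_group.abelian_FactGroup[OF comm_group_cocycles subgroup_coboundaries])

lemma carrier_HH: "carrier (HH s t) = coho_class s t ` cocycles s t"
  by (auto simp: HH_def FactGroup_def RCOSETS_def coho_class_def cocycle_group_def)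

lemma mem_coho_class: "g \<in> coho_class s t f \<longleftrightarrow> g - f \<in> coboundaries s t"
  by (auto simp: coho_class_def r_coset_def cocycle_group_def intro: bexI[of _ "g - f"])

lemma coboundaries_diff: "f \<in> coboundaries s t \<Longrightarrow> g \<in> coboundaries s t \<Longrightarrow> f - g \<in> coboundaries s t"
  using coboundaries_add[of f s t "- g"] coboundaries_uminus[of g s t] by simp

lemma coho_class_eqI: "f - g \<in> coboundaries s t \<Longrightarrow> coho_class s t f = coho_class s t g"
proof -
  assume fg: "f - g \<in> coboundaries s t"
  have "h - f \<in> coboundaries s t \<longleftrightarrow> h - g \<in> coboundaries s t" for h
    using coboundaries_add[OF _ fg, of "h - f"] coboundaries_diff[OF _ fg, of "h - g"] by auto
  then show ?thesis by (auto simp: mem_coho_class)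
qed

lemma coho_class_self: "f \<in> coho_class s t f"
  by (simp add: mem_coho_class coboundaries_zero)

lemma coho_class_nonempty: "coho_class s t f \<noteq> {}"
  using coho_class_self by blast

lemma mem_coho_class_cocycle:
  assumes "f \<in> cocycles s t" "g \<in> coho_class s t f" shows "g \<in> cocycles s t"
proof -
  have "g - f \<in> cocycles s t" using assms(2) coboundaries_cocycles by (auto simp: mem_coho_class)
  from cocycles_add[OF this assms(1)] show ?thesis by simp
qed

lemma coho_class_add:
  "f \<in> cocycles s t \<Longrightarrow> g \<in> cocycles s t \<Longrightarrow>
     coho_class s t f \<otimes>\<^bsub>HH s t\<^esub> coho_class s t g = coho_class s t (f + g)"
  using normal.rcos_sum[OF normal_coboundaries, of f s t g]
  by (simp add: HH_def coho_class_def cocycle_group_def)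

lemma coho_class_sign:
  assumes f: "f \<in> cocycles s t"
  shows "coho_class s t f [^]\<^bsub>HH s t\<^esub> ((-1) ^ a * (-1) ^ b :: int) = coho_class s t (\<lambda>x. scale ((-1) ^ a * (-1) ^ b) (f x))"
proof -
  interpret comm_group "HH s t" by (rule comm_group_HH)
  have mem: "coho_class s t f \<in> carrier (HH s t)" "coho_class s t (- f) \<in> carrier (HH s t)"
    using f cocycles_uminus[OF f] by (auto simp: carrier_HH)
  have one: "\<one>\<^bsub>HH s t\<^esub> = coho_class s t 0"
    using group.inv_solve_left by (auto simp: HH_def FactGroup_def mem_coho_class)
  have neg: "inv\<^bsub>HH s t\<^esub> coho_class s t f = coho_class s t (- f)"
  proof (rule inv_equality[OF _ mem])
    show "coho_class s t (- f) \<otimes>\<^bsub>HH s t\<^esub> coho_class s t f = \<one>\<^bsub>HH s t\<^esub>"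
      using coho_class_add[OF cocycles_uminus[OF f] f] by (simp add: one)
  qed
  have sign: "(-1) ^ a * (-1) ^ b = (if even a = even b then 1 else -1 :: 'r::ring_1)" for a b
    by (cases "even a"; cases "even b") simp_all
  have "(\<lambda>x. scale (-1) (f x)) = - f" by (simp add: fun_Compl_def)
  moreover have "coho_class s t f [^]\<^bsub>HH s t\<^esub> (-1 :: int) = coho_class s t (- f)"
    using int_pow_neg[OF mem(1), of 1] mem neg by (simp add: int_pow_1)
  ultimately show ?thesis
    unfolding sign using int_pow_1[OF mem(1)] by (cases "even a = even b") simp_all
qed

section \<open>The products on cohomology\<close>

lemma cup_cocycles_eq: "\<zeta> \<in> cocycles m i \<Longrightarrow> \<eta> \<in> cocycles n j \<Longrightarrow> cup m n j \<zeta> \<eta> = \<zeta> \<circ> right_lift n j \<eta> m"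
  by (rule cup_eq_right_lift[of \<zeta> m i]) (simp_all add: cocycle_iff)

lemma lifting_class:
  assumes \<tau>: "lifting n j \<eta> \<tau>" and \<zeta>: "\<zeta> \<in> cocycles m i" and \<eta>: "\<eta> \<in> cocycles n j"
  shows "coho_class (m + n) (i + j) (\<zeta> \<circ> \<tau> m) = coho_class (m + n) (i + j) (cup m n j \<zeta> \<eta>)"
proof (rule coho_class_eqI)
  show "(\<zeta> \<circ> \<tau> m) - cup m n j \<zeta> \<eta> \<in> coboundaries (m + n) (i + j)"
    using lifting_unique[OF \<tau> right_lift_lifting[OF \<eta>] \<zeta>] by (simp add: cup_cocycles_eq[OF \<zeta> \<eta>] fun_diff_def)
qed

lemma cup_cocycle:
  assumes \<zeta>: "\<zeta> \<in> cocycles m i" and \<eta>: "\<eta> \<in> cocycles n j"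
  shows "cup m n j \<zeta> \<eta> \<in> cocycles (m + n) (i + j)"
  using lifting_comp_cocycle[OF right_lift_lifting[OF \<eta>] \<zeta>] by (simp add: cup_cocycles_eq[OF \<zeta> \<eta>])

text \<open>The left and the right lifting of \<open>\<eta>\<close> give the same class.\<close>

lemma cup_commute:
  assumes \<zeta>: "\<zeta> \<in> cocycles m i" and \<eta>: "\<eta> \<in> cocycles n j"
  shows "coho_class (m + n) (i + j) (cup m n j \<zeta> \<eta>) =
     coho_class (m + n) (i + j) (\<lambda>x. scale ((-1) ^ (m * n) * (-1) powi (i * j)) (cup n m i \<eta> \<zeta> x))"
proof -
  have "\<zeta> \<in> cochains m i" "\<eta> \<in> cochains n j" using \<zeta> \<eta> by (simp_all add: cocycle_iff)
  then show ?thesis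
    using lifting_class[OF left_lift_lifting[OF \<eta>] \<zeta> \<eta>] comp_left_lift[of \<zeta> m i \<eta> n j] by simp
qed

lemma cup_class_left:
  assumes \<zeta>: "\<zeta> \<in> cocycles m i" and \<zeta>': "\<zeta>' \<in> cocycles m i" "\<zeta>' - \<zeta> \<in> coboundaries m i" and \<eta>: "\<eta> \<in> cocycles n j"
  shows "cup m n j \<zeta>' \<eta> - cup m n j \<zeta> \<eta> \<in> coboundaries (m + n) (i + j)"
proof -
  have "cup m n j \<zeta>' \<eta> - cup m n j \<zeta> \<eta> = (\<zeta>' - \<zeta>) \<circ> right_lift n j \<eta> m"
    by (simp add: cup_cocycles_eq[OF \<zeta> \<eta>] cup_cocycles_eq[OF \<zeta>'(1) \<eta>] fun_eq_iff)
  then show ?thesis using lifting_comp_coboundary[OF right_lift_lifting[OF \<eta>] \<zeta>'(2)] by simp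
qed

text \<open>Independence of the first factor holds since liftings preserve coboundaries. Independence of the second
  factor is reduced to the first one by graded commutativity.\<close>

lemma cup_class:
  assumes \<zeta>: "\<zeta> \<in> cocycles m i" and \<zeta>': "\<zeta>' \<in> coho_class m i \<zeta>"
    and \<eta>: "\<eta> \<in> cocycles n j" and \<eta>': "\<eta>' \<in> coho_class n j \<eta>"
  shows "coho_class (m + n) (i + j) (cup m n j \<zeta>' \<eta>') = coho_class (m + n) (i + j) (cup m n j \<zeta> \<eta>)"
proof -
  have c: "\<zeta>' \<in> cocycles m i" "\<eta>' \<in> cocycles n j" using assms mem_coho_class_cocycle by auto
  let ?s = "(-1) ^ (m * n) * (-1) powi (i * j) :: 'k"
  have "coho_class (m + n) (i + j) (cup m n j \<zeta>' \<eta>') = coho_class (m + n) (i + j) (cup m n j \<zeta> \<eta>')"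
    by (rule coho_class_eqI, rule cup_class_left) (use \<zeta> \<zeta>' c in \<open>auto simp: mem_coho_class\<close>)
  also have "\<dots> = coho_class (m + n) (i + j) (\<lambda>x. scale ?s (cup n m i \<eta>' \<zeta> x))" by (rule cup_commute[OF \<zeta> c(2)])
  also have "\<dots> = coho_class (m + n) (i + j) (\<lambda>x. scale ?s (cup n m i \<eta> \<zeta> x))"
  proof (rule coho_class_eqI)
    have "cup n m i \<eta>' \<zeta> - cup n m i \<eta> \<zeta> \<in> coboundaries (n + m) (j + i)"
      by (rule cup_class_left) (use \<zeta> \<eta> \<eta>' c in \<open>auto simp: mem_coho_class\<close>)
    from coboundaries_scale[OF this, of ?s]
    show "(\<lambda>x. scale ?s (cup n m i \<eta>' \<zeta> x)) - (\<lambda>x. scale ?s (cup n m i \<eta> \<zeta> x)) \<in> coboundaries (m + n) (i + j)"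
      by (simp add: fun_diff_def scale_right_diff_distrib add.commute)
  qed
  also have "\<dots> = coho_class (m + n) (i + j) (cup m n j \<zeta> \<eta>)" by (rule cup_commute[OF \<zeta> \<eta>, symmetric])
  finally show ?thesis .
qed

lemma cup_product_class:
  assumes \<zeta>: "\<zeta> \<in> cocycles m i" and \<eta>: "\<eta> \<in> cocycles n j"
  shows "cup_product m i n j (coho_class m i \<zeta>) (coho_class n j \<eta>) = coho_class (m + n) (i + j) (cup m n j \<zeta> \<eta>)"
proof -
  have "cup_product m i n j (coho_class m i \<zeta>) (coho_class n j \<eta>) =
      (\<Union>\<zeta>'\<in>coho_class m i \<zeta>. \<Union>\<eta>'\<in>coho_class n j \<eta>. coho_class (m + n) (i + j) (cup m n j \<zeta> \<eta>))"
    unfolding cup_product_def by (intro SUP_cong refl cup_class[OF \<zeta> _ \<eta>])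
  then show ?thesis by (simp add: coho_class_nonempty)
qed

text \<open>The two products have the same value since every lifting may be replaced by the right one, and the right
  lifting also shows that there is one.\<close>

lemma yoneda_product_class:
  assumes \<zeta>: "\<zeta> \<in> cocycles m i" and \<eta>: "\<eta> \<in> cocycles n j"
  shows "yoneda_product m i n j (coho_class m i \<zeta>) (coho_class n j \<eta>) = coho_class (m + n) (i + j) (cup m n j \<zeta> \<eta>)"
proof -
  have "coho_class (m + n) (i + j) (\<zeta>' \<circ> \<tau> m) = coho_class (m + n) (i + j) (cup m n j \<zeta> \<eta>)"
    if "\<zeta>' \<in> coho_class m i \<zeta>" "\<eta>' \<in> coho_class n j \<eta>" "lifting n j \<eta>' \<tau>" for \<zeta>' \<eta>' \<tau>
    using lifting_class[OF that(3)] cup_class[OF \<zeta> that(1) \<eta> that(2)]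
      mem_coho_class_cocycle[OF \<zeta> that(1)] mem_coho_class_cocycle[OF \<eta> that(2)] by metis
  then have "yoneda_product m i n j (coho_class m i \<zeta>) (coho_class n j \<eta>) =
      (\<Union>\<zeta>'\<in>coho_class m i \<zeta>. \<Union>\<eta>'\<in>coho_class n j \<eta>. \<Union>\<tau>\<in>{\<tau>. lifting n j \<eta>' \<tau>}.
        coho_class (m + n) (i + j) (cup m n j \<zeta> \<eta>))"
    unfolding yoneda_product_def by (intro SUP_cong refl) simp
  also have "\<dots> = (\<Union>\<zeta>'\<in>coho_class m i \<zeta>. \<Union>\<eta>'\<in>coho_class n j \<eta>. coho_class (m + n) (i + j) (cup m n j \<zeta> \<eta>))"
  proof (intro SUP_cong refl)
    fix \<eta>' assume "\<eta>' \<in> coho_class n j \<eta>"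
    then have "{\<tau>. lifting n j \<eta>' \<tau>} \<noteq> {}"
      using right_lift_lifting[OF mem_coho_class_cocycle[OF \<eta>]] by blast
    then show "(\<Union>\<tau>\<in>{\<tau>. lifting n j \<eta>' \<tau>}. coho_class (m + n) (i + j) (cup m n j \<zeta> \<eta>)) =
        coho_class (m + n) (i + j) (cup m n j \<zeta> \<eta>)" by (simp only: UN_constant if_False)
  qed
  finally show ?thesis by (simp add: coho_class_nonempty)
qed

lemma lifting_add:
  assumes \<tau>: "lifting n j \<eta> \<tau>" and \<tau>': "lifting n j \<eta>' \<tau>'"
  shows "lifting n j (\<eta> + \<eta>') (\<lambda>m x. \<tau> m x + \<tau>' m x)"
proof -
  note tm = tmap_closed[OF Hom_bar_tmap[OF liftingD(1)[OF \<tau>]]] tmap_closed[OF Hom_bar_tmap[OF liftingD(1)[OF \<tau>']]]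
  have "(\<lambda>x. \<tau> m x + \<tau>' m x) \<in> Hom j (bar (m + n)) (bar m)" for m
    by (rule Hom_add[OF two_sided_bar _ liftingD(1)[OF \<tau>] liftingD(1)[OF \<tau>']]) (simp add: bar_simps vector_space_tscale)
  moreover have "bar_d (Suc m) (\<tau> (Suc m) x + \<tau>' (Suc m) x) = \<tau> m (bar_d (Suc (m + n)) x) + \<tau>' m (bar_d (Suc (m + n)) x)" for m x
    by (simp add: tmap_add[OF bar_d tm] liftingD(2)[OF \<tau>] liftingD(2)[OF \<tau>'])
  moreover have "augmentation (\<tau> 0 x + \<tau>' 0 x) = \<eta> x + \<eta>' x" for x
    using cochain_add[of augmentation 0 0, OF _ tm] augmentation_Hom
    by (simp add: cochains_def liftingD(3)[OF \<tau>] liftingD(3)[OF \<tau>'])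
  ultimately show ?thesis by (auto simp: lifting_def comp_def plus_fun_def)
qed

lemma lifting_comp:
  assumes \<sigma>: "lifting p q \<eta> \<sigma>" and \<tau>: "lifting u v \<theta> \<tau>"
  shows "lifting (p + u) (q + v) (\<eta> \<circ> \<tau> p) (\<lambda>k. \<sigma> k \<circ> \<tau> (k + p))"
proof -
  have "\<sigma> k \<circ> \<tau> (k + p) \<in> Hom (q + v) (bar (k + (p + u))) (bar k)" for k
    using Hom_comp[OF liftingD(1)[OF \<tau>, of "k + p"] liftingD(1)[OF \<sigma>, of k]] by (simp add: add_ac)
  moreover have "bar_d (Suc k) (\<sigma> (Suc k) (\<tau> (Suc k + p) x)) = \<sigma> k (\<tau> (k + p) (bar_d (Suc (k + (p + u))) x))" for k x
    using liftingD(2)[OF \<tau>, of "k + p" x] by (simp add: liftingD(2)[OF \<sigma>] add.assoc)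
  moreover have "augmentation (\<sigma> 0 (\<tau> p x)) = \<eta> (\<tau> p x)" for x by (rule liftingD(3)[OF \<sigma>])
  ultimately show ?thesis by (simp add: lifting_def fun_eq_iff comp_def)
qed

text \<open>The identity of a bar module, extended by \<open>0\<close> as all homomorphisms are.\<close>

definition bar_id :: "nat \<Rightarrow> ('k, 'a) tensor \<Rightarrow> ('k, 'a) tensor" where
  "bar_id m x = (if x \<in> tpow (Suc (Suc m)) then x else 0)"

lemma augmentation_cocycle: "augmentation \<in> cocycles 0 0"
proof -
  have c: "augmentation \<in> cochains 0 0" using augmentation_Hom by (simp add: cochains_def)
  have "augmentation (bar_d (Suc 0) x) = 0" for x
  proof (cases "x \<in> tpow (Suc (Suc (Suc 0)))")
    case True
    show ?thesis
    proof (rule linear_on_tpow_eqI[OF True linear_tmap_comp[OF cochain_linear[OF c] bar_d] linear_on_set_zero[OF vector_space_scale]])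
      fix xs ts assume "length xs = Suc (Suc (Suc 0))" "has_degrees xs ts"
      then obtain x y z where "xs = [x, y, z]" by (auto simp: length_Suc_conv)
      then show "augmentation (bar_d (Suc 0) (tensor xs)) = 0"
        by (simp add: bar_d_tensor cochain_diff[OF c] tpow_tensor mult.assoc)
    qed
  qed (simp add: tmap_off[OF bar_d] cochain_zero[OF c])
  then show ?thesis using c by (simp add: cocycle_iff)
qed

lemma bar_id_lifting: "lifting 0 0 augmentation bar_id"
proof -
  have "bar_id m \<in> Hom 0 (bar m) (bar m)" for m
    unfolding Hom_bar_iff[OF two_sided_bar] bar_simps
    using tmap_closed[OF lmul] tmap_closed[OF rmul] subsetD[OF homogeneous_tensors_subset]
    by (auto simp: tlinear_def zero_off_def linear_on_set_def bar_id_def tpow_add tpow_scale twist_even)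
  moreover have "bar_d (Suc m) (bar_id (Suc m) x) = bar_id m (bar_d (Suc m) x)" for m x
    by (simp add: bar_id_def tmap_closed[OF bar_d] tmap_off[OF bar_d] tmap_zero[OF bar_d])
  moreover have "augmentation (bar_id 0 x) = augmentation x" for x
    using augmentation_cocycle tlinear_off[OF cochain_tlinear, of augmentation 0 0 x]
    by (auto simp: bar_id_def cocycle_iff cochain_zero)
  ultimately show ?thesis by (simp add: lifting_def fun_eq_iff)
qed

text \<open>The statement is made for any product that is given on classes by the cup product of representatives, so
  that it covers the cup product and the Yoneda product at once.\<close>

theorem bigraded_commutative_ring_HH:
  assumes P: "\<And>m i n j \<zeta> \<eta>. \<zeta> \<in> cocycles m i \<Longrightarrow> \<eta> \<in> cocycles n j \<Longrightarrow>
    P m i n j (coho_class m i \<zeta>) (coho_class n j \<eta>) = coho_class (m + n) (i + j) (cup m n j \<zeta> \<eta>)"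
  shows "bigraded_commutative_ring HH P"
proof -
  have cc: "f \<in> cocycles s t \<Longrightarrow> f \<in> cochains s t" for f s t by (simp add: cocycle_iff)
  have left: "cup m n j (\<zeta> + \<zeta>') \<eta> = cup m n j \<zeta> \<eta> + cup m n j \<zeta>' \<eta>"
    if "\<zeta> \<in> cocycles m i" "\<zeta>' \<in> cocycles m i" "\<eta> \<in> cocycles n j" for \<zeta> \<zeta>' \<eta> m i n j
    using that
    by (simp add: cup_cocycles_eq[of _ m i] cocycles_add fun_eq_iff plus_fun_apply)
  have right: "coho_class (m + n) (i + j) (cup m n j \<zeta> (\<eta> + \<eta>')) = coho_class (m + n) (i + j) (cup m n j \<zeta> \<eta> + cup m n j \<zeta> \<eta>')"
    if \<zeta>: "\<zeta> \<in> cocycles m i" and \<eta>: "\<eta> \<in> cocycles n j" "\<eta>' \<in> cocycles n j" for \<zeta> \<eta> \<eta>' m i n j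
  proof -
    let ?\<tau> = "\<lambda>m x. right_lift n j \<eta> m x + right_lift n j \<eta>' m x"
    have "\<zeta> \<circ> ?\<tau> m = cup m n j \<zeta> \<eta> + cup m n j \<zeta> \<eta>'"
      using that tmap_closed[OF Hom_bar_tmap[OF right_lift_Hom]] cochain_add[OF cc[OF \<zeta>]]
      by (simp add: cc cup_cocycles_eq[of _ m i] fun_eq_iff plus_fun_apply)
    then show ?thesis
      using lifting_class[OF lifting_add[OF right_lift_lifting[OF \<eta>(1)] right_lift_lifting[OF \<eta>(2)]] \<zeta> cocycles_add[OF \<eta>]]
      by simp
  qed
  have assoc: "coho_class (s + p + u) (t + q + v) (cup (s + p) u v (cup s p q x y) z) =
      coho_class (s + p + u) (t + q + v) (cup s (p + u) (q + v) x (cup p u v y z))"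
    if x: "x \<in> cocycles s t" and y: "y \<in> cocycles p q" and z: "z \<in> cocycles u v" for x y z s t p q u v
  proof -
    have "cup p u v y z = y \<circ> right_lift u v z p" by (rule cup_eq_right_lift[OF cc[OF y] cc[OF z]])
    moreover have "cup (s + p) u v (cup s p q x y) z = x \<circ> (right_lift p q y s \<circ> right_lift u v z (s + p))"
      using cup_eq_right_lift[OF cc[OF cup_cocycle[OF x y]] cc[OF z]] cup_eq_right_lift[OF cc[OF x] cc[OF y]]
      by (simp add: comp_assoc)
    ultimately show ?thesis
      using lifting_class[OF lifting_comp[OF right_lift_lifting[OF y] right_lift_lifting[OF z]] x] cup_cocycle[OF y z]
      by (simp add: add.assoc)
  qed
  have unit_left: "cup 0 s t augmentation x = x" if x: "x \<in> cocycles s t" for x s t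
    using cup_eq_right_lift[OF cc[OF augmentation_cocycle] cc[OF x]] right_lift_lifting[OF x]
    by (simp add: lifting_def)
  have unit_right: "coho_class s t (cup s 0 0 x augmentation) = coho_class s t x" if x: "x \<in> cocycles s t" for x s t
  proof -
    have "x \<circ> bar_id s = x"
      using tlinear_off[OF cochain_tlinear[OF cc[OF x]]] cochain_zero[OF cc[OF x]] by (auto simp: fun_eq_iff bar_id_def)
    then show ?thesis using lifting_class[OF bar_id_lifting x augmentation_cocycle] by simp
  qed
  have "bigraded_ring HH P"
    unfolding bigraded_ring_def carrier_HH ball_simps
    by (intro conjI allI ballI comm_group_HH)
      (simp_all add: P coho_class_add cup_cocycle cocycles_add left right assoc flip: add.assoc,
       rule bexI[OF _ augmentation_cocycle], simp add: unit_left unit_right)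
  moreover have "P m i n j (coho_class m i \<zeta>) (coho_class n j \<eta>) =
      P n j m i (coho_class n j \<eta>) (coho_class m i \<zeta>) [^]\<^bsub>HH (m + n) (i + j)\<^esub> ((-1) ^ (m * n) * (-1) ^ nat \<bar>i * j\<bar> :: int)"
    if \<zeta>: "\<zeta> \<in> cocycles m i" and \<eta>: "\<eta> \<in> cocycles n j" for \<zeta> \<eta> m i n j
  proof -
    have sign: "(-1 :: 'k) powi (i * j) = (-1) ^ nat \<bar>i * j\<bar>" by (simp add: minus_one_powi minus_one_power_iff even_nat_iff)
    have mem: "cup n m i \<eta> \<zeta> \<in> cocycles (m + n) (i + j)"
      using cup_cocycle[OF \<eta> \<zeta>] by (simp only: add.commute[of n m] add.commute[of j i])
    have "P n j m i (coho_class n j \<eta>) (coho_class m i \<zeta>) = coho_class (m + n) (i + j) (cup n m i \<eta> \<zeta>)"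
      unfolding P[OF \<eta> \<zeta>] by (simp only: add.commute[of n m] add.commute[of j i])
    then show ?thesis
      by (simp only: P[OF \<zeta> \<eta>] cup_commute[OF \<zeta> \<eta>] sign coho_class_sign[OF mem])
  qed
  ultimately show ?thesis
    unfolding bigraded_commutative_ring_def carrier_HH ball_simps by blast
qed

end

theorem theorem5p3:
  fixes scale :: "'k::field \<Rightarrow> 'a::{ring,monoid_mult} \<Rightarrow> 'a"
    and gr :: "int \<Rightarrow> 'a set"
  assumes "graded_algebra scale gr"
  shows "bigraded_commutative_ring (graded_algebra.HH scale gr) (graded_algebra.cup_product scale gr) \<and>
         bigraded_commutative_ring (graded_algebra.HH scale gr) (graded_algebra.yoneda_product scale gr)"
proof -
  interpret graded_algebra scale gr by fact
  show ?thesis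
    by (intro conjI bigraded_commutative_ring_HH cup_product_class yoneda_product_class)
qed

end
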